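(* Let $(X,Y,\pi)$ be a factor triple. Let $\nu$ be an ergodic measure on $Y$, and let $\mu_1$ and $\mu_2$ be two distinct ergodic measures of relative maximal entropy over $\nu$. Then $$(\mu_1\otimes_\nu\mu_2)\{(u,v)\in X\times X: u\sim v\}=0,$$ where $\mu_1\otimes_\nu\mu_2$ is the relatively independent joining of $\mu_1$ and $\mu_2$ over $\nu$.
   Context: All shift spaces are one-dimensional, two-sided, over finite alphabets. A factor triple $(X,Y,\pi)$ consists of a shift of finite type $X$, a sofic shift $Y$ and a factor code (surjective continuous shift-commuting map) $\pi:X\to Y$. Measures are Borel probability measures; ergodic measures are shift-invariant. An ergodic measure of relative maximal entropy over $\nu$ is an ergodic measure on $X$ which projects to $\nu$ under $\pi$ and has maximal entropy among all invariant measures in the fibre $\pi^{-1}\{\nu\}$ (invariant measures on $X$ projecting to $\nu$). The relatively independent joining of invariant measures $\mu_1,\mu_2\in\pi^{-1}\{\nu\}$ over $\nu$ is the measure on $X\times X$ determined by $$(\mu_1\otimes_\nu\mu_2)(A_1\times A_2)=\int_Y \mathbb{E}_{\mu_1}(\mathbf 1_{A_1}|\pi^{-1}\mathscr{B}_Y)\circ\pi^{-1}\cdot\mathbb{E}_{\mu_2}(\mathbf 1_{A_2}|\pi^{-1}\mathscr{B}_Y)\circ\pi^{-1}\,d\nu$$ for measurable $A_1,A_2\subseteq X$, where $\mathscr{B}_Y$ is the Borel $\sigma$-algebra of $Y$ and a $\pi^{-1}\mathscr{B}_Y$-measurable function on $X$ composed with $\pi^{-1}$ denotes the corresponding function on $Y$.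 For $x,x'\in X$ write $x\to x'$ if for each integer $n$ there is $v\in X$ with $\pi(v)=\pi(x)=\pi(x')$, $v_j=x_j$ for all $j\le n$, and, for some $i\ge n$, $v_j=x'_j$ for all $j\ge i$. Write $x\sim x'$ if $x\to x'$ and $x'\to x$ (an equivalence relation). *)

theory Defs
  imports "HOL-Probability.Probability" "HOL-Library.Disjoint_Sets"
begin

section \<open>Shift spaces and factor codes\<close>

text \<open>
  Points of a shift space are bi-infinite sequences \<open>int \<Rightarrow> 'a\<close>. With \<open>'a :: discrete_topology\<close> the
  type-class topology on \<open>int \<Rightarrow> 'a\<close> is the product of the discrete topologies. The type \<open>'a\<close>
  itself may be infinite; each shift space uses only finitely many of its elements.
\<close>

definition shift :: "(int \<Rightarrow> 'a) \<Rightarrow> int \<Rightarrow> 'a" where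
  "shift x = (\<lambda>i. x (i + 1))"

definition occurs_in :: "'a list \<Rightarrow> (int \<Rightarrow> 'a) \<Rightarrow> bool" where
  "occurs_in w x \<longleftrightarrow> (\<exists>i. \<forall>j < length w. x (i + int j) = w ! j)"

definition shift_of_finite_type :: "(int \<Rightarrow> 'a) set \<Rightarrow> bool" where
  "shift_of_finite_type X \<longleftrightarrow>
     (\<exists>A F. finite A \<and> finite F \<and> X = {x. range x \<subseteq> A \<and> (\<forall>w \<in> F. \<not> occurs_in w x)})"

text \<open>Codes are total functions on sequences; only their values on \<open>X\<close> matter.\<close>

definition factor_code ::
  "(int \<Rightarrow> 'a::discrete_topology) set \<Rightarrow> (int \<Rightarrow> 'b::discrete_topology) set
    \<Rightarrow> ((int \<Rightarrow> 'a) \<Rightarrow> (int \<Rightarrow> 'b)) \<Rightarrow> bool" where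
  "factor_code X Y \<pi> \<longleftrightarrow>
     continuous_on X \<pi> \<and> \<pi> ` X = Y \<and> (\<forall>x \<in> X. \<pi> (shift x) = shift (\<pi> x))"

text \<open>
  A sofic shift is a factor of some shift of finite type. Up to renaming of symbols the finite
  alphabet of the latter may be taken inside \<open>nat\<close>.
\<close>

definition sofic_shift :: "(int \<Rightarrow> 'b::discrete_topology) set \<Rightarrow> bool" where
  "sofic_shift Y \<longleftrightarrow>
     (\<exists>(Z :: (int \<Rightarrow> nat) set) \<phi>. shift_of_finite_type Z \<and> factor_code Z Y \<phi>)"

definition factor_triple ::
  "(int \<Rightarrow> 'a::discrete_topology) set \<Rightarrow> (int \<Rightarrow> 'b::discrete_topology) set
    \<Rightarrow> ((int \<Rightarrow> 'a) \<Rightarrow> (int \<Rightarrow> 'b)) \<Rightarrow> bool" where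
  "factor_triple X Y \<pi> \<longleftrightarrow> shift_of_finite_type X \<and> sofic_shift Y \<and> factor_code X Y \<pi>"

section \<open>Invariant measures and entropy\<close>

abbreviation borel_on :: "'a::topological_space set \<Rightarrow> 'a measure" where
  "borel_on S \<equiv> restrict_space borel S"

definition invariant_measure ::
  "(int \<Rightarrow> 'a::discrete_topology) set \<Rightarrow> (int \<Rightarrow> 'a) measure \<Rightarrow> bool" where
  "invariant_measure X \<mu> \<longleftrightarrow>
     prob_space \<mu> \<and> sets \<mu> = sets (borel_on X) \<and> distr \<mu> \<mu> shift = \<mu>"

definition ergodic_measure ::
  "(int \<Rightarrow> 'a::discrete_topology) set \<Rightarrow> (int \<Rightarrow> 'a) measure \<Rightarrow> bool" where
  "ergodic_measure X \<mu> \<longleftrightarrow> invariant_measure X \<mu> \<and>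
     (\<forall>A \<in> sets \<mu>. shift -` A \<inter> space \<mu> = A \<longrightarrow> measure \<mu> A = 0 \<or> measure \<mu> A = 1)"

definition measurable_partition :: "'a measure \<Rightarrow> 'a set set \<Rightarrow> bool" where
  "measurable_partition M P \<longleftrightarrow> finite P \<and> P \<subseteq> sets M \<and> partition_on (space M) P"

text \<open>Since \<open>ln 0 = 0\<close>, null cells contribute \<open>0\<close>.\<close>

definition partition_entropy :: "'a measure \<Rightarrow> 'a set set \<Rightarrow> real" where
  "partition_entropy M P = - (\<Sum>A \<in> P. measure M A * ln (measure M A))"

text \<open>The join of the partitions \<open>T\<^sup>-\<^sup>i P\<close> for \<open>0 \<le> i < n\<close>.\<close>

definition iterated_partition ::
  "'a measure \<Rightarrow> ('a \<Rightarrow> 'a) \<Rightarrow> 'a set set \<Rightarrow> nat \<Rightarrow> 'a set set" where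
  "iterated_partition M T P n =
     common_refinement ((\<lambda>i. (\<lambda>A. (T ^^ i) -` A \<inter> space M) ` P) ` {..<n})"

text \<open>
  Kolmogorov--Sinai entropy (in nats) of a measure-preserving transformation. The limit exists by
  subadditivity; the supremum is taken in \<open>ereal\<close> so that no boundedness is presupposed.
\<close>

definition measure_entropy :: "'a measure \<Rightarrow> ('a \<Rightarrow> 'a) \<Rightarrow> ereal" where
  "measure_entropy M T =
     (SUP P \<in> {P. measurable_partition M P}.
        ereal (lim (\<lambda>n. partition_entropy M (iterated_partition M T P n) / real n)))"

definition invariant_fibre ::
  "(int \<Rightarrow> 'a::discrete_topology) set \<Rightarrow> (int \<Rightarrow> 'b::discrete_topology) set
    \<Rightarrow> ((int \<Rightarrow> 'a) \<Rightarrow> (int \<Rightarrow> 'b)) \<Rightarrow> (int \<Rightarrow> 'b) measure \<Rightarrow> (int \<Rightarrow> 'a) measure set" where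
  "invariant_fibre X Y \<pi> \<nu> = {\<mu>. invariant_measure X \<mu> \<and> distr \<mu> (borel_on Y) \<pi> = \<nu>}"

definition ergodic_relative_maximal_entropy ::
  "(int \<Rightarrow> 'a::discrete_topology) set \<Rightarrow> (int \<Rightarrow> 'b::discrete_topology) set
    \<Rightarrow> ((int \<Rightarrow> 'a) \<Rightarrow> (int \<Rightarrow> 'b)) \<Rightarrow> (int \<Rightarrow> 'b) measure \<Rightarrow> (int \<Rightarrow> 'a) measure \<Rightarrow> bool" where
  "ergodic_relative_maximal_entropy X Y \<pi> \<nu> \<mu> \<longleftrightarrow>
     ergodic_measure X \<mu> \<and> \<mu> \<in> invariant_fibre X Y \<pi> \<nu> \<and>
     (\<forall>\<mu>' \<in> invariant_fibre X Y \<pi> \<nu>. measure_entropy \<mu>' shift \<le> measure_entropy \<mu> shift)"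

section \<open>The relatively independent joining\<close>

text \<open>
  The conditional expectation of the indicator of \<open>A\<close> given the pullback of the Borel sets of \<open>Y\<close>,
  regarded as a function on \<open>Y\<close>. It is constant on the fibres of \<open>\<pi>\<close>, so evaluating it at the
  preimage picked by \<open>inv_into\<close> involves no choice; see \<open>fibre_cond_exp_apply\<close>.
\<close>

definition fibre_cond_exp ::
  "(int \<Rightarrow> 'a::discrete_topology) set \<Rightarrow> (int \<Rightarrow> 'b::discrete_topology) set
    \<Rightarrow> ((int \<Rightarrow> 'a) \<Rightarrow> (int \<Rightarrow> 'b)) \<Rightarrow> (int \<Rightarrow> 'a) measure \<Rightarrow> (int \<Rightarrow> 'a) set \<Rightarrow> (int \<Rightarrow> 'b) \<Rightarrow> real" where
  "fibre_cond_exp X Y \<pi> \<mu> A y =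
     real_cond_exp \<mu> (vimage_algebra X \<pi> (borel_on Y)) (indicator A) (inv_into X \<pi> y)"

lemma fibre_cond_exp_apply:
  assumes "\<pi> ` X = Y" and "x \<in> X"
  shows "fibre_cond_exp X Y \<pi> \<mu> A (\<pi> x) =
           real_cond_exp \<mu> (vimage_algebra X \<pi> (borel_on Y)) (indicator A) x"
proof -
  define F where "F = vimage_algebra X \<pi> (borel_on Y)"
  define g where "g = real_cond_exp \<mu> F (indicator A)"
  define x' where "x' = inv_into X \<pi> (\<pi> x)"
  have x': "x' \<in> X" "\<pi> x' = \<pi> x"
    unfolding x'_def using assms(2) by (simp_all add: inv_into_into f_inv_into_f[of _ \<pi> X])
  have "g \<in> borel_measurable F"
    unfolding g_def by simp
  then have "g -` {g x} \<inter> space F \<in> sets F"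
    by (rule measurable_sets) simp
  moreover have "\<pi> \<in> X \<rightarrow> space (borel_on Y)"
    using assms(1) by (auto simp: space_restrict_space)
  ultimately obtain B where "g -` {g x} \<inter> X = \<pi> -` B \<inter> X"
    unfolding F_def by (auto simp: sets_vimage_algebra2)
  then have "g x' = g x"
    using assms(2) x' by auto
  then show ?thesis
    by (simp add: fibre_cond_exp_def g_def F_def x'_def)
qed

definition relatively_independent_joining ::
  "(int \<Rightarrow> 'a::discrete_topology) set \<Rightarrow> (int \<Rightarrow> 'b::discrete_topology) set
    \<Rightarrow> ((int \<Rightarrow> 'a) \<Rightarrow> (int \<Rightarrow> 'b)) \<Rightarrow> (int \<Rightarrow> 'b) measure
    \<Rightarrow> (int \<Rightarrow> 'a) measure \<Rightarrow> (int \<Rightarrow> 'a) measure \<Rightarrow> ((int \<Rightarrow> 'a) \<times> (int \<Rightarrow> 'a)) measure" where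
  "relatively_independent_joining X Y \<pi> \<nu> \<mu>\<^sub>1 \<mu>\<^sub>2 =
     (THE \<Lambda>. sets \<Lambda> = sets (borel_on X \<Otimes>\<^sub>M borel_on X) \<and>
        (\<forall>A\<^sub>1 \<in> sets (borel_on X). \<forall>A\<^sub>2 \<in> sets (borel_on X).
           emeasure \<Lambda> (A\<^sub>1 \<times> A\<^sub>2) =
             ennreal (\<integral>y. fibre_cond_exp X Y \<pi> \<mu>\<^sub>1 A\<^sub>1 y * fibre_cond_exp X Y \<pi> \<mu>\<^sub>2 A\<^sub>2 y \<partial>\<nu>)))"

section \<open>The transition relation\<close>

definition transition ::
  "(int \<Rightarrow> 'a) set \<Rightarrow> ((int \<Rightarrow> 'a) \<Rightarrow> (int \<Rightarrow> 'b)) \<Rightarrow> (int \<Rightarrow> 'a) \<Rightarrow> (int \<Rightarrow> 'a) \<Rightarrow> bool" where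
  "transition X \<pi> x x' \<longleftrightarrow>
     (\<forall>n. \<exists>v \<in> X. \<pi> v = \<pi> x \<and> \<pi> x = \<pi> x' \<and> (\<forall>j \<le> n. v j = x j) \<and>
        (\<exists>i \<ge> n. \<forall>j \<ge> i. v j = x' j))"

definition transition_equiv ::
  "(int \<Rightarrow> 'a) set \<Rightarrow> ((int \<Rightarrow> 'a) \<Rightarrow> (int \<Rightarrow> 'b)) \<Rightarrow> (int \<Rightarrow> 'a) \<Rightarrow> (int \<Rightarrow> 'a) \<Rightarrow> bool" where
  "transition_equiv X \<pi> x x' \<longleftrightarrow> transition X \<pi> x x' \<and> transition X \<pi> x' x"

end

theory Submission
  imports Defs
begin

text \<open>
  The proof has two halves: maximal entropy forces a symmetry, and the symmetry allows the two
  coordinates of the joining to be exchanged.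

  \<^emph>\<open>Symmetry.\<close> Let \<open>T\<close> be an involution of \<open>X\<close> that rewrites the symbols in a finite block of
  coordinates, looking at that block only, without changing the image under \<open>\<pi>\<close>. Then \<open>T\<close>
  preserves every measure \<open>\<mu>\<close> of relative maximal entropy (\<open>maximal_entropy_block_involution\<close>).
  Otherwise place disjoint translates of the block periodically along the integers and apply \<open>T\<close> in
  each of them or not, according to independent fair coins. The new process still lies over \<open>\<nu>\<close>, and
  averaging over one period makes it shift invariant. A coin in one block replaces the law \<open>p\<close> of
  the words by the mean of \<open>p\<close> and \<open>p \<circ> T\<close>. The resulting increase of entropy is half the sum over
  all words \<open>v\<close> of the divergence of \<open>p v\<close> and \<open>p (T v)\<close> to their mean. This divergence is convex
  and homogeneous, hence subadditive (\<open>divergence_to_mean_sum_le\<close>), so the increase is at least what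
  the law of the block alone shows. That amount is the same positive number for each block, because
  the block still has its original law when its coin is tossed. The entropy rate therefore grows
  strictly, and by the Kolmogorov--Sinai theorem (\<open>measure_entropy_eq_entropy_rate\<close>) so does the
  entropy, against maximality.

  \<^emph>\<open>Exchange.\<close> Let \<open>\<Lambda>\<close> be the relatively independent joining. A pair of symmetries of the two
  measures over one and the same map of \<open>Y\<close> preserves \<open>\<Lambda>\<close> (\<open>joining_invariant\<close>). If \<open>u \<sim> v\<close>, a
  finite piece of \<open>u\<close> can be replaced by a detour that follows \<open>v\<close> for a while and comes back
  (\<open>transition_equiv_detour\<close>); exchanging these two pieces is a block involution. So if the
  equivalent pairs had positive measure, then so would the pairs that have the same image and agree
  on a window of length \<open>K\<close>, briefly, that meet (\<open>transition_equiv_null\<close>). By recurrence almost all of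
  these meet infinitely often in the past and in the future. Given a finite window, exchange the words
  of \<open>u\<close> and \<open>v\<close> from the last meeting before the window to the first one after it. In each coordinate
  this is a block involution, so \<open>\<Lambda>\<close> is preserved, and on the set of pairs meeting infinitely often
  both coordinates have the same law (\<open>often_swap_le\<close>). This law is shift invariant, non-zero and
  dominated by the two ergodic measures, hence a multiple of each of them
  (\<open>dominated_invariant_eq_multiple\<close>), and the two measures coincide (\<open>meeting_measures_equal\<close>).
\<close>

section \<open>Finite inequalities\<close>

text \<open>
  Fekete's lemma: division of \<open>n\<close> by a fixed \<open>k\<close> with remainder bounds \<open>a n\<close> by \<open>(n div k) * a k\<close>
  up to a constant, so the quotients converge to their infimum.
\<close>

lemma subadditive_quotient_converges:
  fixes a :: "nat \<Rightarrow> real"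
  assumes sub: "\<And>m n. a (m + n) \<le> a m + a n" and nonneg: "\<And>n. 0 \<le> a n"
  shows "convergent (\<lambda>n. a n / real n)"
proof -
  define L where "L = (INF n\<in>{1..}. a n / real n)"
  have bdd: "bdd_below ((\<lambda>n. a n / real n) ` {1..})"
    using nonneg by (intro bdd_belowI2[of _ 0]) auto
  have mult: "a (q * k + s) \<le> real q * a k + a s" for q k s
  proof (induction q)
    case (Suc q)
    have "a (Suc q * k + s) = a (k + (q * k + s))" by (simp add: algebra_simps)
    also have "\<dots> \<le> a k + a (q * k + s)" by (rule sub)
    also have "\<dots> \<le> a k + (real q * a k + a s)" using Suc by simp
    finally show ?case by (simp add: algebra_simps)
  qed simp
  have "(\<lambda>n. a n / real n) \<longlonglongrightarrow> L"
  proof (rule LIMSEQ_I)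
    fix e :: real assume e: "0 < e"
    have "(INF n\<in>{1..}. a n / real n) < L + e / 2" using e by (simp add: L_def)
    then obtain k where k: "k \<ge> 1" "a k / real k < L + e / 2"
      using bdd by (subst (asm) cINF_less_iff) auto
    define B where "B = (\<Sum>s<k. a s)"
    have aB: "a s \<le> B" if "s < k" for s
      unfolding B_def using that nonneg by (intro member_le_sum) auto
    obtain n0 where n0: "real n0 > 2 * B / e" using reals_Archimedean2 by blast
    show "\<exists>n0. \<forall>n\<ge>n0. norm (a n / real n - L) < e"
    proof (intro exI allI impI)
      fix n assume n: "n \<ge> max 1 n0"
      then have n1: "n \<ge> 1" by simp
      have low: "L \<le> a n / real n"
        unfolding L_def using n1 by (intro cINF_lower bdd) auto
      have "a n \<le> real (n div k) * a k + a (n mod k)"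
        using mult[of "n div k" k "n mod k"] by simp
      also have "\<dots> \<le> real (n div k) * a k + B" using aB[of "n mod k"] k by simp
      also have "real (n div k) * a k = (real (n div k) * real k) * (a k / real k)"
        using k by simp
      also have "(real (n div k) * real k) * (a k / real k) \<le> real n * (a k / real k)"
      proof (rule mult_right_mono)
        show "real (n div k) * real k \<le> real n"
          by (metis div_times_less_eq_dividend of_nat_le_iff of_nat_mult)
        show "0 \<le> a k / real k" using nonneg[of k] by simp
      qed
      finally have "a n \<le> real n * (a k / real k) + B" by simp
      then have "a n / real n \<le> (real n * (a k / real k) + B) / real n"
        by (intro divide_right_mono) auto
      also have "\<dots> = a k / real k + B / real n" using n1 by (simp add: add_divide_distrib)
      finally have "a n / real n \<le> a k / real k + B / real n" .
      moreover have "B / real n < e / 2"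
      proof -
        have "2 * B / e < real n" using n0 n by linarith
        then have "2 * B < real n * e" using e by (simp add: pos_divide_less_eq)
        then show ?thesis using n1 by (simp add: field_simps)
      qed
      ultimately have "a n / real n < L + e" using k by linarith
      then show "norm (a n / real n - L) < e" using low by simp
    qed
  qed
  then show ?thesis by (auto simp: convergent_def)
qed

text \<open>
  Pointwise \<open>p * ln (q / p) \<le> q - p\<close>, because \<open>ln x \<le> x - 1\<close>.
\<close>

lemma gibbs_inequality:
  fixes p q :: "'v \<Rightarrow> real"
  assumes "finite V" and p: "\<And>v. v \<in> V \<Longrightarrow> 0 \<le> p v" and q: "\<And>v. v \<in> V \<Longrightarrow> 0 \<le> q v"
    and ac: "\<And>v. v \<in> V \<Longrightarrow> 0 < p v \<Longrightarrow> 0 < q v" and le: "sum q V \<le> sum p V"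
  shows "(\<Sum>v\<in>V. p v * ln (q v)) \<le> (\<Sum>v\<in>V. p v * ln (p v))"
proof -
  have "p v * ln (q v) - p v * ln (p v) \<le> q v - p v" if v: "v \<in> V" for v
  proof (cases "p v = 0")
    case True then show ?thesis using q v by simp
  next
    case False
    then have pv: "0 < p v" using p v by force
    then have qv: "0 < q v" using ac v by auto
    have "ln (q v) - ln (p v) = ln (q v / p v)" using pv qv by (simp add: ln_div)
    also have "\<dots> \<le> q v / p v - 1" using pv qv by (intro ln_le_minus_one) simp
    finally have "p v * (ln (q v) - ln (p v)) \<le> p v * (q v / p v - 1)"
      using pv by (intro mult_left_mono) auto
    then show ?thesis using pv by (simp add: algebra_simps)
  qed
  then have "(\<Sum>v\<in>V. p v * ln (q v) - p v * ln (p v)) \<le> (\<Sum>v\<in>V. q v - p v)"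
    by (rule sum_mono)
  then show ?thesis using le by (simp add: sum_subtractf)
qed

text \<open>
  With \<open>c = (a + b) / 2\<close> this is \<open>a * ln (a / c) + b * ln (b / c)\<close>, which is the increase of the sum of
  \<open>- x * ln x\<close> when two masses \<open>a\<close> and \<open>b\<close> are both replaced by their mean.
\<close>

definition divergence_to_mean :: "real \<Rightarrow> real \<Rightarrow> real" where
  "divergence_to_mean a b = a * ln a + b * ln b - (a + b) * ln ((a + b) / 2)"

text \<open>
  The divergence is convex and homogeneous of degree one, so it lies above its linear tangent at
  \<open>(s, t)\<close>. The inequality is Gibbs' inequality for two masses, with \<open>(s, t)\<close> rescaled to the
  total mass \<open>a + b\<close>.
\<close>

lemma divergence_to_mean_le_tangent:
  assumes "0 \<le> a" "0 \<le> b" "0 < s" "0 < t" 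
  shows "a * ln s + b * ln t - (a + b) * ln ((s + t) / 2) \<le> divergence_to_mean a b"
proof (cases "a + b = 0")
  case True
  then have "a = 0" "b = 0" using assms by auto
  then show ?thesis by (simp add: divergence_to_mean_def)
next
  case False
  then have ab: "0 < a + b" using assms by simp
  define q where "q i = (if i then s else t) * ((a + b) / (s + t))" for i :: bool
  define p where "p i = (if i then a else b)" for i :: bool
  have st: "0 < s + t" using assms by simp
  have "(\<Sum>i\<in>UNIV. p i * ln (q i)) \<le> (\<Sum>i\<in>UNIV. p i * ln (p i))"
  proof (rule gibbs_inequality)
    have "sum q UNIV = s * c + t * c" if "c = (a + b) / (s + t)" for c
      using that by (simp add: q_def UNIV_bool)
    then have "sum q UNIV = (s + t) * ((a + b) / (s + t))" by (metis distrib_right)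
    then have "sum q UNIV = a + b" using st by simp
    then show "sum q UNIV \<le> sum p UNIV" by (simp add: p_def UNIV_bool)
  qed (use assms ab st in \<open>auto simp: p_def q_def\<close>)
  then have *: "a * ln (s * ((a + b) / (s + t))) + b * ln (t * ((a + b) / (s + t))) \<le> a * ln a + b * ln b"
    by (simp add: UNIV_bool p_def q_def)
  have l: "ln (r * ((a + b) / (s + t))) = ln r + ln ((a + b) / 2) - ln ((s + t) / 2)" if "0 < r" for r
    using that ab st by (simp add: ln_mult ln_div)
  show ?thesis
    using * unfolding l[OF assms(3)] l[OF assms(4)] divergence_to_mean_def by (simp add: algebra_simps)
qed

lemma divergence_to_mean_nonneg:
  assumes "0 \<le> a" "0 \<le> b" shows "0 \<le> divergence_to_mean a b"
  using divergence_to_mean_le_tangent[OF assms, of 1 1] by simp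

lemma divergence_to_mean_pos:
  assumes "0 \<le> a" "0 \<le> b" "a \<noteq> b" shows "0 < divergence_to_mean a b"
proof -
  have *: "0 < divergence_to_mean a b" if ab: "0 \<le> a" "a < b" for a b
  proof (cases "a = 0")
    case True
    then show ?thesis using ab by (simp add: divergence_to_mean_def ln_div algebra_simps)
  next
    case False
    then have a: "0 < a" and b: "0 < b" using ab by auto
    define m where "m = (a + b) / 2"
    have m: "0 < m" "m \<noteq> a" "m \<noteq> b" using a b ab by (auto simp: m_def)
    have "ln (m / a) < m / a - 1" using m a
      by (smt (verit, ccfv_threshold) divide_eq_1_iff ln_eq_minus_one ln_le_minus_one divide_pos_pos)
    then have 1: "a * ln (m / a) < m - a" using a by (simp add: field_simps)
    have "ln (m / b) \<le> m / b - 1" using m b by (intro ln_le_minus_one) auto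
    then have 2: "b * ln (m / b) \<le> m - b" using b by (simp add: field_simps)
    have "a * ln (m / a) + b * ln (m / b) < 0" using 1 2 by (simp add: m_def)
    then show ?thesis using a b m(1) 
      by (simp add: divergence_to_mean_def ln_div m_def[symmetric] algebra_simps)
  qed
  have sym: "divergence_to_mean a b = divergence_to_mean b a"
    by (simp add: divergence_to_mean_def add.commute)
  show ?thesis
    using assms *[of a b] *[of b a] sym by (cases "a < b") auto
qed

text \<open>
  All the points \<open>(a i, b i)\<close> lie above the tangent at their sum. If a coordinate of the sum vanishes
  there is no tangent, but then the divergence is linear in the other one.
\<close>

lemma divergence_to_mean_sum_le:
  assumes fin: "finite I" and a: "\<And>i. i \<in> I \<Longrightarrow> 0 \<le> a i" and b: "\<And>i. i \<in> I \<Longrightarrow> 0 \<le> b i"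
  shows "divergence_to_mean (sum a I) (sum b I) \<le> (\<Sum>i\<in>I. divergence_to_mean (a i) (b i))"
proof -
  define s t where "s = sum a I" and "t = sum b I"
  have st: "0 \<le> s" "0 \<le> t" unfolding s_def t_def using a b by (auto intro: sum_nonneg)
  consider "0 < s" "0 < t" | "s = 0" | "t = 0" using st by fastforce
  then show ?thesis
  proof cases
    case 1
    have "divergence_to_mean s t = (\<Sum>i\<in>I. a i * ln s + b i * ln t - (a i + b i) * ln ((s + t) / 2))"
      by (simp add: divergence_to_mean_def s_def t_def sum_subtractf sum.distrib sum_distrib_right algebra_simps)
    also have "\<dots> \<le> (\<Sum>i\<in>I. divergence_to_mean (a i) (b i))"
      using 1 a b by (intro sum_mono divergence_to_mean_le_tangent) auto
    finally show ?thesis by (simp add: s_def t_def)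
  next
    case 2
    then have a0: "a i = 0" if "i \<in> I" for i
      using that fin a unfolding s_def by (simp add: sum_nonneg_eq_0_iff)
    have d: "divergence_to_mean 0 y = y * ln 2" if "0 \<le> y" for y
      using that by (cases "y = 0") (auto simp: divergence_to_mean_def ln_div algebra_simps)
    have "(\<Sum>i\<in>I. divergence_to_mean (a i) (b i)) = (\<Sum>i\<in>I. b i * ln 2)"
      using a0 d b by (intro sum.cong) auto
    also have "\<dots> = t * ln 2" by (simp add: t_def sum_distrib_right)
    finally show ?thesis using d[OF st(2)] 2 by (simp add: s_def t_def)
  next
    case 3
    then have a0: "b i = 0" if "i \<in> I" for i
      using that fin b unfolding t_def by (simp add: sum_nonneg_eq_0_iff)
    have d: "divergence_to_mean y 0 = y * ln 2" if "0 \<le> y" for y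
      using that by (cases "y = 0") (auto simp: divergence_to_mean_def ln_div algebra_simps)
    have "(\<Sum>i\<in>I. divergence_to_mean (a i) (b i)) = (\<Sum>i\<in>I. a i * ln 2)"
      using a0 d a by (intro sum.cong) auto
    also have "\<dots> = s * ln 2" by (simp add: s_def sum_distrib_right)
    finally show ?thesis using d[OF st(1)] 3 by (simp add: s_def t_def)
  qed
qed

text \<open>
  Since \<open>t\<close> permutes \<open>V\<close>, the entropies of \<open>p\<close> and of \<open>p \<circ> t\<close> agree, so that half of each can be
  compared with the entropy of the mean.
\<close>

lemma symmetrization_entropy_gain:
  fixes p :: "'v \<Rightarrow> real"
  assumes fin: "finite V" and t: "\<And>v. v \<in> V \<Longrightarrow> t v \<in> V" "\<And>v. v \<in> V \<Longrightarrow> t (t v) = v"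
  shows "(\<Sum>v\<in>V. p v * ln (p v)) - (\<Sum>v\<in>V. (p v + p (t v)) / 2 * ln ((p v + p (t v)) / 2))
       = (\<Sum>v\<in>V. divergence_to_mean (p v) (p (t v))) / 2"
proof -
  have bij: "bij_betw t V V"
    by (rule bij_betwI[of _ _ _ t]) (use t in auto)
  have "(\<Sum>v\<in>V. p (t v) * ln (p (t v))) = (\<Sum>v\<in>V. p v * ln (p v))"
    by (rule sum.reindex_bij_betw[OF bij])
  moreover have "2 * (\<Sum>v\<in>V. (p v + p (t v)) / 2 * ln ((p v + p (t v)) / 2))
      = (\<Sum>v\<in>V. (p v + p (t v)) * ln ((p v + p (t v)) / 2))"
    by (simp add: sum_distrib_left)
  ultimately show ?thesis
    by (simp add: divergence_to_mean_def sum_subtractf sum.distrib)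
qed

text \<open>
  An observation \<open>g\<close> that carries \<open>t\<close> to an involution \<open>s\<close> sees at most the divergence of the full
  law: subadditivity within the fibres of \<open>g\<close>. Below, \<open>v\<close> is a word over many blocks and \<open>g v\<close> its
  restriction to one of them.
\<close>

lemma divergence_to_mean_image_le:
  fixes p :: "'v \<Rightarrow> real" and g :: "'v \<Rightarrow> 'b"
  assumes fin: "finite V" and p: "\<And>v. v \<in> V \<Longrightarrow> 0 \<le> p v"
    and t: "\<And>v. v \<in> V \<Longrightarrow> t v \<in> V" "\<And>v. v \<in> V \<Longrightarrow> t (t v) = v"
    and s: "\<And>v. v \<in> V \<Longrightarrow> g (t v) = s (g v)" 
    and B: "g ` V \<subseteq> B" "finite B" and ss: "\<And>b. b \<in> B \<Longrightarrow> s (s b) = b"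
    and r: "\<And>b. b \<in> B \<Longrightarrow> r b = (\<Sum>v\<in>{v\<in>V. g v = b}. p v)"
    and sB: "\<And>b. b \<in> B \<Longrightarrow> s b \<in> B"
  shows "(\<Sum>b\<in>B. divergence_to_mean (r b) (r (s b))) \<le> (\<Sum>v\<in>V. divergence_to_mean (p v) (p (t v)))"
proof -
  have rs: "r (s b) = (\<Sum>v\<in>{v\<in>V. g v = b}. p (t v))" if b: "b \<in> B" for b
  proof -
    have "bij_betw t {v\<in>V. g v = b} {v\<in>V. g v = s b}"
      by (rule bij_betwI[of _ _ _ t]) (use t s ss b in auto)
    from sum.reindex_bij_betw[OF this, of p] show ?thesis
      using r[OF sB[OF b]] by simp
  qed
  have "(\<Sum>b\<in>B. divergence_to_mean (r b) (r (s b))) 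
      \<le> (\<Sum>b\<in>B. \<Sum>v\<in>{v\<in>V. g v = b}. divergence_to_mean (p v) (p (t v)))"
    using fin p t(1) by (intro sum_mono) (auto simp: r rs intro!: divergence_to_mean_sum_le)
  also have "\<dots> = (\<Sum>v\<in>V. divergence_to_mean (p v) (p (t v)))"
    by (rule sum.group) (use fin B in auto)
  finally show ?thesis .
qed

section \<open>Entropy of finite-valued functions\<close>

lemma restrict_eq_iff: "restrict f I = restrict g I \<longleftrightarrow> (\<forall>i\<in>I. f i = g i)"
  by (metis restrict_apply' restrict_ext)

definition fun_entropy :: "'a measure \<Rightarrow> ('a \<Rightarrow> 'v) \<Rightarrow> real" where
  "fun_entropy M f = - (\<Sum>v\<in>f ` space M. measure M (f -` {v} \<inter> space M) * ln (measure M (f -` {v} \<inter> space M)))"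

definition fun_cond_entropy :: "'a measure \<Rightarrow> ('a \<Rightarrow> 'v) \<Rightarrow> ('a \<Rightarrow> 'w) \<Rightarrow> real" where
  "fun_cond_entropy M f h = fun_entropy M (\<lambda>x. (f x, h x)) - fun_entropy M h"

lemma fun_entropy_superset:
  assumes "f ` space M \<subseteq> V" "finite V"
  shows "fun_entropy M f = - (\<Sum>v\<in>V. measure M (f -` {v} \<inter> space M) * ln (measure M (f -` {v} \<inter> space M)))"
proof -
  have "measure M (f -` {v} \<inter> space M) = 0" if "v \<in> V - f ` space M" for v
  proof -
    have "f -` {v} \<inter> space M = {}" using that by auto
    then show ?thesis by simp
  qed
  then show ?thesis
    unfolding fun_entropy_def using assms
    by (intro arg_cong[where f=uminus] sum.mono_neutral_left) auto
qed

text \<open>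
  That \<open>f\<close> is a function of \<open>g\<close> is expressed by the kernels, so that this function need not be named.
\<close>

lemma simple_function_coarser:
  assumes g: "simple_function M g"
    and fg: "\<And>x y. x \<in> space M \<Longrightarrow> y \<in> space M \<Longrightarrow> g x = g y \<Longrightarrow> f x = f y"
  shows "simple_function M f"
proof -
  have "simple_function M (\<lambda>x. f (inv_into (space M) g (g x)))"
    using g by (rule simple_function_compose1)
  moreover have "f (inv_into (space M) g (g x)) = f x" if "x \<in> space M" for x
    using that by (intro fg) (auto simp: inv_into_into f_inv_into_f)
  ultimately show ?thesis by (simp cong: simple_function_cong)
qed

lemma simple_function_restrict:
  assumes "finite I" "\<And>i. i \<in> I \<Longrightarrow> simple_function M (f i)"
  shows "simple_function M (\<lambda>x. restrict (\<lambda>i. f i x) I)"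
  using assms
proof (induction I)
  case empty then show ?case by simp
next
  case (insert j I)
  have "simple_function M (\<lambda>x. restrict (\<lambda>i. f i x) I)"
    by (rule insert.IH) (use insert.prems in blast)
  then have "simple_function M (\<lambda>x. (f j x, restrict (\<lambda>i. f i x) I))"
    using insert.prems by (intro simple_function_Pair) blast+
  then show ?case
    by (rule simple_function_coarser) (auto simp: restrict_eq_iff)
qed

context prob_space
begin

lemma information_space_exp_1: "information_space M (exp 1)"
  by unfold_locales auto

lemma fun_entropy_eq_entropy:
  assumes "simple_function M f"
  shows "fun_entropy M f = entropy (exp 1) (count_space (f ` space M)) f"
  using information_space.entropy_simple_distributed[OF information_space_exp_1 simple_distributedI[OF assms measure_nonneg refl]]
  by (simp add: fun_entropy_def log_def)

lemma fun_entropy_coarser: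
  assumes g: "simple_function M g"
    and fg: "\<And>x y. x \<in> space M \<Longrightarrow> y \<in> space M \<Longrightarrow> g x = g y \<Longrightarrow> f x = f y"
  shows "fun_entropy M f \<le> fun_entropy M g"
proof -
  let ?k = "\<lambda>v. f (inv_into (space M) g v)"
  have k: "?k (g x) = f x" if "x \<in> space M" for x
    using that by (intro fg) (auto simp: inv_into_into f_inv_into_f)
  have im: "(?k \<circ> g) ` space M = f ` space M" using k by (auto simp: image_iff)
  have pre: "(?k \<circ> g) -` {v} \<inter> space M = f -` {v} \<inter> space M" for v using k by auto
  have "fun_entropy M f = fun_entropy M (?k \<circ> g)"
    unfolding fun_entropy_def im pre ..
  also have "\<dots> = entropy (exp 1) (count_space ((?k \<circ> g) ` space M)) (?k \<circ> g)"
    by (intro fun_entropy_eq_entropy simple_function_compose g)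
  also have "\<dots> \<le> entropy (exp 1) (count_space (g ` space M)) g"
    by (rule information_space.entropy_data_processing[OF information_space_exp_1 g])
  also have "\<dots> = fun_entropy M g" by (rule fun_entropy_eq_entropy[OF g, symmetric])
  finally show ?thesis .
qed

lemma fun_entropy_cong_kernel:
  assumes g: "simple_function M g"
    and fg: "\<And>x y. x \<in> space M \<Longrightarrow> y \<in> space M \<Longrightarrow> g x = g y \<longleftrightarrow> f x = f y"
  shows "fun_entropy M f = fun_entropy M g"
  using fun_entropy_coarser[of g f] fun_entropy_coarser[of f g] simple_function_coarser[OF g, of f] fg g
  by (meson antisym)

lemma fun_entropy_nonneg: "0 \<le> fun_entropy M f"
proof -
  have "prob A * ln (prob A) \<le> 0" for A
  proof (cases "prob A = 0")
    case False
    then have "0 < prob A" by (simp add: zero_less_measure_iff)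
    then have "ln (prob A) \<le> 0" by simp
    then show ?thesis by (simp add: mult_nonneg_nonpos)
  qed simp
  then show ?thesis unfolding fun_entropy_def by (simp add: sum_nonpos)
qed

lemma sum_prob_image:
  fixes \<phi> :: "'w \<Rightarrow> real"
  assumes F: "simple_function M F" 
    and k: "\<And>x. x \<in> space M \<Longrightarrow> G x = k (F x)"
  shows "(\<Sum>v\<in>F ` space M. prob (F -` {v} \<inter> space M) * \<phi> (k v))
       = (\<Sum>w\<in>G ` space M. prob (G -` {w} \<inter> space M) * \<phi> w)"
proof -
  have fin: "finite (F ` space M)" using F by (rule simple_functionD)
  have finG: "finite (G ` space M)" using fin k
    by (metis (mono_tags, lifting) finite_imageI image_cong image_image)
  have meas: "F -` {v} \<inter> space M \<in> events" for v using F by (rule simple_functionD)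
  have "(\<Sum>w\<in>G ` space M. prob (G -` {w} \<inter> space M) * \<phi> w)
      = (\<Sum>w\<in>G ` space M. \<Sum>v\<in>{v\<in>F ` space M. k v = w}. prob (F -` {v} \<inter> space M) * \<phi> (k v))"
  proof (rule sum.cong[OF refl])
    fix w assume "w \<in> G ` space M"
    have "G -` {w} \<inter> space M = (\<Union>v\<in>{v\<in>F ` space M. k v = w}. F -` {v} \<inter> space M)"
      using k by auto
    moreover have "prob (\<Union>v\<in>{v\<in>F ` space M. k v = w}. F -` {v} \<inter> space M)
      = (\<Sum>v\<in>{v\<in>F ` space M. k v = w}. prob (F -` {v} \<inter> space M))"
      using fin meas by (intro finite_measure_finite_Union) (auto simp: disjoint_family_on_def)
    ultimately show "prob (G -` {w} \<inter> space M) * \<phi> w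
      = (\<Sum>v\<in>{v\<in>F ` space M. k v = w}. prob (F -` {v} \<inter> space M) * \<phi> (k v))"
      by (simp add: sum_distrib_right)
  qed
  also have "\<dots> = (\<Sum>v\<in>F ` space M. prob (F -` {v} \<inter> space M) * \<phi> (k v))"
    by (rule sum.group[OF fin finG]) (use k in auto)
  finally show ?thesis ..
qed

text \<open>
  This says that the conditional mutual information of \<open>f\<close> and \<open>g\<close> given \<open>h\<close> is non-negative. Gibbs'
  inequality compares the joint law with the one that has the same laws of \<open>(f, h)\<close> and \<open>(g, h)\<close> but makes
  \<open>f\<close> and \<open>g\<close> conditionally independent given \<open>h\<close>.
\<close>

lemma fun_entropy_submodular:
  assumes f: "simple_function M f" and g: "simple_function M g" and h: "simple_function M h"
  shows "fun_entropy M (\<lambda>x. (f x, g x, h x)) + fun_entropy M h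
       \<le> fun_entropy M (\<lambda>x. (f x, h x)) + fun_entropy M (\<lambda>x. (g x, h x))"
proof -
  define Pfh where "Pfh v = prob ((\<lambda>x. (f x, h x)) -` {v} \<inter> space M)" for v
  define Pgh where "Pgh v = prob ((\<lambda>x. (g x, h x)) -` {v} \<inter> space M)" for v
  define Ph where "Ph v = prob (h -` {v} \<inter> space M)" for v
  define F where "F = (\<lambda>x. (f x, g x, h x))"
  define p where "p v = prob (F -` {v} \<inter> space M)" for v
  have F: "simple_function M F" unfolding F_def using f g h by (intro simple_function_Pair)
  have fh: "simple_function M (\<lambda>x. (f x, h x))" and gh: "simple_function M (\<lambda>x. (g x, h x))"
    using f g h by (auto intro: simple_function_Pair)
  have fin: "finite (F ` space M)" using F by (rule simple_functionD)
  have meas: "h -` {v} \<inter> space M \<in> events" "(\<lambda>x. (f x, h x)) -` {w} \<inter> space M \<in> events"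
    "(\<lambda>x. (g x, h x)) -` {u} \<inter> space M \<in> events" for v w u
    using simple_functionD(2)[OF h] simple_functionD(2)[OF fh] simple_functionD(2)[OF gh] by auto
  define q where "q = (\<lambda>(x, y, z). Pfh (x, z) * Pgh (y, z) / Ph z)"
  have le1: "p (x, y, z) \<le> Pfh (x, z)" for x y z
    unfolding p_def Pfh_def F_def using meas(2) by (intro finite_measure_mono) auto
  have le2: "p (x, y, z) \<le> Pgh (y, z)" for x y z
    unfolding p_def Pgh_def F_def using meas(3) by (intro finite_measure_mono) auto
  have le3: "Pfh (x, z) \<le> Ph z" for x z
    unfolding Ph_def Pfh_def using meas(1) by (intro finite_measure_mono) auto
  have nn: "0 \<le> Pfh v" "0 \<le> Pgh w" "0 \<le> Ph u" for u v w
    by (auto simp: Pfh_def Pgh_def Ph_def)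
  have finh: "finite (h ` space M)" "finite (f ` space M)" "finite (g ` space M)"
    using f g h by (auto intro: simple_functionD)
  have s1: "(\<Sum>x\<in>f ` space M. Pfh (x, z)) = Ph z" for z
  proof -
    have "h -` {z} \<inter> space M = (\<Union>x\<in>f ` space M. (\<lambda>x. (f x, h x)) -` {(x, z)} \<inter> space M)" by auto
    then have "Ph z = prob (\<Union>x\<in>f ` space M. (\<lambda>x. (f x, h x)) -` {(x, z)} \<inter> space M)"
      by (simp add: Ph_def)
    also have "\<dots> = (\<Sum>x\<in>f ` space M. Pfh (x, z))"
      unfolding Pfh_def using finh meas(2) 
      by (intro finite_measure_finite_Union) (auto simp: disjoint_family_on_def)
    finally show ?thesis ..
  qed
  have s2: "(\<Sum>y\<in>g ` space M. Pgh (y, z)) = Ph z" for z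
  proof -
    have "h -` {z} \<inter> space M = (\<Union>x\<in>g ` space M. (\<lambda>x. (g x, h x)) -` {(x, z)} \<inter> space M)" by auto
    then have "Ph z = prob (\<Union>x\<in>g ` space M. (\<lambda>x. (g x, h x)) -` {(x, z)} \<inter> space M)"
      by (simp add: Ph_def)
    also have "\<dots> = (\<Sum>x\<in>g ` space M. Pgh (x, z))"
      unfolding Pgh_def using finh meas(3) 
      by (intro finite_measure_finite_Union) (auto simp: disjoint_family_on_def)
    finally show ?thesis ..
  qed
  have tot: "sum p (F ` space M) = 1"
    using sum_prob_image[OF F, of "\<lambda>_. 0::nat" "\<lambda>_. 0::nat" "\<lambda>_. 1"] not_empty
    by (simp add: p_def prob_space image_constant_conv)
  have toth: "sum Ph (h ` space M) = 1"
    using sum_prob_image[OF h, of "\<lambda>_. 0::nat" "\<lambda>_. 0::nat" "\<lambda>_. 1"] not_empty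
    by (simp add: Ph_def prob_space image_constant_conv)
  \<comment> \<open>The law \<open>q\<close> may charge triples that \<open>F\<close> never takes, whence only an inequality.\<close>
  have "sum q (F ` space M) \<le> sum q (f ` space M \<times> g ` space M \<times> h ` space M)"
    using finh nn by (intro sum_mono2) (auto simp: F_def q_def)
  also have "\<dots> = (\<Sum>x\<in>f ` space M. \<Sum>y\<in>g ` space M. \<Sum>z\<in>h ` space M. q (x, y, z))"
    by (simp add: sum.cartesian_product split_def)
  also have "\<dots> = (\<Sum>x\<in>f ` space M. \<Sum>z\<in>h ` space M. \<Sum>y\<in>g ` space M. q (x, y, z))"
    by (intro sum.cong refl sum.swap)
  also have "\<dots> = (\<Sum>z\<in>h ` space M. \<Sum>x\<in>f ` space M. \<Sum>y\<in>g ` space M. q (x, y, z))"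
    by (rule sum.swap)
  also have "\<dots> = (\<Sum>z\<in>h ` space M. (\<Sum>x\<in>f ` space M. Pfh (x, z)) * (\<Sum>y\<in>g ` space M. Pgh (y, z)) / Ph z)"
    by (simp add: q_def sum_product sum_divide_distrib)
  also have "\<dots> = (\<Sum>z\<in>h ` space M. Ph z)"
    by (simp add: s1 s2)
  finally have sq: "sum q (F ` space M) \<le> sum p (F ` space M)" using tot toth by simp
  have pos: "0 < Pfh (x, z) \<and> 0 < Pgh (y, z) \<and> 0 < Ph z" if "0 < p (x, y, z)" for x y z
    using that le1[of x y z] le2[of x y z] le3[of x z] by linarith
  have "(\<Sum>v\<in>F ` space M. p v * ln (q v)) \<le> (\<Sum>v\<in>F ` space M. p v * ln (p v))"
  proof (rule gibbs_inequality[OF fin _ _ _ sq])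
    fix v show "0 \<le> p v" by (simp add: p_def)
    show "0 \<le> q v" using nn by (simp add: q_def split_def)
    obtain x y z where v: "v = (x, y, z)" by (metis surj_pair)
    show "0 < q v" if "0 < p v" using pos[OF that[unfolded v]] by (simp add: v q_def)
  qed
  also have "(\<Sum>v\<in>F ` space M. p v * ln (q v)) = (\<Sum>v\<in>F ` space M. p v * ln (Pfh (fst v, snd (snd v)))
     + p v * ln (Pgh (snd v)) - p v * ln (Ph (snd (snd v))))"
  proof (rule sum.cong[OF refl])
    fix v assume "v \<in> F ` space M"
    obtain x y z where v: "v = (x, y, z)" by (metis surj_pair)
    show "p v * ln (q v) = p v * ln (Pfh (fst v, snd (snd v))) + p v * ln (Pgh (snd v)) - p v * ln (Ph (snd (snd v)))"
    proof (cases "p v = 0")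
      case False
      then have "0 < p v" by (simp add: p_def zero_less_measure_iff)
      from pos[OF this[unfolded v]] show ?thesis
        by (simp add: v q_def ln_mult ln_div algebra_simps)
    qed simp
  qed
  also have "\<dots> = (\<Sum>v\<in>F ` space M. p v * ln (Pfh (fst v, snd (snd v))))
     + (\<Sum>v\<in>F ` space M. p v * ln (Pgh (snd v))) - (\<Sum>v\<in>F ` space M. p v * ln (Ph (snd (snd v))))"
    by (simp add: sum_subtractf sum.distrib)
  also have "(\<Sum>v\<in>F ` space M. p v * ln (Pfh (fst v, snd (snd v)))) = - fun_entropy M (\<lambda>x. (f x, h x))"
    using sum_prob_image[OF F, of "\<lambda>x. (f x, h x)" "\<lambda>v. (fst v, snd (snd v))" "\<lambda>w. ln (Pfh w)"]
    by (simp add: F_def p_def fun_entropy_def Pfh_def)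
  also have "(\<Sum>v\<in>F ` space M. p v * ln (Pgh (snd v))) = - fun_entropy M (\<lambda>x. (g x, h x))"
    using sum_prob_image[OF F, of "\<lambda>x. (g x, h x)" "\<lambda>v. snd v" "\<lambda>w. ln (Pgh w)"]
    by (simp add: F_def p_def fun_entropy_def Pgh_def)
  also have "(\<Sum>v\<in>F ` space M. p v * ln (Ph (snd (snd v)))) = - fun_entropy M h"
    using sum_prob_image[OF F, of h "\<lambda>v. snd (snd v)" "\<lambda>w. ln (Ph w)"]
    by (simp add: F_def p_def fun_entropy_def Ph_def)
  also have "(\<Sum>v\<in>F ` space M. p v * ln (p v)) = - fun_entropy M F"
    by (simp add: p_def fun_entropy_def)
  finally show ?thesis by (simp add: F_def)
qed

lemma fun_cond_entropy_finer_condition: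
  assumes f: "simple_function M f" and h: "simple_function M h'"
    and hh: "\<And>x y. x \<in> space M \<Longrightarrow> y \<in> space M \<Longrightarrow> h' x = h' y \<Longrightarrow> h x = h y"
  shows "fun_cond_entropy M f h' \<le> fun_cond_entropy M f h"
proof -
  have sh: "simple_function M h" using simple_function_coarser[OF h] hh by blast
  have "fun_entropy M (\<lambda>x. (f x, h' x, h x)) = fun_entropy M (\<lambda>x. (f x, h' x))"
    by (rule fun_entropy_cong_kernel[OF simple_function_Pair[OF f h]]) (metis hh prod.inject)
  moreover have "fun_entropy M (\<lambda>x. (h' x, h x)) = fun_entropy M h'"
    by (rule fun_entropy_cong_kernel[OF h]) (metis hh prod.inject)
  ultimately show ?thesis
    using fun_entropy_submodular[OF f h sh] by (simp add: fun_cond_entropy_def)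
qed

lemma fun_cond_entropy_coarser:
  assumes g: "simple_function M g" and h: "simple_function M h"
    and fg: "\<And>x y. x \<in> space M \<Longrightarrow> y \<in> space M \<Longrightarrow> g x = g y \<Longrightarrow> f x = f y"
  shows "fun_cond_entropy M f h \<le> fun_cond_entropy M g h"
proof -
  have "fun_entropy M (\<lambda>x. (f x, h x)) \<le> fun_entropy M (\<lambda>x. (g x, h x))"
    by (rule fun_entropy_coarser[OF simple_function_Pair[OF g h]]) (metis fg prod.inject)
  then show ?thesis by (simp add: fun_cond_entropy_def)
qed

lemma fun_cond_entropy_subadditive:
  assumes f: "simple_function M f" and g: "simple_function M g" and h: "simple_function M h"
  shows "fun_cond_entropy M (\<lambda>x. (f x, g x)) h \<le> fun_cond_entropy M f h + fun_cond_entropy M g h"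
proof -
  have "fun_entropy M (\<lambda>x. ((f x, g x), h x)) = fun_entropy M (\<lambda>x. (f x, g x, h x))"
    by (rule fun_entropy_cong_kernel[OF simple_function_Pair[OF f simple_function_Pair[OF g h]]]) auto
  then show ?thesis
    using fun_entropy_submodular[OF f g h] by (simp add: fun_cond_entropy_def)
qed

lemma fun_cond_entropy_family_le:
  assumes "finite I" "\<And>i. i \<in> I \<Longrightarrow> simple_function M (f i)" and h: "simple_function M h"
  shows "fun_cond_entropy M (\<lambda>x. restrict (\<lambda>i. f i x) I) h \<le> (\<Sum>i\<in>I. fun_cond_entropy M (f i) h)"
  using assms(1,2)
proof (induction I)
  case empty
  have "fun_entropy M (\<lambda>x. (restrict (\<lambda>i. f i x) {}, h x)) = fun_entropy M h"
    by (rule fun_entropy_cong_kernel[OF h]) auto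
  then show ?case unfolding fun_cond_entropy_def sum.empty by linarith
next
  case (insert j I)
  have sI: "simple_function M (\<lambda>x. restrict (\<lambda>i. f i x) I)"
    using insert by (intro simple_function_restrict) auto
  have "fun_cond_entropy M (\<lambda>x. restrict (\<lambda>i. f i x) (insert j I)) h
     \<le> fun_cond_entropy M (\<lambda>x. (f j x, restrict (\<lambda>i. f i x) I)) h"
    using insert sI h by (intro fun_cond_entropy_coarser simple_function_Pair) 
      (auto simp: restrict_eq_iff)
  also have "\<dots> \<le> fun_cond_entropy M (f j) h + fun_cond_entropy M (\<lambda>x. restrict (\<lambda>i. f i x) I) h"
    by (rule fun_cond_entropy_subadditive) (use insert sI h in auto)
  also have "\<dots> \<le> fun_cond_entropy M (f j) h + (\<Sum>i\<in>I. fun_cond_entropy M (f i) h)"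
    by (intro add_left_mono insert.IH) (use insert.prems in blast)
  finally show ?case by (simp only: sum.insert[OF insert.hyps])
qed

lemma fun_entropy_Pair_le:
  assumes f: "simple_function M f" and g: "simple_function M g"
  shows "fun_entropy M (\<lambda>x. (f x, g x)) \<le> fun_entropy M f + fun_entropy M g"
proof -
  have c: "fun_entropy M (\<lambda>x. ()) = 0"
    using not_empty by (simp add: fun_entropy_def image_constant_conv prob_space)
  have "fun_entropy M (\<lambda>x. (f x, ())) = fun_entropy M f"
    by (rule fun_entropy_cong_kernel[OF f]) auto
  moreover have "fun_entropy M (\<lambda>x. (g x, ())) = fun_entropy M g"
    by (rule fun_entropy_cong_kernel[OF g]) auto
  moreover have "fun_entropy M (\<lambda>x. (f x, g x, ())) = fun_entropy M (\<lambda>x. (f x, g x))"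
    by (rule fun_entropy_cong_kernel[OF simple_function_Pair[OF f g]]) auto
  ultimately show ?thesis
    using fun_entropy_submodular[OF f g, of "\<lambda>_. ()"] c by simp
qed

lemma fun_entropy_le_cond:
  assumes f: "simple_function M f" and h: "simple_function M h"
  shows "fun_entropy M f \<le> fun_entropy M h + fun_cond_entropy M f h"
  unfolding fun_cond_entropy_def
  using fun_entropy_coarser[OF simple_function_Pair[OF f h], of f] by simp

lemma fun_entropy_measure_preserving:
  assumes T: "T \<in> M \<rightarrow>\<^sub>M M" and inv: "distr M M T = M" and f: "simple_function M f"
  shows "fun_entropy M (\<lambda>x. f (T x)) = fun_entropy M f"
proof -
  have im: "(\<lambda>x. f (T x)) ` space M \<subseteq> f ` space M" using measurable_space[OF T] by auto
  have "prob ((\<lambda>x. f (T x)) -` {v} \<inter> space M) = prob (f -` {v} \<inter> space M)" for v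
  proof -
    have "prob (f -` {v} \<inter> space M) = measure (distr M M T) (f -` {v} \<inter> space M)" by (simp add: inv)
    also have "\<dots> = prob (T -` (f -` {v} \<inter> space M) \<inter> space M)"
      using T simple_functionD(2)[OF f] by (intro measure_distr) auto
    also have "T -` (f -` {v} \<inter> space M) \<inter> space M = (\<lambda>x. f (T x)) -` {v} \<inter> space M"
      using measurable_space[OF T] by auto
    finally show ?thesis ..
  qed
  then show ?thesis
    unfolding fun_entropy_superset[OF im simple_functionD(1)[OF f]] fun_entropy_superset[OF order_refl simple_functionD(1)[OF f]]
    by simp
qed

lemma simple_function_measurable_comp:
  assumes T: "T \<in> M \<rightarrow>\<^sub>M M" and f: "simple_function M f"
  shows "simple_function M (\<lambda>x. f (T x))"
  using simple_function_comp[OF T f] by (simp add: comp_def)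

lemma tendsto_x_ln_x:
  assumes "(f \<longlongrightarrow> a) F" "0 \<le> a" "\<And>x. 0 \<le> f x"
  shows "((\<lambda>x. f x * ln (f x)) \<longlongrightarrow> a * ln (a::real)) F"
proof (cases "a = 0")
  case False
  then show ?thesis using assms by (intro tendsto_intros) auto
next
  case True
  \<comment> \<open>At \<open>0\<close> the logarithm is discontinuous; it is dominated by a power.\<close>
  have bound: "\<bar>x * ln x\<bar> \<le> 2 * sqrt x" if "0 \<le> x" "x \<le> 1" for x :: real
  proof (cases "x = 0")
    case False
    then have x: "0 < x" using that by simp
    have "ln (1 / sqrt x) \<le> 1 / sqrt x" using x by (smt (verit) divide_pos_pos ln_le_minus_one real_sqrt_gt_zero)
    then have "- ln x \<le> 2 / sqrt x" using x by (simp add: ln_div ln_sqrt)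
    then have "x * (- ln x) \<le> x * (2 / sqrt x)" using x by (intro mult_left_mono) auto
    also have "x * (2 / sqrt x) = 2 * sqrt x" using x by (simp add: real_div_sqrt field_simps)
    finally show ?thesis using that x by (simp add: abs_mult)
  qed simp
  have "((\<lambda>x. 2 * sqrt (f x)) \<longlongrightarrow> 2 * sqrt 0) F" using assms True by (intro tendsto_intros) auto
  moreover have "eventually (\<lambda>x. f x < 1) F" using assms(1) True by (intro order_tendstoD) auto
  then have "eventually (\<lambda>x. norm (f x * ln (f x)) \<le> 2 * sqrt (f x)) F"
  proof eventually_elim
    case (elim x)
    then show ?case using bound[of "f x"] assms(3)[of x] by simp
  qed
  ultimately have "((\<lambda>x. f x * ln (f x)) \<longlongrightarrow> 0) F"
    using Lim_null_comparison[of "\<lambda>x. f x * ln (f x)" "\<lambda>x. 2 * sqrt (f x)" F] by simp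
  then show ?thesis using True by simp
qed

text \<open>
  The joint law of the two indicators tends to a law on the diagonal, and \<open>x * ln x\<close> is continuous,
  also at \<open>0\<close>.
\<close>

lemma fun_cond_entropy_indicator_tendsto_0:
  assumes A: "A \<in> events" and C: "\<And>k. C k \<in> events"
    and lim: "(\<lambda>k::nat. prob (A - C k) + prob (C k - A)) \<longlonglongrightarrow> 0"
  shows "(\<lambda>k. fun_cond_entropy M (\<lambda>x. x \<in> A) (\<lambda>x. x \<in> C k)) \<longlonglongrightarrow> 0"
proof -
  have AS: "A \<subseteq> space M" and CS: "C k \<subseteq> space M" for k using A C sets.sets_into_space by auto
  have l1: "(\<lambda>k. prob (A - C k)) \<longlonglongrightarrow> 0"
    by (rule tendsto_sandwich[OF _ _ tendsto_const lim]) auto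
  have l2: "(\<lambda>k. prob (C k - A)) \<longlonglongrightarrow> 0"
    by (rule tendsto_sandwich[OF _ _ tendsto_const lim]) auto
  have e3: "prob (A \<inter> C k) = prob A - prob (A - C k)" for k
    using A C by (simp add: finite_measure_Diff' Int_commute)
  have l3: "(\<lambda>k. prob (A \<inter> C k)) \<longlonglongrightarrow> prob A"
    unfolding e3 using tendsto_diff[OF tendsto_const l1, of "prob A"] by simp
  have e4: "prob (C k) = prob (A \<inter> C k) + prob (C k - A)" for k
    using A C by (simp add: finite_measure_Diff' Int_commute)
  have l4: "(\<lambda>k. prob (C k)) \<longlonglongrightarrow> prob A"
    unfolding e4 using tendsto_add[OF l3 l2] by simp
  have e5: "prob (space M - C k) = 1 - prob (C k)" for k using C by (rule prob_compl)
  have l5: "(\<lambda>k. prob (space M - C k)) \<longlonglongrightarrow> 1 - prob A"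
    unfolding e5 by (intro tendsto_intros l4)
  have e6: "prob (space M - (A \<union> C k)) = 1 - prob A - prob (C k - A)" for k
  proof -
    have "prob (A \<union> C k) = prob A + prob (C k - A)"
      using A C by (simp add: finite_measure_Union')
    then show ?thesis using A C prob_compl[of "A \<union> C k"] by auto
  qed
  have l6: "(\<lambda>k. prob (space M - (A \<union> C k))) \<longlonglongrightarrow> 1 - prob A"
    unfolding e6 using tendsto_diff[OF tendsto_const l2, of "1 - prob A"] by simp
  have H2: "fun_entropy M (\<lambda>x. x \<in> C k) = - (prob (C k) * ln (prob (C k)) + prob (space M - C k) * ln (prob (space M - C k)))" for k
  proof -
    have "(\<lambda>x. x \<in> C k) -` {True} \<inter> space M = C k" using CS by auto
    moreover have "(\<lambda>x. x \<in> C k) -` {False} \<inter> space M = space M - C k" by auto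
    ultimately show ?thesis
      using fun_entropy_superset[of "\<lambda>x. x \<in> C k" M UNIV, OF subset_UNIV] by (simp add: UNIV_bool add.commute)
  qed
  have H1: "fun_entropy M (\<lambda>x. (x \<in> A, x \<in> C k)) =
     - (prob (A \<inter> C k) * ln (prob (A \<inter> C k)) + prob (A - C k) * ln (prob (A - C k))
       + prob (C k - A) * ln (prob (C k - A)) + prob (space M - (A \<union> C k)) * ln (prob (space M - (A \<union> C k))))" for k
  proof -
    have "(\<lambda>x. (x \<in> A, x \<in> C k)) -` {(True, True)} \<inter> space M = A \<inter> C k"
      "(\<lambda>x. (x \<in> A, x \<in> C k)) -` {(True, False)} \<inter> space M = A - C k"
      "(\<lambda>x. (x \<in> A, x \<in> C k)) -` {(False, True)} \<inter> space M = C k - A"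
      "(\<lambda>x. (x \<in> A, x \<in> C k)) -` {(False, False)} \<inter> space M = space M - (A \<union> C k)"
      using CS AS by auto
    moreover have "(\<lambda>x. (x \<in> A, x \<in> C k)) ` space M
        \<subseteq> {(True, True), (True, False), (False, True), (False, False)}" by auto
    ultimately show ?thesis
      by (subst fun_entropy_superset) auto
  qed
  have p1: "prob A \<le> 1" by simp
  have "(\<lambda>k. fun_cond_entropy M (\<lambda>x. x \<in> A) (\<lambda>x. x \<in> C k)) \<longlonglongrightarrow>
     - (prob A * ln (prob A) + 0 * ln 0 + 0 * ln 0 + (1 - prob A) * ln (1 - prob A))
     - (- (prob A * ln (prob A) + (1 - prob A) * ln (1 - prob A)))"
    unfolding fun_cond_entropy_def H1 H2
    by (intro tendsto_diff tendsto_minus tendsto_add tendsto_x_ln_x l1 l2 l3 l4 l5 l6) auto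
  then show ?thesis by simp
qed

end

section \<open>Cylinders and the Borel sets of a shift space\<close>

definition determined_on :: "int set \<Rightarrow> (int \<Rightarrow> 'a) set \<Rightarrow> (int \<Rightarrow> 'a) set \<Rightarrow> bool" where
  "determined_on J X C \<longleftrightarrow> C \<subseteq> X \<and> (\<forall>x\<in>C. \<forall>x'\<in>X. (\<forall>i\<in>J. x i = x' i) \<longrightarrow> x' \<in> C)"

text \<open>
  Any condition on finitely many coordinates defines a cylinder, so the cylinders form an algebra.
\<close>

definition cylinders :: "(int \<Rightarrow> 'a) set \<Rightarrow> (int \<Rightarrow> 'a) set set" where
  "cylinders X = {C. \<exists>J. finite J \<and> determined_on J X C}"

lemma determined_on_mono: "determined_on J X C \<Longrightarrow> J \<subseteq> J' \<Longrightarrow> determined_on J' X C"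
  unfolding determined_on_def by blast

lemma determined_onD: "determined_on J X C \<Longrightarrow> x \<in> X \<Longrightarrow> x' \<in> X \<Longrightarrow> (\<And>i. i \<in> J \<Longrightarrow> x i = x' i) \<Longrightarrow> x \<in> C \<longleftrightarrow> x' \<in> C"
  unfolding determined_on_def by metis

lemma cylindersI: "finite J \<Longrightarrow> determined_on J X C \<Longrightarrow> C \<in> cylinders X"
  unfolding cylinders_def by blast

lemma cylinders_subset: "C \<in> cylinders X \<Longrightarrow> C \<subseteq> X"
  unfolding cylinders_def determined_on_def by blast

lemma algebra_cylinders: "algebra X (cylinders X)"
  unfolding algebra_iff_Un
proof (intro conjI ballI)
  show "cylinders X \<subseteq> Pow X" using cylinders_subset by auto
  show "{} \<in> cylinders X" by (rule cylindersI[of "{}"]) (auto simp: determined_on_def)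
  show "X - C \<in> cylinders X" if C: "C \<in> cylinders X" for C
  proof -
    obtain J where J: "finite J" "determined_on J X C" using C by (auto simp: cylinders_def)
    have "determined_on J X (X - C)" using J(2) unfolding determined_on_def by (metis DiffD1 DiffD2 DiffI Diff_subset)
    then show ?thesis by (rule cylindersI[OF J(1)])
  qed
  show "C \<union> D \<in> cylinders X" if C: "C \<in> cylinders X" and D: "D \<in> cylinders X" for C D
  proof -
    obtain J J' where J: "finite J" "determined_on J X C" "finite J'" "determined_on J' X D"
      using C D by (auto simp: cylinders_def)
    have "determined_on (J \<union> J') X (C \<union> D)" using J(2,4) unfolding determined_on_def by blast
    then show ?thesis using J(1,3) by (intro cylindersI[of "J \<union> J'"]) auto
  qed
qed

interpretation cyl: algebra X "cylinders X" for X :: "(int \<Rightarrow> 'a) set"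
  by (rule algebra_cylinders)

lemma open_agreement:
  fixes x :: "int \<Rightarrow> 'a::discrete_topology"
  assumes "finite J" shows "open {z. \<forall>i\<in>J. z i = x i}"
proof -
  have "open {z. \<forall>i\<in>J. z (id i) \<in> {x i}}"
    by (rule product_topology_basis') (use assms in \<open>simp_all add: discrete_topology_class.open_discrete\<close>)
  then show ?thesis by simp
qed

lemma open_contains_agreement:
  fixes x :: "int \<Rightarrow> 'a::discrete_topology"
  assumes "open U" "x \<in> U"
  shows "\<exists>n::nat. \<forall>z. (\<forall>i\<in>{- int n..int n}. z i = x i) \<longrightarrow> z \<in> U"
proof -
  have "openin (product_topology (\<lambda>i. euclidean) UNIV) U" using assms(1) by (simp add: open_fun_def)
  from product_topology_open_contains_basis[OF this assms(2)]
  obtain F where F: "x \<in> (\<Pi>\<^sub>E i\<in>UNIV. F i)" "finite {i. F i \<noteq> UNIV}" "(\<Pi>\<^sub>E i\<in>UNIV. F i) \<subseteq> U"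
    by auto
  obtain n where n: "\<forall>i\<in>{i. F i \<noteq> UNIV}. \<bar>i\<bar> \<le> n"
  proof -
    have "finite (abs ` {i. F i \<noteq> UNIV})" using F(2) by simp
    then show ?thesis using that by (meson Max_ge imageI)
  qed
  have "z \<in> U" if z: "\<forall>i\<in>{- int (nat n)..int (nat n)}. z i = x i" for z
  proof -
    have "z i \<in> F i" for i
    proof (cases "F i = UNIV")
      case False
      then have "\<bar>i\<bar> \<le> n" using n by auto
      then have "i \<in> {- int (nat n)..int (nat n)}" by auto
      then have "z i = x i" using z by blast
      then show ?thesis using F(1) by auto
    qed auto
    then show ?thesis using F(3) by auto
  qed
  then show ?thesis by blast
qed

lemma cylinder_eq_Int_open:
  fixes X :: "(int \<Rightarrow> 'a::discrete_topology) set"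
  assumes "C \<in> cylinders X" shows "\<exists>U. open U \<and> C = U \<inter> X"
proof -
  obtain J where J: "finite J" "determined_on J X C" using assms by (auto simp: cylinders_def)
  have "open (\<Union>x\<in>C. {z. \<forall>i\<in>J. z i = x i})" using J(1) by (intro open_UN ballI open_agreement)
  moreover have "C = (\<Union>x\<in>C. {z. \<forall>i\<in>J. z i = x i}) \<inter> X"
    using J(2) unfolding determined_on_def by auto
  ultimately show ?thesis by blast
qed

text \<open>
  An open set \<open>U\<close> is the union over \<open>n\<close> of the cylinders of those points whose coordinates in
  \<open>{-n..n}\<close> already force membership in \<open>U\<close>.
\<close>

lemma sets_borel_on:
  fixes X :: "(int \<Rightarrow> 'a::discrete_topology) set"
  shows "sets (borel_on X) = sigma_sets X (cylinders X)"
proof -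
  have "sets (borel_on X) = sets (vimage_algebra X (\<lambda>x. x) (sigma UNIV {S :: (int \<Rightarrow> 'a) set. open S}))"
    using restrict_space_eq_vimage_algebra'[of borel X] by (simp add: borel_def)
  also have "\<dots> = sigma_sets X {(\<lambda>x. x) -` U \<inter> X | U. U \<in> {S. open S}}"
    by (subst vimage_algebra_sigma) (auto intro!: sets_measure_of)
  also have "\<dots> = sigma_sets X (cylinders X)"
  proof (rule sigma_sets_eqI)
    fix V assume "V \<in> {(\<lambda>x. x) -` U \<inter> X | U. U \<in> {S. open S}}"
    then obtain U where U: "open U" "V = U \<inter> X" by auto
    define W where "W n = {x \<in> X. \<forall>z\<in>X. (\<forall>i\<in>{- int n..int n}. z i = x i) \<longrightarrow> z \<in> U}" for n :: nat
    have "W n \<in> cylinders X" for n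
      by (rule cylindersI[of "{- int n..int n}"]) (auto simp: W_def determined_on_def)
    moreover have "V = (\<Union>n. W n)"
    proof
      show "V \<subseteq> (\<Union>n. W n)" using open_contains_agreement[OF U(1)] U(2) by (force simp: W_def)
      show "(\<Union>n. W n) \<subseteq> V" using U(2) by (auto simp: W_def)
    qed
    ultimately show "V \<in> sigma_sets X (cylinders X)" by (auto intro: sigma_sets.intros)
  next
    fix C assume "C \<in> cylinders X"
    from cylinder_eq_Int_open[OF this] show "C \<in> sigma_sets X {(\<lambda>x. x) -` U \<inter> X | U. U \<in> {S. open S}}"
      by (auto intro!: sigma_sets.Basic)
  qed
  finally show ?thesis .
qed

lemma space_borel_on [simp]: "space (borel_on X) = X"
  by (simp add: space_restrict_space)

lemma cylinder_sets: 
  fixes X :: "(int \<Rightarrow> 'a::discrete_topology) set"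
  shows "C \<in> cylinders X \<Longrightarrow> C \<in> sets (borel_on X)"
  by (simp add: sets_borel_on sigma_sets.Basic)

lemma measurable_borel_onI:
  fixes X :: "(int \<Rightarrow> 'a::discrete_topology) set"
  assumes "f \<in> space M \<rightarrow> X" "\<And>C. C \<in> cylinders X \<Longrightarrow> f -` C \<inter> space M \<in> sets M"
  shows "f \<in> M \<rightarrow>\<^sub>M borel_on X"
proof (rule measurable_sigma_sets[OF sets_borel_on _ assms])
  show "cylinders X \<subseteq> Pow X" using cylinders_subset by auto
qed

lemma measure_eqI_cylinders:
  fixes X :: "(int \<Rightarrow> 'a::discrete_topology) set"
  assumes "finite_measure M" "sets M = sets (borel_on X)" "sets N = sets (borel_on X)"
    and "\<And>C. C \<in> cylinders X \<Longrightarrow> emeasure M C = emeasure N C"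
  shows "M = N"
proof (rule measure_eqI_generator_eq[of "cylinders X" X _ _ "\<lambda>_. X"])
  show "Int_stable (cylinders X)" by (auto simp: Int_stable_def)
  show "emeasure M X \<noteq> \<infinity>" 
    using finite_measure.emeasure_finite[OF assms(1), of X] by simp
qed (use assms in \<open>auto simp: sets_borel_on dest: cylinders_subset\<close>)

text \<open>
  The sets that can be approximated by cylinders form a sigma-algebra. For a countable union it
  suffices to approximate finitely many members.
\<close>

lemma symmetric_difference_approximation:
  fixes X :: "(int \<Rightarrow> 'a::discrete_topology) set"
  assumes "finite_measure M" and sM: "sets M = sets (borel_on X)" and A: "A \<in> sets M" and e: "0 < e"
  shows "\<exists>C\<in>cylinders X. measure M (A - C) + measure M (C - A) < e"
proof -
  interpret finite_measure M by fact
  have spM: "space M = X" using sets_eq_imp_space_eq[OF sM] by simp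
  have cyl: "C \<in> sets M" if "C \<in> cylinders X" for C using that cylinder_sets sM by blast
  have "A \<in> sigma_sets X (cylinders X)" using A sM sets_borel_on by blast
  then show ?thesis using e
  proof (induction A arbitrary: e)
    case (Basic a)
    then show ?case by (intro bexI[of _ a]) auto
  next
    case Empty
    then show ?case by (intro bexI[of _ "{}"]) auto
  next
    case (Compl a)
    then obtain C where C: "C \<in> cylinders X" "measure M (a - C) + measure M (C - a) < e" by blast
    have aX: "a \<subseteq> X" "C \<subseteq> X"
      using sigma_sets_into_sp[of "cylinders X" X a] Compl.hyps cylinders_subset C(1) by blast+
    have "X - a - (X - C) = C - a" "X - C - (X - a) = a - C" using aX by auto
    then show ?case using C by (intro bexI[of _ "X - C"]) (auto simp: add.commute)
  next
    case (Union a)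
    have aM: "a i \<in> sets M" for i using Union.hyps sM sets_borel_on by blast
    define b where "b n = (\<Union>i<n. a i)" for n :: nat
    have bM: "b n \<in> sets M" for n unfolding b_def using aM by auto
    have bU: "(\<Union>n. b n) = (\<Union>i. a i)" unfolding b_def by auto
    have "(\<lambda>n. measure M (b n)) \<longlonglongrightarrow> measure M (\<Union>n. b n)"
      by (rule finite_Lim_measure_incseq) (use bM in \<open>auto simp: incseq_def b_def\<close>, blast intro: less_le_trans)
    then have "eventually (\<lambda>n. measure M (b n) > measure M (\<Union>i. a i) - e / 2) sequentially"
      using Union.prems unfolding bU by (intro order_tendstoD(1)) auto
    then obtain n where n: "measure M (b n) > measure M (\<Union>i. a i) - e / 2"
      by (meson eventually_sequentially order_refl)
    \<comment> \<open>Half of the error is left for truncating the union, the other half is shared by \<open>n\<close> sets.\<close>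
    define d where "d = e / (2 * (real n + 1))"
    have d: "0 < d" using Union.prems by (simp add: d_def)
    have "\<forall>i. \<exists>C\<in>cylinders X. measure M (a i - C) + measure M (C - a i) < d"
      using Union.IH d by blast
    then obtain C where C: "\<And>i. C i \<in> cylinders X" "\<And>i. measure M (a i - C i) + measure M (C i - a i) < d"
      by metis
    define D where "D = (\<Union>i<n. C i)"
    have D: "D \<in> cylinders X" unfolding D_def using C(1) by (intro cyl.finite_UN) auto
    have U1: "(\<Union>i. a i) - D \<subseteq> ((\<Union>i. a i) - b n) \<union> (\<Union>i<n. a i - C i)"
      by (auto simp: D_def b_def)
    have U2: "D - (\<Union>i. a i) \<subseteq> (\<Union>i<n. C i - a i)" by (auto simp: D_def)
    have m0: "measure M ((\<Union>i. a i) - b n) < e / 2"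
    proof -
      have "b n \<subseteq> (\<Union>i. a i)" by (auto simp: b_def)
      then have "measure M ((\<Union>i. a i) - b n) = measure M (\<Union>i. a i) - measure M (b n)"
        using aM bM by (intro finite_measure_Diff) auto
      then show ?thesis using n by simp
    qed
    have "measure M ((\<Union>i. a i) - D) \<le> measure M (((\<Union>i. a i) - b n) \<union> (\<Union>i<n. a i - C i))"
      using U1 aM bM cyl C(1) by (intro finite_measure_mono) (auto intro!: sets.Un sets.finite_UN sets.Diff sets.countable_UN)
    also have "\<dots> \<le> measure M ((\<Union>i. a i) - b n) + measure M (\<Union>i<n. a i - C i)"
      using aM bM cyl C(1) by (intro measure_Un_le) (auto intro!: sets.finite_UN sets.Diff sets.countable_UN)
    also have "measure M (\<Union>i<n. a i - C i) \<le> (\<Sum>i<n. measure M (a i - C i))"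
      using aM cyl C(1) by (intro measure_UNION_le) auto
    finally have 1: "measure M ((\<Union>i. a i) - D) \<le> measure M ((\<Union>i. a i) - b n) + (\<Sum>i<n. measure M (a i - C i))" by simp
    have "measure M (D - (\<Union>i. a i)) \<le> measure M (\<Union>i<n. C i - a i)"
      using U2 aM cyl C(1) by (intro finite_measure_mono) (auto intro!: sets.finite_UN sets.Diff)
    also have "\<dots> \<le> (\<Sum>i<n. measure M (C i - a i))"
      using aM cyl C(1) by (intro measure_UNION_le) auto
    finally have 2: "measure M (D - (\<Union>i. a i)) \<le> (\<Sum>i<n. measure M (C i - a i))" .
    have "measure M ((\<Union>i. a i) - D) + measure M (D - (\<Union>i. a i)) 
        \<le> measure M ((\<Union>i. a i) - b n) + (\<Sum>i<n. measure M (a i - C i) + measure M (C i - a i))"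
      using 1 2 by (simp add: sum.distrib)
    also have "\<dots> \<le> measure M ((\<Union>i. a i) - b n) + (\<Sum>i<n. d)"
      using C(2) by (intro add_left_mono sum_mono) (auto intro: less_imp_le)
    also have "\<dots> < e / 2 + real n * d" using m0 by simp
    also have "real n * d \<le> e / 2" using Union.prems by (simp add: d_def field_simps)
    finally show ?case using D by (intro bexI[of _ D]) auto
  qed
qed

lemma closed_extension_of_cylinder:
  fixes X :: "(int \<Rightarrow> 'a::discrete_topology) set"
  assumes "C \<in> cylinders X" shows "\<exists>T. closed T \<and> C = X \<inter> T"
proof -
  have "X - C \<in> cylinders X" using assms by auto
  from cylinder_eq_Int_open[OF this] obtain U where U: "open U" "X - C = U \<inter> X" by blast
  have "C = X \<inter> - U" using U(2) cylinders_subset[OF assms] by blast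
  then show ?thesis using U(1) by (intro exI[of _ "- U"]) (auto simp: closed_Compl)
qed

text \<open>
  Cylinders are relatively closed, so this is the finite intersection property.
\<close>

lemma decreasing_cylinders_eventually_empty:
  fixes X :: "(int \<Rightarrow> 'a::discrete_topology) set"
  assumes X: "compact X" and C: "range C \<subseteq> cylinders X" and dec: "decseq C" and emp: "(\<Inter>i::nat. C i) = {}"
  shows "\<exists>n. C n = {}"
proof (rule ccontr)
  assume ne: "\<nexists>n. C n = {}"
  have "\<forall>i. \<exists>T. closed T \<and> C i = X \<inter> T" using C closed_extension_of_cylinder by (metis range_subsetD)
  then obtain T where T: "\<And>i. closed (T i)" "\<And>i. C i = X \<inter> T i" by metis
  have "X \<inter> \<Inter>(range T) \<noteq> {}"
  proof (rule compact_imp_fip[OF X])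
    fix F' assume F': "finite F'" "F' \<subseteq> range T"
    then obtain I where I: "finite I" "F' = T ` I" by (metis finite_subset_image)
    obtain n where n: "\<forall>i\<in>I. i \<le> n" using I(1) finite_nat_set_iff_bounded_le by blast
    have "C n \<subseteq> X \<inter> \<Inter>F'"
    proof
      fix x assume x: "x \<in> C n"
      have "x \<in> T i" if "i \<in> I" for i
        using n that decseqD[OF dec, of i n] x T(2)[of i] by blast
      then show "x \<in> X \<inter> \<Inter>F'" using x T(2)[of n] I(2) by blast
    qed
    then show "X \<inter> \<Inter>F' \<noteq> {}" using ne by (metis subset_empty)
  qed (use T in auto)
  moreover have "X \<inter> \<Inter>(range T) = (\<Inter>i. C i)" using T(2) by auto
  ultimately show False using emp by simp
qed

text \<open>
  By compactness a finitely additive mass on cylinders is continuous at the empty set, so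
  Caratheodory's theorem extends it.
\<close>

lemma cylinder_measure_extension:
  fixes X :: "(int \<Rightarrow> 'a::discrete_topology) set" and m :: "(int \<Rightarrow> 'a) set \<Rightarrow> real"
  assumes X: "compact X" and nonneg: "\<And>C. C \<in> cylinders X \<Longrightarrow> 0 \<le> m C"
    and add: "\<And>C D. C \<in> cylinders X \<Longrightarrow> D \<in> cylinders X \<Longrightarrow> C \<inter> D = {} \<Longrightarrow> m (C \<union> D) = m C + m D"
  shows "\<exists>M. sets M = sets (borel_on X) \<and> (\<forall>C\<in>cylinders X. emeasure M C = ennreal (m C))"
proof -
  have e: "m {} = 0" using add[of "{}" "{}"] by simp
  have "\<exists>\<mu> :: (int \<Rightarrow> 'a) set \<Rightarrow> ennreal. (\<forall>s\<in>cylinders X. \<mu> s = ennreal (m s)) \<and> measure_space X (sigma_sets X (cylinders X)) \<mu>"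
  proof (rule cyl.caratheodory_empty_continuous)
    show "positive (cylinders X) (\<lambda>s. ennreal (m s))" by (simp add: positive_def e)
    show "additive (cylinders X) (\<lambda>s. ennreal (m s))"
      unfolding additive_def using add nonneg by (auto simp: ennreal_plus)
    fix C assume C: "range C \<subseteq> cylinders X" "decseq C" "(\<Inter>i::nat. C i) = {}"
    from decreasing_cylinders_eventually_empty[OF X C] obtain n where n: "C n = {}" by blast
    have "ennreal (m (C i)) = 0" if "i \<ge> n" for i
      using decseqD[OF C(2) that] n e by simp
    then show "(\<lambda>i. ennreal (m (C i))) \<longlonglongrightarrow> 0"
      by (intro tendsto_eventually) (auto simp: eventually_sequentially)
  qed simp
  then obtain \<mu> :: "(int \<Rightarrow> 'a) set \<Rightarrow> ennreal" where \<mu>: "\<forall>s\<in>cylinders X. \<mu> s = ennreal (m s)"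
    "measure_space X (sigma_sets X (cylinders X)) \<mu>" by blast
  define M where "M = measure_of X (sigma_sets X (cylinders X)) \<mu>"
  have sub: "sigma_sets X (cylinders X) \<subseteq> Pow X"
    using sigma_sets_into_sp[of "cylinders X" X] cylinders_subset by blast
  have "sets M = sigma_sets X (cylinders X)"
    unfolding M_def using sub sigma_sets_sigma_sets_eq[of "cylinders X" X] cylinders_subset by (simp add: sets_measure_of) blast
  moreover have "emeasure M C = ennreal (m C)" if "C \<in> cylinders X" for C
  proof -
    have "emeasure M C = \<mu> C"
      unfolding M_def using \<mu>(2) that
      by (intro emeasure_measure_of_sigma) (auto simp: measure_space_def sigma_sets.Basic)
    then show ?thesis using \<mu>(1) that by simp
  qed
  ultimately show ?thesis by (intro exI[of _ M]) (simp add: sets_borel_on)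
qed

lemma finite_determined_on:
  assumes A: "finite A" "\<And>x i. x \<in> X \<Longrightarrow> x i \<in> A" and J: "finite J"
  shows "finite {C. determined_on J X C}"
proof (rule finite_imageD)
  let ?f = "\<lambda>C. (\<lambda>x. restrict x J) ` C"
  show "finite (?f ` {C. determined_on J X C})"
  proof (rule finite_subset)
    show "?f ` {C. determined_on J X C} \<subseteq> Pow (PiE J (\<lambda>_. A))"
      using A(2) by (auto simp: determined_on_def)
    show "finite (Pow (PiE J (\<lambda>_. A)))" using A(1) J by (simp add: finite_PiE)
  qed
  show "inj_on ?f {C. determined_on J X C}"
  proof (rule inj_onI)
    have *: "C \<subseteq> D" if C: "determined_on J X C" and D: "determined_on J X D" and eq: "?f C = ?f D" for C D
    proof
      fix x assume x: "x \<in> C"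
      then have "restrict x J \<in> ?f D" using eq by blast
      then obtain y where y: "y \<in> D" "restrict x J = restrict y J" by blast
      then have "x i = y i" if "i \<in> J" for i using that by (simp add: restrict_eq_iff)
      then show "x \<in> D" using determined_onD[OF D, of y x] x y C D by (auto simp: determined_on_def)
    qed
    fix C D assume "C \<in> {C. determined_on J X C}" "D \<in> {C. determined_on J X C}" "?f C = ?f D"
    then show "C = D" using *[of C D] *[of D C] by auto
  qed
qed

lemma countable_cylinders:
  assumes A: "finite A" "\<And>x i. x \<in> X \<Longrightarrow> x i \<in> A"
  shows "countable (cylinders X)"
proof -
  have "cylinders X = (\<Union>J\<in>Collect finite. {C. determined_on J X C})"
    by (auto simp: cylinders_def)
  moreover have "finite {C. determined_on J X C}" if "finite J" for J
    using A that by (rule finite_determined_on)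
  ultimately show ?thesis
    using countable_Collect_finite
    by (metis (mono_tags, lifting) countable_UN countable_finite mem_Collect_eq)
qed

text \<open>
  Over a finite alphabet a cylinder is a finite union of sets that prescribe the symbols in its window.
\<close>

lemma measurable_borel_on_coordinatewise:
  fixes X :: "(int \<Rightarrow> 'a::discrete_topology) set"
  assumes A: "finite A" "\<And>x i. x \<in> X \<Longrightarrow> x i \<in> A"
    and f: "f \<in> space M \<rightarrow> X" and m: "\<And>i c. c \<in> A \<Longrightarrow> {w \<in> space M. f w i = c} \<in> sets M"
  shows "f \<in> M \<rightarrow>\<^sub>M borel_on X"
proof (rule measurable_borel_onI[OF f])
  fix C assume "C \<in> cylinders X"
  then obtain J where J: "finite J" "determined_on J X C" by (auto simp: cylinders_def)
  let ?S = "(\<lambda>x. restrict x J) ` C"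
  have CX: "C \<subseteq> X" using J(2) by (simp add: determined_on_def)
  have fin: "finite ?S"
  proof (rule finite_subset)
    show "?S \<subseteq> PiE J (\<lambda>_. A)" using A(2) CX by auto
    show "finite (PiE J (\<lambda>_. A))" using A(1) J(1) by (simp add: finite_PiE)
  qed
  have "f -` C \<inter> space M = (\<Union>s\<in>?S. {w \<in> space M. \<forall>i\<in>J. f w i = s i})"
  proof (intro equalityI subsetI)
    fix w assume "w \<in> f -` C \<inter> space M"
    then show "w \<in> (\<Union>s\<in>?S. {w \<in> space M. \<forall>i\<in>J. f w i = s i})"
      by (intro UN_I[of "restrict (f w) J"]) auto
  next
    fix w assume "w \<in> (\<Union>s\<in>?S. {w \<in> space M. \<forall>i\<in>J. f w i = s i})"
    then obtain x where "x \<in> C" "w \<in> space M" "\<forall>i\<in>J. f w i = x i" by auto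
    then show "w \<in> f -` C \<inter> space M" using determined_onD[OF J(2), of x "f w"] f CX by auto
  qed
  also have "\<dots> \<in> sets M"
  proof -
    have "{w \<in> space M. \<forall>i\<in>J. f w i = s i} \<in> sets M" if s: "s \<in> ?S" for s
      using J(1) s A(2) CX by (intro sets.sets_Collect_finite_All m) auto
    then show ?thesis using fin by (intro sets.finite_UN) blast+
  qed
  finally show "f -` C \<inter> space M \<in> sets M" .
qed

lemma coordinate_cylinder: "{x \<in> X. x i = c} \<in> cylinders X"
  by (rule cylindersI[of "{i}"]) (auto simp: determined_on_def)

lemma coordinate_sets:
  fixes X :: "(int \<Rightarrow> 'a::discrete_topology) set"
  shows "{x \<in> X. x i = c} \<in> sets (borel_on X)"
  by (rule cylinder_sets[OF coordinate_cylinder])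

section \<open>Sliding block codes on shifts of finite type\<close>

definition translate :: "int \<Rightarrow> (int \<Rightarrow> 'a) \<Rightarrow> int \<Rightarrow> 'a" where
  "translate k x = (\<lambda>i. x (i + k))"

lemma translate_apply [simp]: "translate k x i = x (i + k)"
  by (simp add: translate_def)

lemma translate_0 [simp]: "translate 0 x = x"
  by (simp add: translate_def)

lemma translate_translate [simp]: "translate k (translate l x) = translate (k + l) x"
  by (simp add: translate_def algebra_simps)

lemma shift_eq_translate: "shift = translate 1"
  by (simp add: shift_def translate_def fun_eq_iff)

lemma shift_funpow: "(shift ^^ n) x = translate (int n) x"
  by (induction n arbitrary: x) (simp_all add: shift_eq_translate funpow_Suc_right add.commute del: funpow.simps(2))

text \<open>
  All that the proof uses of a factor triple: membership in \<open>X\<close> is decided by windows of length \<open>K\<close>,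
  and a window of length \<open>K\<close> in \<open>x\<close> decides the symbol of \<open>\<pi> x\<close> that lies \<open>r\<close> places to the right
  of its left end.
\<close>

locale sliding_block_code =
  fixes X :: "(int \<Rightarrow> 'a::discrete_topology) set"
    and Y :: "(int \<Rightarrow> 'b::discrete_topology) set"
    and \<pi> :: "(int \<Rightarrow> 'a) \<Rightarrow> (int \<Rightarrow> 'b)"
    and A :: "'a set" and K r :: int
  assumes finite_A: "finite A"
    and alphabet: "x \<in> X \<Longrightarrow> x i \<in> A"
    and compact_X: "compact X"
    and K_pos: "0 < K"
    and glue: "(\<And>i. \<exists>x\<in>X. \<forall>j\<in>{i..<i + K}. z j = x j) \<Longrightarrow> z \<in> X"
    and code_local: "x \<in> X \<Longrightarrow> x' \<in> X \<Longrightarrow> (\<And>j. j \<in> {i..<i + K} \<Longrightarrow> x j = x' j) \<Longrightarrow> \<pi> x (i + r) = \<pi> x' (i + r)"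
    and translate_X: "x \<in> X \<Longrightarrow> translate k x \<in> X"
    and code_translate: "x \<in> X \<Longrightarrow> \<pi> (translate k x) = translate k (\<pi> x)"
    and code_image: "\<pi> ` X = Y"

lemma compact_full_shift:
  assumes "finite A"
  shows "compact {x :: int \<Rightarrow> 'a::discrete_topology. range x \<subseteq> A}"
proof -
  have "compactin (product_topology (\<lambda>i::int. euclidean :: 'a topology) UNIV) (PiE UNIV (\<lambda>_. A))"
    unfolding compactin_PiE using assms by (simp add: finite_imp_compact)
  moreover have "PiE UNIV (\<lambda>_. A) = {x :: int \<Rightarrow> 'a. range x \<subseteq> A}" by (auto simp: PiE_def)
  ultimately show ?thesis by (simp add: euclidean_product_topology)
qed

lemma shift_of_finite_type_properties:
  fixes X :: "(int \<Rightarrow> 'a::discrete_topology) set"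
  assumes "shift_of_finite_type X"
  obtains A :: "'a set" and K0 :: int
  where "finite A" "\<And>x i. x \<in> X \<Longrightarrow> x i \<in> A" "compact X"
    "\<And>K z. K0 \<le> K \<Longrightarrow> (\<And>i. \<exists>x\<in>X. \<forall>j\<in>{i..<i + K}. z j = x j) \<Longrightarrow> z \<in> X"
    "\<And>x k. x \<in> X \<Longrightarrow> translate k x \<in> X"
proof -
  obtain A F where AF: "finite A" "finite F" "X = {x. range x \<subseteq> A \<and> (\<forall>w\<in>F. \<not> occurs_in w x)}"
    using assms by (auto simp: shift_of_finite_type_def)
  have occ: "occurs_in w z \<longleftrightarrow> (\<exists>i. \<forall>j\<in>{i..<i + int (length w)}. z j = w ! nat (j - i))" for w and z :: "int \<Rightarrow> 'a"
  proof
    assume "occurs_in w z"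
    then obtain i where i: "\<forall>j<length w. z (i + int j) = w ! j" by (auto simp: occurs_in_def)
    have "z j = w ! nat (j - i)" if "j \<in> {i..<i + int (length w)}" for j
      using i[rule_format, of "nat (j - i)"] that by auto
    then show "\<exists>i. \<forall>j\<in>{i..<i + int (length w)}. z j = w ! nat (j - i)" by blast
  next
    assume "\<exists>i. \<forall>j\<in>{i..<i + int (length w)}. z j = w ! nat (j - i)"
    then obtain i where i: "\<forall>j\<in>{i..<i + int (length w)}. z j = w ! nat (j - i)" by blast
    have "\<forall>j<length w. z (i + int j) = w ! j" using i by auto
    then show "occurs_in w z" unfolding occurs_in_def by blast
  qed
  have "open {z :: int \<Rightarrow> 'a. occurs_in w z}" for w
  proof -
    have "{z :: int \<Rightarrow> 'a. occurs_in w z} = (\<Union>i. {z. \<forall>j\<in>{i..<i + int (length w)}. z j = w ! nat (j - i)})"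
      using occ by auto
    moreover have "open \<dots>"
      by (intro open_UN ballI, rule open_agreement[of _ "\<lambda>j. w ! nat (j - _)"]) auto
    ultimately show ?thesis by simp
  qed
  then have "closed {z :: int \<Rightarrow> 'a. \<not> occurs_in w z}" for w
    by (metis (mono_tags) closed_def Collect_neg_eq double_compl)
  then have "closed (\<Inter>w\<in>F. {z :: int \<Rightarrow> 'a. \<not> occurs_in w z})" by blast
  then have "compact ({x. range x \<subseteq> A} \<inter> (\<Inter>w\<in>F. {z :: int \<Rightarrow> 'a. \<not> occurs_in w z}))"
    by (intro compact_Int_closed compact_full_shift AF)
  moreover have "{x. range x \<subseteq> A} \<inter> (\<Inter>w\<in>F. {z. \<not> occurs_in w z}) = X" using AF(3) by auto
  ultimately have comp: "compact X" by simp
  obtain K1 where K1: "\<forall>w\<in>F. length w \<le> K1" using AF(2) 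
    by (metis finite_imageI finite_nat_set_iff_bounded_le imageI)
  define K0 where "K0 = max 1 (int K1)"
  have gl: "z \<in> X" if K: "K0 \<le> K" and z: "\<And>i. \<exists>x\<in>X. \<forall>j\<in>{i..<i + K}. z j = x j" for K z
  proof -
    have "z i \<in> A" for i
    proof -
      obtain x where x: "x \<in> X" "\<forall>j\<in>{i..<i + K}. z j = x j" using z by blast
      have "i \<in> {i..<i + K}" using K by (auto simp: K0_def)
      then have "z i = x i" using x(2) by blast
      then show ?thesis using x(1) AF(3) by auto
    qed
    moreover have "\<not> occurs_in w z" if w: "w \<in> F" for w
    proof
      assume "occurs_in w z"
      then obtain i where i: "\<forall>j\<in>{i..<i + int (length w)}. z j = w ! nat (j - i)" using occ by blast
      obtain x where x: "x \<in> X" "\<forall>j\<in>{i..<i + K}. z j = x j" using z by blast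
      have "{i..<i + int (length w)} \<subseteq> {i..<i + K}" using K1 w K by (force simp: K0_def)
      then have "\<forall>j\<in>{i..<i + int (length w)}. x j = w ! nat (j - i)" using i x(2) by auto
      then have "occurs_in w x" using occ by blast
      then show False using x(1) w AF(3) by auto
    qed
    ultimately show ?thesis using AF(3) by auto
  qed
  have tr: "translate k x \<in> X" if x: "x \<in> X" for x k
  proof -
    have "\<not> occurs_in w (translate k x)" if w: "w \<in> F" for w
    proof
      assume "occurs_in w (translate k x)"
      then obtain i where "\<forall>j<length w. x (i + k + int j) = w ! j" 
        by (auto simp: occurs_in_def algebra_simps)
      then have "occurs_in w x" by (auto simp: occurs_in_def)
      then show False using x w AF(3) by auto
    qed
    then show ?thesis using x AF(3) by auto
  qed
  show ?thesis
  proof (rule that[of A K0])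
    show "x i \<in> A" if "x \<in> X" for x i using that AF(3) by auto
  qed (fact AF(1) comp gl tr)+
qed

text \<open>
  Near each point the symbol of the image at \<open>0\<close> is constant on a basic open set; finitely many of
  these cover \<open>X\<close>, and the largest of their windows serves for all points.
\<close>

lemma curtis_hedlund_lyndon:
  fixes X :: "(int \<Rightarrow> 'a::discrete_topology) set" and \<pi> :: "(int \<Rightarrow> 'a) \<Rightarrow> (int \<Rightarrow> 'b::discrete_topology)"
  assumes "compact X" "continuous_on X \<pi>"
  shows "\<exists>N::nat. \<forall>x\<in>X. \<forall>x'\<in>X. (\<forall>i\<in>{- int N..int N}. x i = x' i) \<longrightarrow> \<pi> x 0 = \<pi> x' 0"
proof -
  have c: "continuous_on X (\<lambda>x. \<pi> x 0)" using assms(2) by (rule continuous_on_product_then_coordinatewise)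
  have "\<exists>n::nat. \<forall>z\<in>X. (\<forall>i\<in>{- int n..int n}. z i = x i) \<longrightarrow> \<pi> z 0 = \<pi> x 0" if x: "x \<in> X" for x
  proof -
    obtain U where U: "open U" "U \<inter> X = (\<lambda>x. \<pi> x 0) -` {\<pi> x 0} \<inter> X"
      using c discrete_topology_class.open_discrete[of "{\<pi> x 0}"] unfolding continuous_on_open_invariant by blast
    have "x \<in> U" using U(2) x by auto
    from open_contains_agreement[OF U(1) this] obtain n where "\<forall>z. (\<forall>i\<in>{- int n..int n}. z i = x i) \<longrightarrow> z \<in> U"
      by blast
    then show ?thesis using U(2) by blast
  qed
  then obtain n :: "(int \<Rightarrow> 'a) \<Rightarrow> nat" where n: "\<And>x z. x \<in> X \<Longrightarrow> z \<in> X \<Longrightarrow> (\<forall>i\<in>{- int (n x)..int (n x)}. z i = x i) \<Longrightarrow> \<pi> z 0 = \<pi> x 0"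
    by metis
  define U where "U x = {z. \<forall>i\<in>{- int (n x)..int (n x)}. z i = x i}" for x
  have "\<forall>x\<in>X. open (U x)" unfolding U_def by (auto intro: open_agreement)
  moreover have "X \<subseteq> (\<Union>x\<in>X. U x)" by (auto simp: U_def)
  ultimately obtain D where D: "D \<subseteq> X" "finite D" "X \<subseteq> (\<Union>x\<in>D. U x)"
    using compactE_image[OF assms(1), of X U] by blast
  obtain N where N: "\<forall>x\<in>D. n x \<le> N" using D(2) by (metis finite_imageI finite_nat_set_iff_bounded_le imageI)
  have "\<pi> x 0 = \<pi> x' 0" if x: "x \<in> X" "x' \<in> X" and eq: "\<forall>i\<in>{- int N..int N}. x i = x' i" for x x'
  proof -
    obtain y where y: "y \<in> D" "x \<in> U y" using D(3) x by blast
    have "x' i = y i" if i: "i \<in> {- int (n y)..int (n y)}" for i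
    proof -
      have "i \<in> {- int N..int N}" using i N y(1) by force
      then have "x i = x' i" using eq by blast
      then show ?thesis using y(2) i by (auto simp: U_def)
    qed
    then have "\<pi> x' 0 = \<pi> y 0" using n[of y x'] y D(1) x by blast
    moreover have "\<pi> x 0 = \<pi> y 0" using n[of y x] y D(1) x by (auto simp: U_def)
    ultimately show ?thesis by simp
  qed
  then show ?thesis by blast
qed

lemma factor_triple_sliding_block_code:
  fixes X :: "(int \<Rightarrow> 'a::discrete_topology) set" and Y :: "(int \<Rightarrow> 'b::discrete_topology) set"
  assumes "factor_triple X Y \<pi>"
  obtains A K r where "sliding_block_code X Y \<pi> A K r"
proof -
  have sft: "shift_of_finite_type X" and fc: "factor_code X Y \<pi>" using assms by (auto simp: factor_triple_def)
  obtain A K0 where A: "finite A" "\<And>x i. x \<in> X \<Longrightarrow> x i \<in> A" "compact X"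
    and gl: "\<And>K z. K0 \<le> K \<Longrightarrow> (\<And>i. \<exists>x\<in>X. \<forall>j\<in>{i..<i + K}. z j = x j) \<Longrightarrow> z \<in> X"
    and tr: "\<And>x k. x \<in> X \<Longrightarrow> translate k x \<in> X"
    using shift_of_finite_type_properties[OF sft] by metis
  have sh: "\<pi> (shift x) = shift (\<pi> x)" if "x \<in> X" for x using fc that by (simp add: factor_code_def)
  have nat_tr: "\<pi> (translate (int n) x) = translate (int n) (\<pi> x)" if "x \<in> X" for x n
  proof (induction n)
    case (Suc n)
    have "\<pi> (translate (1 + int n) x) = translate (1 + int n) (\<pi> x)"
      using sh[OF tr[OF that, of "int n"]] unfolding shift_eq_translate translate_translate Suc .
    then show ?case by (simp only: of_nat_Suc)
  qed simp
  have code_tr: "\<pi> (translate k x) = translate k (\<pi> x)" if x: "x \<in> X" for x k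
  proof (cases "0 \<le> k")
    case True then show ?thesis using nat_tr[OF x, of "nat k"] by simp
  next
    case False
    have "\<pi> x = \<pi> (translate (int (nat (- k))) (translate k x))" using False by simp
    also have "\<dots> = translate (- k) (\<pi> (translate k x))" using nat_tr[OF tr[OF x, of k], of "nat (- k)"] False by simp
    finally show ?thesis by (metis translate_translate add.right_inverse translate_0)
  qed
  from curtis_hedlund_lyndon[OF A(3)] fc obtain N :: nat where
    N: "\<And>x x'. x \<in> X \<Longrightarrow> x' \<in> X \<Longrightarrow> (\<forall>i\<in>{- int N..int N}. x i = x' i) \<Longrightarrow> \<pi> x 0 = \<pi> x' 0"
    unfolding factor_code_def by metis
  \<comment> \<open>Windows must be as long as the forbidden words and as the range \<open>{-N..N}\<close> of the code.\<close>
  define K where "K = max K0 (2 * int N + 1)"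
  have loc: "\<pi> x (i + int N) = \<pi> x' (i + int N)" 
    if x: "x \<in> X" "x' \<in> X" and eq: "\<And>j. j \<in> {i..<i + K} \<Longrightarrow> x j = x' j" for x x' i
  proof -
    have "\<pi> (translate (i + int N) x) 0 = \<pi> (translate (i + int N) x') 0"
      by (rule N) (use x tr in \<open>auto intro!: eq simp: K_def\<close>)
    then show ?thesis using code_tr x by simp
  qed
  have "sliding_block_code X Y \<pi> A K (int N)"
  proof
    show "0 < K" by (simp add: K_def)
    show "z \<in> X" if "\<And>i. \<exists>x\<in>X. \<forall>j\<in>{i..<i + K}. z j = x j" for z
      using that by (intro gl[of K]) (auto simp: K_def)
    show "\<pi> ` X = Y" using fc by (simp add: factor_code_def)
  qed (fact A tr code_tr loc)+
  then show ?thesis by (rule that)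
qed

context sliding_block_code
begin

lemma code_in_Y: "x \<in> X \<Longrightarrow> \<pi> x \<in> Y"
  using code_image by blast

lemma code_eqI:
  assumes "x \<in> X" "x' \<in> X" "\<And>j. j \<in> {i - r..<i - r + K} \<Longrightarrow> x j = x' j"
  shows "\<pi> x i = \<pi> x' i"
  using code_local[OF assms(1,2), of "i - r"] assms(3) by simp

lemma code_vimage_cylinder:
  assumes "B \<in> cylinders Y" shows "\<pi> -` B \<inter> X \<in> cylinders X"
proof -
  obtain J where J: "finite J" "determined_on J Y B" using assms by (auto simp: cylinders_def)
  have "determined_on (\<Union>i\<in>J. {i - r..<i - r + K}) X (\<pi> -` B \<inter> X)"
    unfolding determined_on_def
  proof (intro conjI ballI impI)
    fix x x' assume x: "x \<in> \<pi> -` B \<inter> X" "x' \<in> X" and eq: "\<forall>j\<in>(\<Union>i\<in>J. {i - r..<i - r + K}). x j = x' j"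
    have "\<pi> x i = \<pi> x' i" if "i \<in> J" for i
      using x eq that by (intro code_eqI) auto
    then have "\<pi> x \<in> B \<longleftrightarrow> \<pi> x' \<in> B"
      using x by (intro determined_onD[OF J(2)]) (simp_all add: code_in_Y)
    then show "x' \<in> \<pi> -` B \<inter> X" using x by simp
  qed auto
  then show ?thesis using J(1) by (intro cylindersI) auto
qed

lemma measurable_code [measurable]: "\<pi> \<in> borel_on X \<rightarrow>\<^sub>M borel_on Y"
  by (rule measurable_borel_onI) (auto simp: code_in_Y intro: code_vimage_cylinder cylinder_sets)

lemma translate_vimage_cylinder:
  assumes "C \<in> cylinders X" shows "translate k -` C \<inter> X \<in> cylinders X"
proof -
  obtain J where J: "finite J" "determined_on J X C" using assms by (auto simp: cylinders_def)
  have "determined_on ((\<lambda>i. i + k) ` J) X (translate k -` C \<inter> X)"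
    unfolding determined_on_def
  proof (intro conjI ballI impI)
    fix x x' assume x: "x \<in> translate k -` C \<inter> X" "x' \<in> X" and eq: "\<forall>j\<in>(\<lambda>i. i + k) ` J. x j = x' j"
    have "translate k x \<in> C \<longleftrightarrow> translate k x' \<in> C"
      by (rule determined_onD[OF J(2)]) (use x eq in \<open>simp_all add: translate_X\<close>)
    then show "x' \<in> translate k -` C \<inter> X" using x by simp
  qed auto
  then show ?thesis using J(1) by (intro cylindersI) auto
qed

lemma measurable_translate [measurable]: "translate k \<in> borel_on X \<rightarrow>\<^sub>M borel_on X"
  by (rule measurable_borel_onI) (auto simp: translate_X intro: translate_vimage_cylinder cylinder_sets)

lemma translate_Y:
  assumes "y \<in> Y" shows "translate k y \<in> Y"
proof -
  obtain x where x: "x \<in> X" "y = \<pi> x" using assms code_image by blast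
  then show ?thesis using code_in_Y[OF translate_X[OF x(1)]] code_translate[OF x(1), of k] by metis
qed

lemma measurable_translate_Y [measurable]: "translate k \<in> borel_on Y \<rightarrow>\<^sub>M borel_on Y"
proof (rule measurable_borel_onI)
  fix C assume "C \<in> cylinders Y"
  then obtain J where J: "finite J" "determined_on J Y C" by (auto simp: cylinders_def)
  have "determined_on ((\<lambda>i. i + k) ` J) Y (translate k -` C \<inter> Y)"
    unfolding determined_on_def
  proof (intro conjI ballI impI)
    fix x x' assume x: "x \<in> translate k -` C \<inter> Y" "x' \<in> Y" and eq: "\<forall>j\<in>(\<lambda>i. i + k) ` J. x j = x' j"
    have "translate k x \<in> C \<longleftrightarrow> translate k x' \<in> C"
      by (rule determined_onD[OF J(2)]) (use x eq in \<open>simp_all add: translate_Y\<close>)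
    then show "x' \<in> translate k -` C \<inter> Y" using x by simp
  qed auto
  then show "translate k -` C \<inter> space (borel_on Y) \<in> sets (borel_on Y)"
    using J(1) unfolding space_borel_on by (intro cylinder_sets cylindersI[of "(\<lambda>i. i + k) ` J"]) simp
qed (auto simp: translate_Y)

end

lemma invariant_measureD:
  assumes "invariant_measure X \<mu>"
  shows "prob_space \<mu>" "sets \<mu> = sets (borel_on X)" "distr \<mu> \<mu> shift = \<mu>" "space \<mu> = X"
  using assms sets_eq_imp_space_eq[of \<mu> "borel_on X"] by (auto simp: invariant_measure_def)

lemma (in sliding_block_code) distr_translate:
  assumes "invariant_measure X \<mu>" shows "distr \<mu> \<mu> (translate k) = \<mu>"
proof -
  note D = invariant_measureD[OF assms]
  have m: "translate k \<in> \<mu> \<rightarrow>\<^sub>M \<mu>" for k using measurable_translate D(2) by (simp cong: measurable_cong_sets)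
  have nat: "distr \<mu> \<mu> (translate (int n)) = \<mu>" for n
  proof (induction n)
    case 0 
    have "translate 0 = (\<lambda>x. x)" by auto
    then show ?case using distr_id2[of \<mu> \<mu>] by simp
  next
    case (Suc n)
    have "distr (distr \<mu> \<mu> shift) \<mu> (translate (int n)) = distr \<mu> \<mu> (translate (int n) \<circ> shift)"
      using m[of 1] m[of "int n"] by (intro distr_distr) (auto simp: shift_eq_translate)
    moreover have "translate (int n) \<circ> shift = translate (int (Suc n))"
      by (rule ext) (simp add: shift_eq_translate add.commute)
    ultimately show ?case using Suc D(3) by metis
  qed
  show ?thesis
  proof (cases "0 \<le> k")
    case True then show ?thesis using nat[of "nat k"] by simp
  next
    case False
    then have n: "distr \<mu> \<mu> (translate (- k)) = \<mu>" using nat[of "nat (- k)"] by simp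
    have "distr (distr \<mu> \<mu> (translate (- k))) \<mu> (translate k) = distr \<mu> \<mu> (translate k \<circ> translate (- k))"
      using m by (intro distr_distr) auto
    moreover have "translate k \<circ> translate (- k) = (\<lambda>x :: int \<Rightarrow> 'a. x)" by auto
    ultimately show ?thesis using n distr_id2[of \<mu> \<mu>, OF refl] by simp
  qed
qed

section \<open>Kolmogorov--Sinai entropy of a shift\<close>

lemma partition_entropy_fibres:
  assumes "finite (g ` space M)" "P = (\<lambda>v. g -` {v} \<inter> space M) ` g ` space M"
  shows "partition_entropy M P = fun_entropy M g"
proof -
  have "inj_on (\<lambda>v. g -` {v} \<inter> space M) (g ` space M)"
    by (intro inj_onI) blast
  then show ?thesis
    unfolding partition_entropy_def fun_entropy_def assms(2) by (simp add: sum.reindex)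
qed

text \<open>
  Two points lie in the same cell of the refinement exactly if their itineraries agree. An itinerary
  lists, instead of the cells visited, the singletons consisting of them, which avoids choosing a cell.
\<close>

lemma iterated_partition_fibres:
  assumes P: "partition_on (space M) P" and T: "T \<in> space M \<rightarrow> space M" and n: "1 \<le> n"
  defines "g \<equiv> \<lambda>x. restrict (\<lambda>i. {B \<in> P. (T ^^ i) x \<in> B}) {..<n}"
  shows "iterated_partition M T P n = (\<lambda>v. g -` {v} \<inter> space M) ` g ` space M"
proof -
  define Q where "Q i = (\<lambda>A. (T ^^ i) -` A \<inter> space M) ` P" for i :: nat
  have Ti: "(T ^^ i) x \<in> space M" if "x \<in> space M" for i x
    using that T by (induction i) auto
  have it: "iterated_partition M T P n = (\<Union>f\<in>(\<Pi> R\<in>Q ` {..<n}. R). {\<Inter> (f ` Q ` {..<n})}) - {{}}"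
    unfolding iterated_partition_def common_refinement Q_def ..
  have cell: "{B \<in> P. z \<in> B} = {C}" if "C \<in> P" "z \<in> C" for C z
    using that P unfolding partition_on_def disjoint_def by blast
  have key: "\<Inter> (f ` Q ` {..<n}) = g -` {g x} \<inter> space M"
    if f: "f \<in> (\<Pi> R\<in>Q ` {..<n}. R)" and x: "x \<in> \<Inter> (f ` Q ` {..<n})" for f x
  proof -
    have "\<exists>C\<in>P. f (Q i) = (T ^^ i) -` C \<inter> space M" if "i < n" for i
    proof -
      have "f (Q i) \<in> Q i" using f that by blast
      then show ?thesis unfolding Q_def by blast
    qed
    then obtain C where C: "\<And>i. i < n \<Longrightarrow> C i \<in> P" "\<And>i. i < n \<Longrightarrow> f (Q i) = (T ^^ i) -` C i \<inter> space M"
      by metis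
    have xC: "(T ^^ i) x \<in> C i" if "i < n" for i using x C(2)[OF that] that by auto
    have eq: "\<Inter> (f ` Q ` {..<n}) = {y. \<forall>i<n. (T ^^ i) y \<in> C i \<and> y \<in> space M}"
      using C(2) by auto
    have "(\<forall>i<n. (T ^^ i) y \<in> C i) \<longleftrightarrow> g y = g x" if y: "y \<in> space M" for y
    proof -
      have x_cell: "{B \<in> P. (T ^^ i) x \<in> B} = {C i}" if "i < n" for i
        using cell[OF C(1)[OF that] xC[OF that]] .
      have "g y = g x \<longleftrightarrow> (\<forall>i\<in>{..<n}. {B \<in> P. (T ^^ i) y \<in> B} = {B \<in> P. (T ^^ i) x \<in> B})"
        unfolding g_def restrict_eq_iff ..
      also have "\<dots> \<longleftrightarrow> (\<forall>i\<in>{..<n}. {B \<in> P. (T ^^ i) y \<in> B} = {C i})"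
        by (intro ball_cong refl) (simp only: lessThan_iff x_cell)
      finally have "g y = g x \<longleftrightarrow> (\<forall>i\<in>{..<n}. {B \<in> P. (T ^^ i) y \<in> B} = {C i})" .
      moreover have "{B \<in> P. (T ^^ i) y \<in> B} = {C i} \<longleftrightarrow> (T ^^ i) y \<in> C i" if "i < n" for i
        using cell[OF C(1)[OF that], of "(T ^^ i) y"] by blast
      ultimately show ?thesis by (simp only: Ball_def lessThan_iff) blast
    qed
    note mem = this
    show ?thesis unfolding eq
    proof (intro equalityI subsetI)
      fix y assume y: "y \<in> {y. \<forall>i<n. (T ^^ i) y \<in> C i \<and> y \<in> space M}"
      then have "y \<in> space M" using n by (simp add: Suc_le_eq)
      then show "y \<in> g -` {g x} \<inter> space M" using mem[of y] y by simp
    next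
      fix y assume "y \<in> g -` {g x} \<inter> space M"
      then show "y \<in> {y. \<forall>i<n. (T ^^ i) y \<in> C i \<and> y \<in> space M}" using mem[of y] by simp
    qed
  qed
  show ?thesis
  proof (intro equalityI subsetI)
    fix E assume "E \<in> iterated_partition M T P n"
    then obtain f where f: "f \<in> (\<Pi> R\<in>Q ` {..<n}. R)" "E = \<Inter> (f ` Q ` {..<n})" "E \<noteq> {}"
      unfolding it by auto
    then obtain x where x: "x \<in> E" by blast
    have E: "E = g -` {g x} \<inter> space M" using key[OF f(1), of x] x unfolding f(2) .
    then have "x \<in> space M" using x by simp
    then show "E \<in> (\<lambda>v. g -` {v} \<inter> space M) ` g ` space M" using E by simp
  next
    fix E assume "E \<in> (\<lambda>v. g -` {v} \<inter> space M) ` g ` space M"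
    then obtain x where x: "x \<in> space M" "E = g -` {g x} \<inter> space M" by blast
    \<comment> \<open>Different times may induce the same pulled-back partition, so the choice depends on \<open>R\<close> only.\<close>
    define f where "f R = (SOME E. E \<in> R \<and> x \<in> E)" for R
    have f: "f R \<in> R \<and> x \<in> f R" if R: "R \<in> Q ` {..<n}" for R
    proof -
      obtain i where i: "R = Q i" using R by blast
      have "(T ^^ i) x \<in> \<Union>P" using Ti[OF x(1)] P by (auto simp: partition_on_def)
      then have "\<exists>E. E \<in> R \<and> x \<in> E" using x(1) unfolding i Q_def by blast
      then show ?thesis unfolding f_def by (rule someI_ex)
    qed
    then have fP: "f \<in> (\<Pi> R\<in>Q ` {..<n}. R)" and xf: "x \<in> \<Inter> (f ` Q ` {..<n})" by auto
    have "E = \<Inter> (f ` Q ` {..<n})" using key[OF fP xf] x(2) by simp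
    then show "E \<in> iterated_partition M T P n" unfolding it using fP xf by blast
  qed
qed

lemma simple_function_finite_range:
  assumes "finite V" "f ` space M \<subseteq> V" "\<And>v. v \<in> V \<Longrightarrow> f -` {v} \<inter> space M \<in> sets M"
  shows "simple_function M f"
  unfolding simple_function_def using assms finite_subset by blast

lemma simple_function_mem: 
  assumes "B \<in> sets M" shows "simple_function M (\<lambda>x. x \<in> B)"
proof (rule simple_function_finite_range[of UNIV])
  have "(\<lambda>x. x \<in> B) -` {True} \<inter> space M = B" "(\<lambda>x. x \<in> B) -` {False} \<inter> space M = space M - B"
    using sets.sets_into_space[OF assms] by auto
  then show "(\<lambda>x. x \<in> B) -` {v} \<inter> space M \<in> sets M" for v using assms by (cases v) auto
qed auto

context sliding_block_code
begin

lemma simple_function_word_on: 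
  assumes M: "sets M = sets (borel_on X)" and J: "finite J"
  shows "simple_function M (\<lambda>x. restrict x J)"
proof (rule simple_function_restrict[OF J, of M "\<lambda>i x. x i"])
  fix i
  have sp: "space M = X" using sets_eq_imp_space_eq[OF M] by simp
  show "simple_function M (\<lambda>x. x i)"
  proof (rule simple_function_finite_range[OF finite_A])
    show "(\<lambda>x. x i) ` space M \<subseteq> A" using alphabet by (auto simp: sp)
    fix c
    have "(\<lambda>x. x i) -` {c} \<inter> space M = {x \<in> X. x i = c}" by (auto simp: sp)
    then show "(\<lambda>x. x i) -` {c} \<inter> space M \<in> sets M" using coordinate_sets M by simp
  qed
qed

context
  fixes \<mu> :: "(int \<Rightarrow> 'a) measure"
  assumes inv: "invariant_measure X \<mu>"
begin

interpretation prob_space \<mu> by (rule invariant_measureD(1)[OF inv])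

lemma space_invariant: "space \<mu> = X" by (rule invariant_measureD(4)[OF inv])

lemma sets_invariant: "sets \<mu> = sets (borel_on X)" by (rule invariant_measureD(2)[OF inv])

lemma simple_function_word: "finite J \<Longrightarrow> simple_function \<mu> (\<lambda>x. restrict x J)"
  by (rule simple_function_word_on[OF sets_invariant])

lemma measurable_translate_invariant: "translate k \<in> \<mu> \<rightarrow>\<^sub>M \<mu>"
  using measurable_translate sets_invariant by (simp cong: measurable_cong_sets)

lemma simple_function_translate: "simple_function \<mu> f \<Longrightarrow> simple_function \<mu> (\<lambda>x. f (translate k x))"
  by (rule simple_function_measurable_comp[OF measurable_translate_invariant])

lemma fun_entropy_translate: "simple_function \<mu> f \<Longrightarrow> fun_entropy \<mu> (\<lambda>x. f (translate k x)) = fun_entropy \<mu> f"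
  by (rule fun_entropy_measure_preserving[OF measurable_translate_invariant distr_translate[OF inv]])

lemma fun_cond_entropy_translate:
  assumes "simple_function \<mu> f" "simple_function \<mu> h"
  shows "fun_cond_entropy \<mu> (\<lambda>x. f (translate k x)) (\<lambda>x. h (translate k x)) = fun_cond_entropy \<mu> f h"
  unfolding fun_cond_entropy_def
  using fun_entropy_translate[OF assms(2), of k] fun_entropy_translate[OF simple_function_Pair[OF assms], of k] by simp

lemma word_translate_eq_iff:
  "restrict (translate k x) {a..<b} = restrict (translate k y) {a..<b} \<longleftrightarrow> restrict x {a + k..<b + k} = restrict y {a + k..<b + k}"
  unfolding restrict_eq_iff
proof (intro iffI ballI)
  fix i assume "\<forall>i\<in>{a..<b}. translate k x i = translate k y i" "i \<in> {a + k..<b + k}"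
  then show "x i = y i" by (auto dest: bspec[of _ _ "i - k"])
qed auto

lemma word_entropy_translate:
  "fun_entropy \<mu> (\<lambda>x. restrict x {a + k..<b + k}) = fun_entropy \<mu> (\<lambda>x. restrict x {a..<b})"
proof -
  have "fun_entropy \<mu> (\<lambda>x. restrict x {a + k..<b + k}) = fun_entropy \<mu> (\<lambda>x. restrict (translate k x) {a..<b})"
    by (rule fun_entropy_cong_kernel[OF simple_function_translate[OF simple_function_word]])
      (simp, simp only: word_translate_eq_iff)
  then show ?thesis using fun_entropy_translate[OF simple_function_word, of "{a..<b}" k] by simp
qed

definition word_entropy :: "nat \<Rightarrow> real" where
  "word_entropy n = fun_entropy \<mu> (\<lambda>x. restrict x {0..<int n})"

lemma simple_function_itinerary:
  assumes "simple_function \<mu> f"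
  shows "simple_function \<mu> (\<lambda>x. restrict (\<lambda>i. f (translate (int i) x)) {..<n})"
  using simple_function_translate[OF assms] by (intro simple_function_restrict) auto

lemma itinerary_entropy_converges:
  assumes f: "simple_function \<mu> f"
  shows "convergent (\<lambda>n. fun_entropy \<mu> (\<lambda>x. restrict (\<lambda>i. f (translate (int i) x)) {..<n}) / real n)"
proof (rule subadditive_quotient_converges)
  fix m n :: nat
  let ?F = "\<lambda>n x. restrict (\<lambda>i. f (translate (int i) x)) {..<n}"
  have "fun_entropy \<mu> (?F (m + n)) \<le> fun_entropy \<mu> (\<lambda>x. (?F m x, ?F n (translate (int m) x)))"
  proof (rule fun_entropy_coarser)
    show "simple_function \<mu> (\<lambda>x. (?F m x, ?F n (translate (int m) x)))"
      by (intro simple_function_Pair simple_function_itinerary f simple_function_translate[of "?F n"])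
    fix x y assume "(?F m x, ?F n (translate (int m) x)) = (?F m y, ?F n (translate (int m) y))"
    then have 1: "\<And>i. i < m \<Longrightarrow> f (translate (int i) x) = f (translate (int i) y)"
      and 2: "\<And>i. i < n \<Longrightarrow> f (translate (int i + int m) x) = f (translate (int i + int m) y)"
      by (auto simp: restrict_eq_iff)
    have "f (translate (int i) x) = f (translate (int i) y)" if "i < m + n" for i
    proof (cases "i < m")
      case False
      then have "i - m < n" "int (i - m) + int m = int i" using that by auto
      then show ?thesis using 2[of "i - m"] by metis
    qed (rule 1)
    then show "?F (m + n) x = ?F (m + n) y" unfolding restrict_eq_iff by simp
  qed
  also have "\<dots> \<le> fun_entropy \<mu> (?F m) + fun_entropy \<mu> (\<lambda>x. ?F n (translate (int m) x))"
    by (intro fun_entropy_Pair_le simple_function_itinerary f simple_function_translate[of "?F n"])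
  also have "fun_entropy \<mu> (\<lambda>x. ?F n (translate (int m) x)) = fun_entropy \<mu> (?F n)"
    by (intro fun_entropy_translate simple_function_itinerary f)
  finally show "fun_entropy \<mu> (?F (m + n)) \<le> fun_entropy \<mu> (?F m) + fun_entropy \<mu> (?F n)" .
qed (rule fun_entropy_nonneg)

lemma itinerary_coordinate_eq_iff:
  "restrict (\<lambda>i. translate (int i) x 0) {..<n} = restrict (\<lambda>i. translate (int i) y 0) {..<n} \<longleftrightarrow> restrict x {0..<int n} = restrict y {0..<int n}"
  unfolding restrict_eq_iff
proof (intro iffI ballI)
  fix i assume "\<forall>i\<in>{..<n}. translate (int i) x 0 = translate (int i) y 0" "i \<in> {0..<int n}"
  then show "x i = y i" by (auto dest: bspec[of _ _ "nat i"])
qed auto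

lemma simple_function_coordinate: "simple_function \<mu> (\<lambda>x. x i)"
  by (rule simple_function_coarser[OF simple_function_word[of "{i}"]]) (auto simp: restrict_eq_iff)

lemma word_entropy_itinerary:
  "word_entropy n = fun_entropy \<mu> (\<lambda>x. restrict (\<lambda>i. translate (int i) x 0) {..<n})"
  unfolding word_entropy_def
  by (rule fun_entropy_cong_kernel[OF simple_function_itinerary[of "\<lambda>x. x 0", OF simple_function_coordinate]])
    (simp only: itinerary_coordinate_eq_iff)

lemma word_entropy_converges: "convergent (\<lambda>n. word_entropy n / real n)"
  using itinerary_entropy_converges[OF simple_function_coordinate[of 0]] by (simp only: word_entropy_itinerary)

definition entropy_rate :: real where
  "entropy_rate = lim (\<lambda>n. word_entropy n / real n)"

lemma word_entropy_tendsto: "(\<lambda>n. word_entropy n / real n) \<longlonglongrightarrow> entropy_rate"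
  using word_entropy_converges by (simp add: entropy_rate_def convergent_LIMSEQ_iff)

lemma word_entropy_add_le: "word_entropy (m + n) \<le> word_entropy m + word_entropy n"
proof -
  have "word_entropy (m + n) \<le> fun_entropy \<mu> (\<lambda>x. (restrict x {0..<int m}, restrict x {0 + int m..<int n + int m}))"
    unfolding word_entropy_def
  proof (rule fun_entropy_coarser)
    show "simple_function \<mu> (\<lambda>x. (restrict x {0..<int m}, restrict x {0 + int m..<int n + int m}))"
      by (intro simple_function_Pair simple_function_word) auto
  qed (auto simp: restrict_eq_iff)
  also have "\<dots> \<le> fun_entropy \<mu> (\<lambda>x. restrict x {0..<int m}) + fun_entropy \<mu> (\<lambda>x. restrict x {0 + int m..<int n + int m})"
    by (intro fun_entropy_Pair_le simple_function_word) auto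
  also have "\<dots> = word_entropy m + word_entropy n"
    unfolding word_entropy_translate by (simp add: word_entropy_def)
  finally show ?thesis .
qed

text \<open>
  Each cell of \<open>P\<close> is close to a cylinder, and a long word determines these finitely many cylinders.
\<close>

lemma cond_entropy_given_word_small:
  assumes P: "measurable_partition \<mu> P" and e: "0 < e"
  shows "\<exists>k::nat. fun_cond_entropy \<mu> (\<lambda>x. {B \<in> P. x \<in> B}) (\<lambda>x. restrict x {- int k..<int k}) \<le> e"
proof -
  have P: "finite P" "P \<subseteq> sets \<mu>" using P by (auto simp: measurable_partition_def)
  define d where "d = e / (real (card P) + 1)"
  have d: "0 < d" using e by (simp add: d_def add_nonneg_pos)
  have "\<exists>J. finite J \<and> fun_cond_entropy \<mu> (\<lambda>x. x \<in> B) (\<lambda>x. restrict x J) \<le> d" if B: "B \<in> P" for B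
  proof -
    have BM: "B \<in> sets \<mu>" using B P by blast
    have "\<exists>C\<in>cylinders X. prob (B - C) + prob (C - B) < inverse (real (Suc k))" for k
      by (rule symmetric_difference_approximation[OF finite_measure_axioms sets_invariant BM]) simp
    then obtain C where C: "\<And>k. C k \<in> cylinders X" "\<And>k. prob (B - C k) + prob (C k - B) < inverse (real (Suc k))"
      by metis
    have CM: "C k \<in> sets \<mu>" for k using C(1) cylinder_sets sets_invariant by blast
    have "(\<lambda>k. prob (B - C k) + prob (C k - B)) \<longlonglongrightarrow> 0"
      by (rule tendsto_sandwich[OF _ _ tendsto_const LIMSEQ_inverse_real_of_nat])
        (use C(2) in \<open>auto simp: less_imp_le\<close>)
    from fun_cond_entropy_indicator_tendsto_0[OF BM CM this]
    have "eventually (\<lambda>k. fun_cond_entropy \<mu> (\<lambda>x. x \<in> B) (\<lambda>x. x \<in> C k) < d) sequentially"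
      using d by (rule order_tendstoD(2))
    then obtain k where k: "fun_cond_entropy \<mu> (\<lambda>x. x \<in> B) (\<lambda>x. x \<in> C k) < d"
      by (meson eventually_sequentially order_refl)
    obtain J where J: "finite J" "determined_on J X (C k)" using C(1)[of k] by (auto simp: cylinders_def)
    have "fun_cond_entropy \<mu> (\<lambda>x. x \<in> B) (\<lambda>x. restrict x J) \<le> fun_cond_entropy \<mu> (\<lambda>x. x \<in> B) (\<lambda>x. x \<in> C k)"
    proof (rule fun_cond_entropy_finer_condition[OF simple_function_mem[OF BM] simple_function_word[OF J(1)]])
      fix x y assume "x \<in> space \<mu>" "y \<in> space \<mu>" "restrict x J = restrict y J"
      then show "(x \<in> C k) = (y \<in> C k)"
        by (intro determined_onD[OF J(2)]) (auto simp: space_invariant restrict_eq_iff)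
    qed
    then show ?thesis using J(1) k by (intro exI[of _ J]) auto
  qed
  then obtain J where J: "\<And>B. B \<in> P \<Longrightarrow> finite (J B)" 
    "\<And>B. B \<in> P \<Longrightarrow> fun_cond_entropy \<mu> (\<lambda>x. x \<in> B) (\<lambda>x. restrict x (J B)) \<le> d" by metis
  have "finite (\<Union>B\<in>P. J B)" using P(1) J(1) by blast
  then have "finite (abs ` (\<Union>B\<in>P. J B))" by blast
  then obtain b where b: "\<And>j. j \<in> (\<Union>B\<in>P. J B) \<Longrightarrow> \<bar>j\<bar> \<le> b" by (meson Max_ge imageI)
  define k where "k = nat (b + 1)"
  have sub: "J B \<subseteq> {- int k..<int k}" if "B \<in> P" for B
  proof
    fix j assume "j \<in> J B"
    then have "\<bar>j\<bar> \<le> b" using b that by blast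
    then show "j \<in> {- int k..<int k}" by (auto simp: k_def)
  qed
  let ?W = "\<lambda>x. restrict x {- int k..<int k}"
  have W: "simple_function \<mu> ?W" by (rule simple_function_word) auto
  have sB: "simple_function \<mu> (\<lambda>x. x \<in> B)" if "B \<in> P" for B
    using that P by (intro simple_function_mem) auto
  have "fun_cond_entropy \<mu> (\<lambda>x. {B \<in> P. x \<in> B}) ?W \<le> fun_cond_entropy \<mu> (\<lambda>x. restrict (\<lambda>B. x \<in> B) P) ?W"
    by (rule fun_cond_entropy_coarser[OF simple_function_restrict[OF P(1) sB] W]) (auto simp: restrict_eq_iff)
  also have "\<dots> \<le> (\<Sum>B\<in>P. fun_cond_entropy \<mu> (\<lambda>x. x \<in> B) ?W)"
    by (rule fun_cond_entropy_family_le[OF P(1) sB W])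
  also have "\<dots> \<le> (\<Sum>B\<in>P. d)"
  proof (rule sum_mono)
    fix B assume B: "B \<in> P"
    have "fun_cond_entropy \<mu> (\<lambda>x. x \<in> B) ?W \<le> fun_cond_entropy \<mu> (\<lambda>x. x \<in> B) (\<lambda>x. restrict x (J B))"
      by (rule fun_cond_entropy_finer_condition[OF sB[OF B] W]) (use sub[OF B] in \<open>auto simp: restrict_eq_iff\<close>)
    then show "fun_cond_entropy \<mu> (\<lambda>x. x \<in> B) ?W \<le> d" using J(2)[OF B] by simp
  qed
  also have "\<dots> \<le> e" using e by (simp add: d_def field_simps)
  finally show ?thesis by blast
qed

lemma partition_entropy_eq_itinerary:
  assumes P: "measurable_partition \<mu> P" and n: "1 \<le> n"
  shows "partition_entropy \<mu> (iterated_partition \<mu> shift P n)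
       = fun_entropy \<mu> (\<lambda>x. restrict (\<lambda>i. {B \<in> P. translate (int i) x \<in> B}) {..<n})"
proof -
  have "partition_on (space \<mu>) P" using P by (simp add: measurable_partition_def)
  moreover have "shift \<in> space \<mu> \<rightarrow> space \<mu>" using translate_X by (auto simp: space_invariant shift_eq_translate)
  ultimately have "iterated_partition \<mu> shift P n = (\<lambda>v. (\<lambda>x. restrict (\<lambda>i. {B \<in> P. (shift ^^ i) x \<in> B}) {..<n}) -` {v} \<inter> space \<mu>)
     ` (\<lambda>x. restrict (\<lambda>i. {B \<in> P. (shift ^^ i) x \<in> B}) {..<n}) ` space \<mu>"
    using n by (rule iterated_partition_fibres)
  moreover have "finite ((\<lambda>x. restrict (\<lambda>i. {B \<in> P. (shift ^^ i) x \<in> B}) {..<n}) ` space \<mu>)"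
  proof (rule finite_subset)
    show "(\<lambda>x. restrict (\<lambda>i. {B \<in> P. (shift ^^ i) x \<in> B}) {..<n}) ` space \<mu> \<subseteq> PiE {..<n} (\<lambda>_. Pow P)" by auto
    show "finite (PiE {..<n} (\<lambda>_. Pow P))" using P by (intro finite_PiE) (auto simp: measurable_partition_def)
  qed
  ultimately show ?thesis by (subst partition_entropy_fibres) (auto simp: shift_funpow)
qed

lemma simple_function_cell:
  assumes "measurable_partition \<mu> P" shows "simple_function \<mu> (\<lambda>x. {B \<in> P. x \<in> B})"
proof (rule simple_function_coarser)
  show "simple_function \<mu> (\<lambda>x. restrict (\<lambda>B. x \<in> B) P)"
    using assms by (intro simple_function_restrict simple_function_mem) (auto simp: measurable_partition_def)
qed (auto simp: restrict_eq_iff)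

text \<open>
  Given the word of length \<open>n + 2 * k\<close> around it, every one of the \<open>n\<close> entries of the itinerary has
  conditional entropy at most \<open>e\<close>.
\<close>

lemma itinerary_entropy_le:
  assumes P: "measurable_partition \<mu> P"
  shows "lim (\<lambda>n. partition_entropy \<mu> (iterated_partition \<mu> shift P n) / real n) \<le> entropy_rate"
proof -
  define f where "f = (\<lambda>x. {B \<in> P. x \<in> B})"
  have f: "simple_function \<mu> f" unfolding f_def by (rule simple_function_cell[OF P])
  let ?F = "\<lambda>n x. restrict (\<lambda>i. f (translate (int i) x)) {..<n}"
  have "convergent (\<lambda>n. fun_entropy \<mu> (?F n) / real n)" by (rule itinerary_entropy_converges[OF f])
  then obtain L where L: "(\<lambda>n. fun_entropy \<mu> (?F n) / real n) \<longlonglongrightarrow> L" by (auto simp: convergent_def)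
  have "eventually (\<lambda>n. fun_entropy \<mu> (?F n) / real n = partition_entropy \<mu> (iterated_partition \<mu> shift P n) / real n) sequentially"
    using eventually_ge_at_top[of 1] by eventually_elim (simp add: partition_entropy_eq_itinerary[OF P] f_def)
  then have "(\<lambda>n. partition_entropy \<mu> (iterated_partition \<mu> shift P n) / real n) \<longlonglongrightarrow> L"
    using L by (rule Lim_transform_eventually[rotated])
  then have limL: "lim (\<lambda>n. partition_entropy \<mu> (iterated_partition \<mu> shift P n) / real n) = L" by (rule limI)
  have "L \<le> entropy_rate + e" if e: "0 < e" for e
  proof -
    obtain k :: nat where k: "fun_cond_entropy \<mu> f (\<lambda>x. restrict x {- int k..<int k}) \<le> e"
      using cond_entropy_given_word_small[OF P e] unfolding f_def by blast
    have bound: "fun_entropy \<mu> (?F n) \<le> word_entropy n + word_entropy (k + k) + real n * e" for n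
    proof -
      let ?W = "\<lambda>x. restrict x {0 + (- int k)..<int (n + (k + k)) + (- int k)}"
      have W: "simple_function \<mu> ?W" by (rule simple_function_word) auto
      have fi: "simple_function \<mu> (\<lambda>x. f (translate (int i) x))" for i by (rule simple_function_translate[OF f])
      have "fun_entropy \<mu> (?F n) \<le> fun_entropy \<mu> ?W + fun_cond_entropy \<mu> (?F n) ?W"
        by (rule fun_entropy_le_cond[OF simple_function_itinerary[OF f] W])
      also have "fun_entropy \<mu> ?W = word_entropy (n + (k + k))"
        unfolding word_entropy_translate by (simp add: word_entropy_def)
      also have "word_entropy (n + (k + k)) \<le> word_entropy n + word_entropy (k + k)" by (rule word_entropy_add_le)
      also have "fun_cond_entropy \<mu> (?F n) ?W \<le> (\<Sum>i<n. fun_cond_entropy \<mu> (\<lambda>x. f (translate (int i) x)) ?W)"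
        by (rule fun_cond_entropy_family_le[OF _ fi W]) auto
      also have "\<dots> \<le> (\<Sum>i<n. e)"
      proof (rule sum_mono)
        fix i assume i: "i \<in> {..<n}"
        have "fun_cond_entropy \<mu> (\<lambda>x. f (translate (int i) x)) ?W
          \<le> fun_cond_entropy \<mu> (\<lambda>x. f (translate (int i) x)) (\<lambda>x. restrict (translate (int i) x) {- int k..<int k})"
        proof (rule fun_cond_entropy_finer_condition[OF fi W])
          fix x y assume "?W x = ?W y"
          then show "restrict (translate (int i) x) {- int k..<int k} = restrict (translate (int i) y) {- int k..<int k}"
            using i unfolding word_translate_eq_iff by (auto simp: restrict_eq_iff)
        qed
        also have "\<dots> = fun_cond_entropy \<mu> f (\<lambda>x. restrict x {- int k..<int k})"
          by (intro fun_cond_entropy_translate f simple_function_word) auto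
        finally show "fun_cond_entropy \<mu> (\<lambda>x. f (translate (int i) x)) ?W \<le> e" using k by simp
      qed
      also have "(\<Sum>i<n. e) = real n * e" by simp
      finally show ?thesis by (simp only: add.assoc)
    qed
    have "(\<lambda>n. word_entropy n / real n + word_entropy (k + k) * inverse (real n) + e) \<longlonglongrightarrow> entropy_rate + word_entropy (k + k) * 0 + e"
      by (intro tendsto_intros word_entropy_tendsto lim_inverse_n)
    moreover have "eventually (\<lambda>n. fun_entropy \<mu> (?F n) / real n \<le> word_entropy n / real n + word_entropy (k + k) * inverse (real n) + e) sequentially"
      using eventually_ge_at_top[of 1]
    proof eventually_elim
      case (elim n)
      have "fun_entropy \<mu> (?F n) / real n \<le> (word_entropy n + word_entropy (k + k) + real n * e) / real n"
        using bound[of n] by (intro divide_right_mono) auto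
      also have "\<dots> = word_entropy n / real n + word_entropy (k + k) * inverse (real n) + e"
        using elim by (simp add: field_simps)
      finally show ?case .
    qed
    ultimately show "L \<le> entropy_rate + e" using L by (intro tendsto_le[OF sequentially_bot]) auto
  qed
  then show ?thesis unfolding limL by (rule field_le_epsilon)
qed

text \<open>
  The Kolmogorov--Sinai theorem for the partition by the symbol at \<open>0\<close>, which attains the supremum.
\<close>

theorem measure_entropy_eq_entropy_rate: "measure_entropy \<mu> shift = ereal entropy_rate"
proof (rule antisym)
  show "measure_entropy \<mu> shift \<le> ereal entropy_rate"
    unfolding measure_entropy_def using itinerary_entropy_le by (intro SUP_least) simp
next
  define P where "P = (\<lambda>c. {x \<in> X. x 0 = c}) ` (\<lambda>x. x 0) ` X"
  have P: "measurable_partition \<mu> P"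
    unfolding measurable_partition_def
  proof (intro conjI)
    have "(\<lambda>x. x 0) ` X \<subseteq> A" using alphabet by auto
    then show "finite P" unfolding P_def using finite_A finite_subset by blast
    show "P \<subseteq> sets \<mu>" unfolding P_def using coordinate_sets sets_invariant by blast
    show "partition_on (space \<mu>) P"
      unfolding partition_on_def P_def space_invariant disjoint_def by auto
  qed
  have cell: "{B \<in> P. x \<in> B} = {B \<in> P. y \<in> B} \<longleftrightarrow> x 0 = y 0" if "x \<in> X" "y \<in> X" for x y
  proof -
    have c: "{B \<in> P. z \<in> B} = {{x \<in> X. x 0 = z 0}}" if "z \<in> X" for z
      using that unfolding P_def by blast
    show ?thesis unfolding c[OF that(1)] c[OF that(2)]
    proof
      assume "{{u \<in> X. u 0 = x 0}} = {{u \<in> X. u 0 = y 0}}"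
      then have "{u \<in> X. u 0 = x 0} = {u \<in> X. u 0 = y 0}" by simp
      moreover have "x \<in> {u \<in> X. u 0 = x 0}" using that(1) by simp
      ultimately have "x \<in> {u \<in> X. u 0 = y 0}" by (rule subst)
      then show "x 0 = y 0" by simp
    qed simp
  qed
  have eq: "fun_entropy \<mu> (\<lambda>x. restrict (\<lambda>i. {B \<in> P. translate (int i) x \<in> B}) {..<n}) = word_entropy n" for n
    unfolding word_entropy_itinerary
  proof (rule fun_entropy_cong_kernel[OF simple_function_itinerary[of "\<lambda>x. x 0", OF simple_function_coordinate]])
    fix x y assume "x \<in> space \<mu>" "y \<in> space \<mu>"
    then have "translate k x \<in> X" "translate k y \<in> X" for k by (simp_all only: translate_X space_invariant)
    from cell[OF this] show "restrict (\<lambda>i. translate (int i) x 0) {..<n} = restrict (\<lambda>i. translate (int i) y 0) {..<n}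
      \<longleftrightarrow> restrict (\<lambda>i. {B \<in> P. translate (int i) x \<in> B}) {..<n} = restrict (\<lambda>i. {B \<in> P. translate (int i) y \<in> B}) {..<n}"
      by (simp only: restrict_eq_iff)
  qed
  have "eventually (\<lambda>n. word_entropy n / real n = partition_entropy \<mu> (iterated_partition \<mu> shift P n) / real n) sequentially"
    using eventually_ge_at_top[of 1] by eventually_elim (simp add: partition_entropy_eq_itinerary[OF P] eq)
  then have "(\<lambda>n. partition_entropy \<mu> (iterated_partition \<mu> shift P n) / real n) \<longlonglongrightarrow> entropy_rate"
    using word_entropy_tendsto by (rule Lim_transform_eventually[rotated])
  then have "lim (\<lambda>n. partition_entropy \<mu> (iterated_partition \<mu> shift P n) / real n) = entropy_rate" by (rule limI)
  then show "ereal entropy_rate \<le> measure_entropy \<mu> shift"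
    unfolding measure_entropy_def using P by (intro SUP_upper2[of P]) auto
qed

end

end

section \<open>Block involutions over a factor code\<close>

context sliding_block_code
begin

text \<open>
  The new symbols in \<open>J\<close> are determined by the old ones in \<open>J\<close>, so involutions of disjoint blocks do
  not interfere.
\<close>

definition block_involution :: "int set \<Rightarrow> ((int \<Rightarrow> 'a) \<Rightarrow> (int \<Rightarrow> 'a)) \<Rightarrow> bool" where
  "block_involution J T \<longleftrightarrow>
     (\<forall>x\<in>X. T x \<in> X \<and> T (T x) = x \<and> \<pi> (T x) = \<pi> x \<and> (\<forall>i. i \<notin> J \<longrightarrow> T x i = x i)) \<and>
     (\<forall>x\<in>X. \<forall>x'\<in>X. (\<forall>i\<in>J. x i = x' i) \<longrightarrow> (\<forall>i\<in>J. T x i = T x' i))"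

lemma block_involutionD:
  assumes "block_involution J T" "x \<in> X"
  shows "T x \<in> X" "T (T x) = x" "\<pi> (T x) = \<pi> x" "i \<notin> J \<Longrightarrow> T x i = x i"
  using assms unfolding block_involution_def by blast+

lemma block_involution_local:
  assumes "block_involution J T" "x \<in> X" "x' \<in> X" "\<And>i. i \<in> J \<Longrightarrow> x i = x' i" "i \<in> J"
  shows "T x i = T x' i"
  using assms unfolding block_involution_def by blast

lemma block_involution_local_or:
  assumes "block_involution J T" "x \<in> X" "x' \<in> X" "\<And>i. i \<in> J \<Longrightarrow> x i = x' i" "x i = x' i"
  shows "T x i = T x' i"
  using assms(5) block_involution_local[OF assms(1-4), of i] block_involutionD(4)[OF assms(1), of _ i] assms(2,3)
  by (cases "i \<in> J") simp_all

lemma block_involution_mono: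
  assumes T: "block_involution J T" and J: "J \<subseteq> J'"
  shows "block_involution J' T"
  unfolding block_involution_def
proof (intro conjI ballI impI allI)
  fix x x' i assume x: "x \<in> X" "x' \<in> X" "\<forall>i\<in>J'. x i = x' i" and i: "i \<in> J'"
  show "T x i = T x' i"
    by (rule block_involution_local_or[OF T]) (use x i J in blast)+
qed (use block_involutionD[OF T] J in blast)+

lemma block_involution_translate:
  assumes T: "block_involution J T"
  shows "block_involution ((\<lambda>i. i + k) ` J) (\<lambda>x. translate (- k) (T (translate k x)))"
  unfolding block_involution_def
proof (intro conjI ballI impI allI)
  fix x assume x: "x \<in> X"
  note D = block_involutionD[OF T translate_X[OF x, of k]]
  show "translate (- k) (T (translate k x)) \<in> X" by (rule translate_X[OF D(1)])
  show "translate (- k) (T (translate k (translate (- k) (T (translate k x))))) = x"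
    unfolding translate_translate using D(2) by simp
  show "\<pi> (translate (- k) (T (translate k x))) = \<pi> x"
    unfolding code_translate[OF D(1)] D(3) code_translate[OF x] translate_translate by simp
  fix i assume "i \<notin> (\<lambda>i. i + k) ` J"
  then have "i - k \<notin> J" by (metis diff_add_cancel image_eqI)
  then show "translate (- k) (T (translate k x)) i = x i" using D(4)[of "i - k"] by simp
next
  fix x x' i assume x: "x \<in> X" "x' \<in> X" "\<forall>i\<in>(\<lambda>i. i + k) ` J. x i = x' i" and i: "i \<in> (\<lambda>i. i + k) ` J"
  have "T (translate k x) (i - k) = T (translate k x') (i - k)"
    by (rule block_involution_local[OF T translate_X[OF x(1)] translate_X[OF x(2)]]) (use x(3) i in auto)
  then show "translate (- k) (T (translate k x)) i = translate (- k) (T (translate k x')) i" by simp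
qed

lemma block_involution_vimage_cylinder:
  assumes T: "block_involution J T" and J: "finite J" and C: "C \<in> cylinders X"
  shows "T -` C \<inter> X \<in> cylinders X"
proof -
  obtain J' where J': "finite J'" "determined_on J' X C" using C by (auto simp: cylinders_def)
  have "determined_on (J \<union> J') X (T -` C \<inter> X)"
    unfolding determined_on_def
  proof (intro conjI ballI impI)
    fix x x' assume x: "x \<in> T -` C \<inter> X" "x' \<in> X" and eq: "\<forall>i\<in>J \<union> J'. x i = x' i"
    have "T x i = T x' i" if "i \<in> J'" for i
      by (rule block_involution_local_or[OF T]) (use x eq that in blast)+
    then have "T x \<in> C \<longleftrightarrow> T x' \<in> C"
      using x block_involutionD(1)[OF T] by (intro determined_onD[OF J'(2)]) blast+
    then show "x' \<in> T -` C \<inter> X" using x by simp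
  qed auto
  then show ?thesis using J J' by (intro cylindersI[of "J \<union> J'"]) auto
qed

lemma measurable_block_involution:
  assumes T: "block_involution J T" and J: "finite J"
  shows "T \<in> borel_on X \<rightarrow>\<^sub>M borel_on X"
proof (rule measurable_borel_onI)
  show "T \<in> space (borel_on X) \<rightarrow> X" using block_involutionD(1)[OF T] by auto
  fix C assume "C \<in> cylinders X"
  then show "T -` C \<inter> space (borel_on X) \<in> sets (borel_on X)"
    unfolding space_borel_on by (intro cylinder_sets block_involution_vimage_cylinder[OF T J])
qed

subsection \<open>Acting on all blocks\<close>

end

locale block_action = sliding_block_code X Y \<pi> A K r
  for X :: "(int \<Rightarrow> 'a::discrete_topology) set" and Y :: "(int \<Rightarrow> 'b::discrete_topology) set"
    and \<pi> :: "(int \<Rightarrow> 'a) \<Rightarrow> (int \<Rightarrow> 'b)" and A :: "'a set" and K r :: int +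
  fixes N :: int and T :: "(int \<Rightarrow> 'a) \<Rightarrow> (int \<Rightarrow> 'a)"
  assumes N: "0 < N" and T: "block_involution {0..<N} T"
begin

definition act_block :: "int \<Rightarrow> (int \<Rightarrow> 'a) \<Rightarrow> (int \<Rightarrow> 'a)" where
  "act_block k x = translate (- (k * N)) (T (translate (k * N) x))"

lemma block_iff: "i \<in> {k * N..<k * N + N} \<longleftrightarrow> i div N = k"
proof
  assume "i \<in> {k * N..<k * N + N}"
  then have "0 \<le> i - k * N" "i - k * N < N" by auto
  then have "(i - k * N + k * N) div N = k" using N by (subst div_mult_self1) auto
  then show "i div N = k" by simp
next
  assume "i div N = k"
  then have "i = k * N + i mod N" using div_mult_mod_eq[of i N] by simp
  moreover have "0 \<le> i mod N" "i mod N < N" using N by simp_all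
  ultimately show "i \<in> {k * N..<k * N + N}" unfolding atLeastLessThan_iff by linarith
qed

lemma block_involution_act_block: "block_involution {k * N..<k * N + N} (act_block k)"
proof -
  have "(\<lambda>i. i + k * N) ` {0..<N} = {k * N..<k * N + N}"
    using image_add_int_atLeastLessThan[of "k * N" "k * N + N"] by (simp add: add.commute)
  then show ?thesis using block_involution_translate[OF T, of "k * N"] unfolding act_block_def by simp
qed

text \<open>
  Block \<open>k\<close> is \<open>{k * N..<k * N + N}\<close>, so position \<open>i\<close> lies in block \<open>i div N\<close>. The set \<open>S\<close> of blocks to
  be acted on may be infinite.
\<close>

definition act_blocks :: "int set \<Rightarrow> (int \<Rightarrow> 'a) \<Rightarrow> (int \<Rightarrow> 'a)" where
  "act_blocks S x = (\<lambda>i. if i div N \<in> S then act_block (i div N) x i else x i)"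

lemma act_blocks_empty: "act_blocks {} x = x"
  by (simp add: act_blocks_def)

lemma act_blocks_eqI: "(i div N \<in> S \<longleftrightarrow> i div N \<in> S') \<Longrightarrow> act_blocks S x i = act_blocks S' x i"
  by (simp add: act_blocks_def)

lemma act_blocks_insert:
  assumes x: "x \<in> X" "act_blocks S x \<in> X" and k: "k \<notin> S"
  shows "act_blocks (insert k S) x = act_block k (act_blocks S x)"
proof
  fix i
  show "act_blocks (insert k S) x i = act_block k (act_blocks S x) i"
  proof (cases "i div N = k")
    case True
    have "act_block k x i = act_block k (act_blocks S x) i"
    proof (rule block_involution_local[OF block_involution_act_block x])
      fix i assume "i \<in> {k * N..<k * N + N}"
      then have "i div N = k" by (simp only: block_iff)
      then show "x i = act_blocks S x i" using k by (simp add: act_blocks_def)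
    qed (simp only: block_iff True)
    then show ?thesis using True by (simp add: act_blocks_def)
  next
    case False
    then have "act_block k (act_blocks S x) i = act_blocks S x i"
      by (intro block_involutionD(4)[OF block_involution_act_block x(2)]) (simp only: block_iff not_False_eq_True)
    then show ?thesis using False by (simp add: act_blocks_def)
  qed
qed

lemma act_blocks_finite:
  assumes "finite S" "x \<in> X" shows "act_blocks S x \<in> X \<and> \<pi> (act_blocks S x) = \<pi> x"
  using assms(1)
proof (induction S)
  case empty then show ?case using assms(2) by (simp add: act_blocks_empty)
next
  case (insert k S)
  then have S: "act_blocks S x \<in> X" "\<pi> (act_blocks S x) = \<pi> x" by auto
  note D = block_involutionD[OF block_involution_act_block[of k] S(1)]
  show ?case unfolding act_blocks_insert[OF assms(2) S(1) insert(2)] using D(1,3) S(2) by simp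
qed

lemma act_blocks_window:
  assumes "j \<in> {i..<i + K}"
  shows "act_blocks S x j = act_blocks (S \<inter> {i div N..(i + K) div N}) x j"
proof (rule act_blocks_eqI)
  have "i div N \<le> j div N" "j div N \<le> (i + K) div N" using assms N by (auto intro: zdiv_mono1)
  then show "j div N \<in> S \<longleftrightarrow> j div N \<in> S \<inter> {i div N..(i + K) div N}" by auto
qed

text \<open>
  A window of length \<open>K\<close> meets finitely many blocks, so it looks as if finitely many had been changed.
\<close>

lemma act_blocks_in_X:
  assumes "x \<in> X" shows "act_blocks S x \<in> X"
proof (rule glue)
  fix i
  show "\<exists>x'\<in>X. \<forall>j\<in>{i..<i + K}. act_blocks S x j = x' j"
    using act_blocks_finite[of "S \<inter> {i div N..(i + K) div N}" x] act_blocks_window[of _ i S x] assms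
    by (intro bexI[of _ "act_blocks (S \<inter> {i div N..(i + K) div N}) x"]) auto
qed

lemma code_act_blocks:
  assumes x: "x \<in> X" shows "\<pi> (act_blocks S x) = \<pi> x"
proof
  fix i
  let ?S = "S \<inter> {(i - r) div N..(i - r + K) div N}"
  have S: "act_blocks ?S x \<in> X" "\<pi> (act_blocks ?S x) = \<pi> x" using act_blocks_finite[of ?S x] x by auto
  have "\<pi> (act_blocks S x) i = \<pi> (act_blocks ?S x) i"
    by (rule code_eqI[OF act_blocks_in_X[OF x] S(1)]) (rule act_blocks_window)
  then show "\<pi> (act_blocks S x) i = \<pi> x i" using S(2) by simp
qed

lemma translate_act_blocks:
  "translate N (act_blocks S x) = act_blocks {j. j + 1 \<in> S} (translate N x)"
proof
  fix i
  have d: "(i + N) div N = i div N + 1" using N by simp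
  have "act_block (i div N + 1) x (i + N) = act_block (i div N) (translate N x) i"
    by (simp add: act_block_def translate_def algebra_simps)
  then show "translate N (act_blocks S x) i = act_blocks {j. j + 1 \<in> S} (translate N x) i"
    by (simp add: act_blocks_def d)
qed

end

section \<open>Random application of a block involution\<close>

definition coins :: "(int \<Rightarrow> bool) measure" where
  "coins = PiM UNIV (\<lambda>_. measure_pmf (bernoulli_pmf (1 / 2)))"

lemma prob_space_coins: "prob_space coins"
  unfolding coins_def by (intro prob_space_PiM measure_pmf.prob_space_axioms)

lemma space_coins [simp]: "space coins = UNIV"
  by (simp add: coins_def space_PiM)

lemma sets_coin: "{c. c j} \<in> sets coins"
proof -
  have "(\<lambda>c. c j) \<in> coins \<rightarrow>\<^sub>M measure_pmf (bernoulli_pmf (1 / 2))"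
    unfolding coins_def by (rule measurable_component_singleton) simp
  from measurable_sets[OF this, of "{True}"] show ?thesis by (simp add: vimage_def)
qed

lemma measurable_into_coins:
  assumes "\<And>j. {w \<in> space M. f w j} \<in> sets M" shows "f \<in> M \<rightarrow>\<^sub>M coins"
  unfolding coins_def
proof (rule measurable_PiM_single')
  fix j
  have "(\<lambda>w. f w j) -` {b} \<inter> space M \<in> sets M" for b
  proof -
    have "(\<lambda>w. f w j) -` {True} \<inter> space M = {w \<in> space M. f w j}"
      "(\<lambda>w. f w j) -` {False} \<inter> space M = space M - {w \<in> space M. f w j}" by auto
    then show ?thesis using assms[of j] by (cases b) auto
  qed
  then have "(\<lambda>w. f w j) \<in> M \<rightarrow>\<^sub>M count_space UNIV"
    by (subst measurable_count_space_eq2_countable) auto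
  then show "(\<lambda>w. f w j) \<in> M \<rightarrow>\<^sub>M measure_pmf (bernoulli_pmf (1 / 2))"
    by (simp cong: measurable_cong_sets)
qed auto

lemma distr_coins_shift: "distr coins coins (\<lambda>c j. c (j + 1)) = coins"
proof -
  have "distr (Pi\<^sub>M UNIV (\<lambda>_. measure_pmf (bernoulli_pmf (1 / 2)))) (\<Pi>\<^sub>M i\<in>UNIV. measure_pmf (bernoulli_pmf (1 / 2)))
     (\<lambda>\<omega>. \<lambda>n\<in>UNIV. \<omega> (n + 1)) = (\<Pi>\<^sub>M i\<in>(UNIV :: int set). measure_pmf (bernoulli_pmf (1 / 2)))"
    by (rule distr_PiM_reindex) (auto intro: measure_pmf.prob_space_axioms)
  moreover have "(\<lambda>\<omega>. \<lambda>n\<in>UNIV. \<omega> (n + 1)) = (\<lambda>(c :: int \<Rightarrow> bool) j. c (j + 1))" by (simp add: restrict_def)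
  ultimately show ?thesis unfolding coins_def by metis
qed

lemma measurable_coin_flip: "(\<lambda>c. c(k := \<not> c k)) \<in> coins \<rightarrow>\<^sub>M coins"
proof (rule measurable_into_coins)
  fix j
  show "{c \<in> space coins. (c(k := \<not> c k)) j} \<in> sets coins"
  proof (cases "j = k")
    case True
    then have "{c \<in> space coins. (c(k := \<not> c k)) j} = space coins - {c. c k}" by auto
    also have "\<dots> \<in> sets coins" using sets_coin by blast
    finally show ?thesis .
  next
    case False
    then have "{c \<in> space coins. (c(k := \<not> c k)) j} = {c. c j}" by auto
    also have "\<dots> \<in> sets coins" by (rule sets_coin)
    finally show ?thesis .
  qed
qed

lemma bernoulli_half_flip: 
  "emeasure (measure_pmf (bernoulli_pmf (1 / 2))) {b. (\<not> b) \<in> B} = emeasure (measure_pmf (bernoulli_pmf (1 / 2))) B"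
proof -
  have "map_pmf Not (bernoulli_pmf (1 / 2)) = bernoulli_pmf (1 / 2)"
  proof (rule pmf_eqI)
    fix b
    have "inj Not" by (auto simp: inj_on_def)
    from pmf_map_inj'[OF this, of "bernoulli_pmf (1 / 2)" "\<not> b"]
    show "pmf (map_pmf Not (bernoulli_pmf (1 / 2))) b = pmf (bernoulli_pmf (1 / 2)) b"
      by (cases b) simp_all
  qed
  then have "emeasure (measure_pmf (bernoulli_pmf (1 / 2))) B = emeasure (measure_pmf (map_pmf Not (bernoulli_pmf (1 / 2)))) B" by simp
  then show ?thesis by (simp add: emeasure_map_pmf vimage_def)
qed

lemma distr_coins_flip: "distr coins coins (\<lambda>c. c(k := \<not> c k)) = coins"
proof (rule measure_eqI_PiM_infinite[symmetric, of coins UNIV "\<lambda>_. measure_pmf (bernoulli_pmf (1 / 2))"])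
  show "finite_measure coins" using prob_space_coins by (rule prob_space.finite_measure)
  fix B :: "int \<Rightarrow> bool set" and J :: "int set" assume J: "finite J"
  let ?b = "measure_pmf (bernoulli_pmf (1 / 2))"
  let ?emb = "\<lambda>B. prod_emb UNIV (\<lambda>_. ?b) J (Pi\<^sub>E J B)"
  let ?B = "B(k := {b. (\<not> b) \<in> B k})"
  have emb: "emeasure coins (?emb B) = (\<Prod>i\<in>J. emeasure ?b (B i))" for B
    unfolding coins_def using J by (intro emeasure_PiM_emb) (auto intro: measure_pmf.prob_space_axioms)
  have "emeasure (distr coins coins (\<lambda>c. c(k := \<not> c k))) (?emb B) = emeasure coins ((\<lambda>c. c(k := \<not> c k)) -` ?emb B \<inter> space coins)"
    using J by (intro emeasure_distr measurable_coin_flip) (auto simp: coins_def intro!: sets_PiM_I)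
  also have "(\<lambda>c. c(k := \<not> c k)) -` ?emb B \<inter> space coins = ?emb ?B"
    by (auto simp: prod_emb_def PiE_iff space_PiM extensional_def restrict_def split: if_splits)
  also have "emeasure coins (?emb ?B) = (\<Prod>i\<in>J. emeasure ?b (B i))"
    unfolding emb using bernoulli_half_flip[of "B k"] by (intro prod.cong) auto
  finally show "emeasure coins (?emb B) = emeasure (distr coins coins (\<lambda>c. c(k := \<not> c k))) (?emb B)"
    unfolding emb by (rule sym)
qed (auto simp: coins_def)

locale coin_action = block_action X Y \<pi> A K r N T
  for X :: "(int \<Rightarrow> 'a::discrete_topology) set" and Y :: "(int \<Rightarrow> 'b::discrete_topology) set"
    and \<pi> :: "(int \<Rightarrow> 'a) \<Rightarrow> (int \<Rightarrow> 'b)" and A :: "'a set" and K r N :: int 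
    and T :: "(int \<Rightarrow> 'a) \<Rightarrow> (int \<Rightarrow> 'a)" +
  fixes \<mu> :: "(int \<Rightarrow> 'a) measure"
  assumes inv: "invariant_measure X \<mu>"
begin

lemmas space_\<mu> = space_invariant[OF inv] and sets_\<mu> = sets_invariant[OF inv]

sublocale \<mu>: prob_space \<mu> by (rule invariant_measureD(1)[OF inv])

abbreviation joint :: "((int \<Rightarrow> 'a) \<times> (int \<Rightarrow> bool)) measure" where
  "joint \<equiv> \<mu> \<Otimes>\<^sub>M coins"

sublocale coins: prob_space coins by (rule prob_space_coins)

sublocale joint: pair_prob_space \<mu> coins ..

sublocale joint: prob_space joint by (rule joint.prob_space_axioms)

lemma space_joint: "space joint = X \<times> UNIV"
  by (simp add: space_pair_measure space_\<mu>)

lemma sets_joint_fst: "B \<in> sets (borel_on X) \<Longrightarrow> {w \<in> space joint. fst w \<in> B} \<in> sets joint"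
  using measurable_sets[OF measurable_fst[of \<mu> coins], of B] sets_\<mu> by (simp add: vimage_def Int_def conj_commute)

lemma sets_joint_snd: "B \<in> sets coins \<Longrightarrow> {w \<in> space joint. snd w \<in> B} \<in> sets joint"
  using measurable_sets[OF measurable_snd[of \<mu> coins], of B] by (simp add: vimage_def Int_def conj_commute)

lemma measurable_act_block: "act_block k \<in> borel_on X \<rightarrow>\<^sub>M borel_on X"
  by (rule measurable_block_involution[OF block_involution_act_block]) simp

lemma sets_act_block_coordinate: "{x \<in> X. act_block k x i = a} \<in> sets (borel_on X)"
proof -
  have "{x \<in> X. act_block k x i = a} = act_block k -` {x \<in> X. x i = a} \<inter> space (borel_on X)"
    using block_involutionD(1)[OF block_involution_act_block] by auto
  also have "\<dots> \<in> sets (borel_on X)" by (rule measurable_sets[OF measurable_act_block coordinate_sets])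
  finally show ?thesis .
qed

lemma measurable_act_blocks:
  assumes S: "\<And>j. {c. j \<in> S c} \<in> sets coins"
  shows "(\<lambda>w. act_blocks (S (snd w)) (fst w)) \<in> joint \<rightarrow>\<^sub>M borel_on X"
proof (rule measurable_borel_on_coordinatewise[OF finite_A])
  show "x i \<in> A" if "x \<in> X" for x i using that by (rule alphabet)
  show "(\<lambda>w. act_blocks (S (snd w)) (fst w)) \<in> space joint \<rightarrow> X"
    using act_blocks_in_X by (auto simp: space_joint)
  fix i a
  have "{w \<in> space joint. act_blocks (S (snd w)) (fst w) i = a} =
     ({w \<in> space joint. snd w \<in> {c. i div N \<in> S c}} \<inter> {w \<in> space joint. fst w \<in> {x \<in> X. act_block (i div N) x i = a}})
     \<union> ((space joint - {w \<in> space joint. snd w \<in> {c. i div N \<in> S c}}) \<inter> {w \<in> space joint. fst w \<in> {x \<in> X. x i = a}})"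
    by (auto simp: space_joint act_blocks_def)
  also have "\<dots> \<in> sets joint"
    by (intro sets.Un sets.Int sets.Diff sets.top sets_joint_fst sets_joint_snd S sets_act_block_coordinate coordinate_sets)
  finally show "{w \<in> space joint. act_blocks (S (snd w)) (fst w) i = a} \<in> sets joint" .
qed

text \<open>
  Flipping the \<open>k\<close>-th coin preserves the joint law and interchanges the two events.
\<close>

lemma half_of_flip_invariant:
  assumes E: "E \<in> sets joint" and flip: "\<And>x c. (x, c(k := \<not> c k)) \<in> E \<longleftrightarrow> (x, c) \<in> E"
  shows "measure joint {w \<in> E. snd w k} = measure joint E / 2" "measure joint {w \<in> E. \<not> snd w k} = measure joint E / 2"
proof -
  let ?f = "\<lambda>(x, c). (x, c(k := \<not> c k))"
  have "distr \<mu> \<mu> (\<lambda>x. x) \<Otimes>\<^sub>M distr coins coins (\<lambda>c. c(k := \<not> c k)) = distr joint joint ?f"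
    by (rule pair_measure_distr) (auto simp: distr_coins_flip measurable_coin_flip coins.sigma_finite_measure_axioms)
  then have d: "distr joint joint ?f = joint" by (simp add: distr_coins_flip)
  have m: "?f \<in> joint \<rightarrow>\<^sub>M joint" 
    using measurable_coin_flip[of k] by measurable
  have E1: "{w \<in> E. snd w k} \<in> sets joint" and E2: "{w \<in> E. \<not> snd w k} \<in> sets joint"
  proof -
    have ES: "E \<subseteq> space joint" using E by (rule sets.sets_into_space)
    have "{w \<in> E. snd w k} = E \<inter> {w \<in> space joint. snd w \<in> {c. c k}}" using ES by auto
    then show "{w \<in> E. snd w k} \<in> sets joint" using E sets_joint_snd[OF sets_coin] by simp
    moreover have "{w \<in> E. \<not> snd w k} = E - {w \<in> E. snd w k}" by auto
    ultimately show "{w \<in> E. \<not> snd w k} \<in> sets joint" using E by simp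
  qed
  have "measure joint {w \<in> E. snd w k} = measure (distr joint joint ?f) {w \<in> E. snd w k}" by (simp only: d)
  also have "\<dots> = measure joint (?f -` {w \<in> E. snd w k} \<inter> space joint)" by (rule measure_distr[OF m E1])
  also have "?f -` {w \<in> E. snd w k} \<inter> space joint = {w \<in> E. \<not> snd w k}"
    using flip sets.sets_into_space[OF E] by auto
  finally have eq: "measure joint {w \<in> E. snd w k} = measure joint {w \<in> E. \<not> snd w k}" .
  have "E = {w \<in> E. snd w k} \<union> {w \<in> E. \<not> snd w k}" by auto
  then have "measure joint E = measure joint {w \<in> E. snd w k} + measure joint {w \<in> E. \<not> snd w k}"
    using joint.finite_measure_Union[OF E1 E2] by auto
  then show "measure joint {w \<in> E. snd w k} = measure joint E / 2" "measure joint {w \<in> E. \<not> snd w k} = measure joint E / 2"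
    using eq by auto
qed

definition randomized :: "(int \<Rightarrow> 'a) measure" where
  "randomized = distr joint (borel_on X) (\<lambda>w. act_blocks {j. snd w j} (fst w))"

lemma measurable_randomize: "(\<lambda>w. act_blocks {j. snd w j} (fst w)) \<in> joint \<rightarrow>\<^sub>M borel_on X"
  using measurable_act_blocks[of "\<lambda>c. {j. c j}"] sets_coin by simp

lemma sets_randomized: "sets randomized = sets (borel_on X)" by (simp add: randomized_def)

lemma space_randomized: "space randomized = X" by (simp add: randomized_def)

lemma prob_space_randomized: "prob_space randomized"
  unfolding randomized_def by (rule joint.prob_space_distr[OF measurable_randomize])

text \<open>
  Translation by \<open>N\<close> carries blocks to blocks, and the coins can be moved along with them.
\<close>

lemma distr_randomized_translate: "distr randomized (borel_on X) (translate N) = randomized"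
proof -
  let ?f = "\<lambda>(x, c). (translate N x, \<lambda>j. c (j + 1))"
  have mc: "(\<lambda>c j. c (j + 1)) \<in> coins \<rightarrow>\<^sub>M coins"
    by (rule measurable_into_coins) (simp add: sets_coin)
  have mt: "translate N \<in> \<mu> \<rightarrow>\<^sub>M \<mu>" by (rule measurable_translate_invariant[OF inv])
  have "distr \<mu> \<mu> (translate N) \<Otimes>\<^sub>M distr coins coins (\<lambda>c j. c (j + 1)) = distr joint joint ?f"
    by (rule pair_measure_distr) (auto simp: distr_coins_shift mc mt coins.sigma_finite_measure_axioms)
  then have d: "distr joint joint ?f = joint" by (simp add: distr_coins_shift distr_translate[OF inv])
  have m: "?f \<in> joint \<rightarrow>\<^sub>M joint" using mc mt by measurable
  have "distr randomized (borel_on X) (translate N) = distr joint (borel_on X) (translate N \<circ> (\<lambda>w. act_blocks {j. snd w j} (fst w)))"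
    unfolding randomized_def by (rule distr_distr[OF measurable_translate measurable_randomize])
  also have "translate N \<circ> (\<lambda>w. act_blocks {j. snd w j} (fst w)) = (\<lambda>w. act_blocks {j. snd w j} (fst w)) \<circ> ?f"
    by (auto simp: translate_act_blocks)
  also have "distr joint (borel_on X) \<dots> = distr (distr joint joint ?f) (borel_on X) (\<lambda>w. act_blocks {j. snd w j} (fst w))"
    by (rule distr_distr[OF measurable_randomize m, symmetric])
  finally show ?thesis unfolding d randomized_def .
qed

lemma distr_randomized_code: "distr randomized (borel_on Y) \<pi> = distr \<mu> (borel_on Y) \<pi>"
proof -
  have "distr randomized (borel_on Y) \<pi> = distr joint (borel_on Y) (\<pi> \<circ> (\<lambda>w. act_blocks {j. snd w j} (fst w)))"
    unfolding randomized_def by (rule distr_distr[OF measurable_code measurable_randomize])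
  also have "\<dots> = distr joint (borel_on Y) (\<pi> \<circ> fst)"
    by (rule distr_cong) (auto simp: space_joint code_act_blocks)
  also have "\<dots> = distr (distr joint \<mu> fst) (borel_on Y) \<pi>"
  proof (rule distr_distr[symmetric])
    show "\<pi> \<in> \<mu> \<rightarrow>\<^sub>M borel_on Y" using measurable_code sets_\<mu> by (simp cong: measurable_cong_sets)
  qed simp
  also have "distr joint \<mu> fst = \<mu>"
    by (rule coins.distr_pair_fst)
  finally show ?thesis .
qed

end

section \<open>Entropy gained by randomizing\<close>

context coin_action
begin

text \<open>
  Blocks are randomized one at a time: after \<open>k\<close> steps only the coins \<open>0\<close>, ..., \<open>k - 1\<close> have been used.
\<close>

definition partial_act :: "nat \<Rightarrow> (int \<Rightarrow> 'a) \<times> (int \<Rightarrow> bool) \<Rightarrow> (int \<Rightarrow> 'a)" where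
  "partial_act k w = act_blocks ({j. snd w j} \<inter> {0..<int k}) (fst w)"

lemma measurable_partial_act: "partial_act k \<in> joint \<rightarrow>\<^sub>M borel_on X"
proof -
  have "{c. j \<in> {j. c j} \<inter> {0..<int k}} \<in> sets coins" for j
  proof (cases "j \<in> {0..<int k}")
    case True
    then have "{c. j \<in> {j. c j} \<inter> {0..<int k}} = {c. c j}" by auto
    then show ?thesis using sets_coin by simp
  next
    case False
    then have "{c. j \<in> {j. c j} \<inter> {0..<int k}} = {}" by auto
    then show ?thesis by (simp only: sets.empty_sets)
  qed
  from measurable_act_blocks[OF this] show ?thesis unfolding partial_act_def .
qed

lemma partial_act_in_X: "w \<in> space joint \<Longrightarrow> partial_act k w \<in> X"
  using act_blocks_in_X by (auto simp: space_joint partial_act_def)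

lemma partial_act_0: "partial_act 0 w = fst w"
  by (simp add: partial_act_def act_blocks_empty)

lemma partial_act_Suc:
  assumes w: "w \<in> space joint"
  shows "partial_act (Suc k) w = (if snd w (int k) then act_block (int k) (partial_act k w) else partial_act k w)"
proof (cases "snd w (int k)")
  case True
  then have "{j. snd w j} \<inter> {0..<int (Suc k)} = insert (int k) ({j. snd w j} \<inter> {0..<int k})"
    by (auto simp: order_less_le)
  moreover have "fst w \<in> X" using w by (auto simp: space_joint)
  ultimately show ?thesis
    using act_blocks_insert[of "fst w" "{j. snd w j} \<inter> {0..<int k}" "int k"] act_blocks_in_X True
    by (simp add: partial_act_def)
next
  case False
  then have "{j. snd w j} \<inter> {0..<int (Suc k)} = {j. snd w j} \<inter> {0..<int k}"
    by (auto simp: order_less_le)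
  then show ?thesis using False by (simp add: partial_act_def)
qed

lemma partial_act_flip: "partial_act k (x, c(int k := \<not> c (int k))) = partial_act k (x, c)"
proof -
  have "{j. (c(int k := \<not> c (int k))) j} \<inter> {0..<int k} = {j. c j} \<inter> {0..<int k}" by auto
  then show ?thesis by (simp add: partial_act_def)
qed

lemma partial_act_later_block:
  assumes "i div N \<ge> int k" shows "partial_act k w i = fst w i"
  using assms by (simp add: partial_act_def act_blocks_def)

lemma partial_act_event: "C \<in> sets (borel_on X) \<Longrightarrow> {w \<in> space joint. partial_act k w \<in> C} \<in> sets joint"
  using measurable_sets[OF measurable_partial_act, of C k] by (simp add: vimage_def Int_def conj_commute)

lemma measure_fst_event:
  assumes "C \<in> sets (borel_on X)" shows "measure joint {w \<in> space joint. fst w \<in> C} = measure \<mu> C"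
proof -
  have "measure \<mu> C = measure (distr joint \<mu> fst) C" by (simp only: coins.distr_pair_fst)
  also have "\<dots> = measure joint (fst -` C \<inter> space joint)"
    using assms sets_\<mu> by (intro measure_distr) auto
  also have "fst -` C \<inter> space joint = {w \<in> space joint. fst w \<in> C}" by auto
  finally show ?thesis ..
qed

subsection \<open>Words over several blocks\<close>

definition word :: "int set \<Rightarrow> (int \<Rightarrow> 'a) \<Rightarrow> (int \<Rightarrow> 'a)" where
  "word J x = restrict x J"

lemma word_eq_iff: "word J x = word J y \<longleftrightarrow> (\<forall>i\<in>J. x i = y i)"
  by (simp add: word_def restrict_eq_iff)

lemma finite_words: "finite J \<Longrightarrow> finite (word J ` X)"
proof (rule finite_subset)
  show "word J ` X \<subseteq> PiE J (\<lambda>_. A)" using alphabet by (auto simp: word_def)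
qed (simp add: finite_PiE finite_A)

lemma word_event: "finite J \<Longrightarrow> {x \<in> X. word J x = v} \<in> cylinders X"
  by (rule cylindersI) (auto simp: determined_on_def word_def fun_eq_iff restrict_def)

lemmas word_event_sets = cylinder_sets[OF word_event]

lemma fun_entropy_word:
  assumes "space M = X"
  shows "fun_entropy M (word J) = - (\<Sum>v\<in>word J ` X. measure M {x \<in> X. word J x = v} * ln (measure M {x \<in> X. word J x = v}))"
proof -
  have "word J -` {v} \<inter> X = {x \<in> X. word J x = v}" for v by auto
  then show ?thesis by (simp add: fun_entropy_def assms)
qed

definition block_word_prob :: "(int \<Rightarrow> 'a) \<Rightarrow> real" where
  "block_word_prob b = measure \<mu> {x \<in> X. word {0..<N} x = b}"

definition block_word_swap :: "(int \<Rightarrow> 'a) \<Rightarrow> (int \<Rightarrow> 'a)" where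
  "block_word_swap b = word {0..<N} (T (inv_into X (word {0..<N}) b))"

text \<open>
  Twice the entropy that a fair choice between \<open>x\<close> and \<open>T x\<close> adds to the law of a single block.
\<close>

definition block_gain :: real where
  "block_gain = (\<Sum>b\<in>word {0..<N} ` X. divergence_to_mean (block_word_prob b) (block_word_prob (block_word_swap b)))"

lemma block_word_swap:
  assumes x: "x \<in> X" shows "block_word_swap (word {0..<N} x) = word {0..<N} (T x)"
proof -
  let ?y = "inv_into X (word {0..<N}) (word {0..<N} x)"
  have y: "?y \<in> X" "word {0..<N} ?y = word {0..<N} x" using inv_into_into[OF imageI[OF x]] f_inv_into_f[OF imageI[OF x]] by blast+
  then have "T ?y i = T x i" if "i \<in> {0..<N}" for i
    using that by (intro block_involution_local[OF T]) (auto simp: word_eq_iff x)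
  then show ?thesis unfolding block_word_swap_def word_eq_iff by blast
qed

context
  fixes m :: nat
begin

abbreviation W where "W \<equiv> word {0..<int m * N}"

definition word_swap :: "nat \<Rightarrow> (int \<Rightarrow> 'a) \<Rightarrow> (int \<Rightarrow> 'a)" where
  "word_swap k v = W (act_block (int k) (inv_into X W v))"

definition block_of_word :: "nat \<Rightarrow> (int \<Rightarrow> 'a) \<Rightarrow> (int \<Rightarrow> 'a)" where
  "block_of_word k v = word {0..<N} (translate (int k * N) v)"

definition word_prob :: "nat \<Rightarrow> (int \<Rightarrow> 'a) \<Rightarrow> real" where
  "word_prob k v = measure joint {w \<in> space joint. partial_act k w \<in> {x \<in> X. W x = v}}"

lemma block_in_word:
  assumes "k < m" shows "{int k * N..<int k * N + N} \<subseteq> {0..<int m * N}"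
proof -
  have "int k + 1 \<le> int m" using assms by simp
  then have "(int k + 1) * N \<le> int m * N" using N by (intro mult_right_mono) auto
  moreover have "0 \<le> int k * N" using N by simp
  ultimately show ?thesis by (auto simp: algebra_simps)
qed

lemma word_swap:
  assumes x: "x \<in> X" and k: "k < m" shows "word_swap k (W x) = W (act_block (int k) x)"
proof -
  let ?y = "inv_into X W (W x)"
  have y: "?y \<in> X" "W ?y = W x" using inv_into_into[OF imageI[OF x]] f_inv_into_f[OF imageI[OF x]] by blast+
  have eq: "?y i = x i" if "i \<in> {0..<int m * N}" for i using y(2) that unfolding word_eq_iff by blast
  have "act_block (int k) ?y i = act_block (int k) x i" if "i \<in> {0..<int m * N}" for i
    by (rule block_involution_local_or[OF block_involution_act_block y(1) x]) (use eq that block_in_word[OF k] in blast)+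
  then show ?thesis unfolding word_swap_def word_eq_iff by blast
qed

lemma block_of_word:
  assumes k: "k < m" shows "block_of_word k (W x) = word {0..<N} (translate (int k * N) x)"
proof -
  have "W x (i + int k * N) = x (i + int k * N)" if "i \<in> {0..<N}" for i
  proof -
    have "i + int k * N \<in> {int k * N..<int k * N + N}" using that by auto
    then have "i + int k * N \<in> {0..<int m * N}" using block_in_word[OF k] by blast
    then show ?thesis by (simp add: word_def)
  qed
  then show ?thesis unfolding block_of_word_def word_eq_iff by simp
qed

lemma word_swap_involution:
  assumes v: "v \<in> W ` X" and k: "k < m"
  shows "word_swap k v \<in> W ` X" "word_swap k (word_swap k v) = v"
    "block_of_word k (word_swap k v) = block_word_swap (block_of_word k v)"
proof -
  obtain x where x: "x \<in> X" "v = W x" using v by blast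
  note D = block_involutionD[OF block_involution_act_block[of "int k"] x(1)]
  show "word_swap k v \<in> W ` X" unfolding x(2) word_swap[OF x(1) k] using D(1) by blast
  show "word_swap k (word_swap k v) = v"
    unfolding x(2) word_swap[OF x(1) k] word_swap[OF D(1) k] D(2) ..
  have "translate (int k * N) (act_block (int k) x) = T (translate (int k * N) x)"
    by (simp add: act_block_def)
  then show "block_of_word k (word_swap k v) = block_word_swap (block_of_word k v)"
    unfolding x(2) word_swap[OF x(1) k] block_of_word[OF k] block_word_swap[OF translate_X[OF x(1)]] by simp
qed

lemma block_word_swap_involution:
  assumes b: "b \<in> word {0..<N} ` X"
  shows "block_word_swap b \<in> word {0..<N} ` X" "block_word_swap (block_word_swap b) = b"
proof -
  obtain x where x: "x \<in> X" "b = word {0..<N} x" using b by blast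
  note D = block_involutionD[OF T x(1)]
  show "block_word_swap b \<in> word {0..<N} ` X" unfolding x(2) block_word_swap[OF x(1)] using D(1) by blast
  show "block_word_swap (block_word_swap b) = b"
    unfolding x(2) block_word_swap[OF x(1)] block_word_swap[OF D(1)] D(2) ..
qed

text \<open>
  The next coin is independent of everything used so far.
\<close>

lemma word_prob_Suc:
  assumes k: "k < m" and v: "v \<in> W ` X"
  shows "word_prob (Suc k) v = (word_prob k v + word_prob k (word_swap k v)) / 2"
proof -
  define E where "E v = {w \<in> space joint. partial_act k w \<in> {x \<in> X. W x = v}}" for v
  have E: "E v \<in> sets joint" for v
    unfolding E_def by (intro partial_act_event word_event_sets) simp
  have flip: "(x, c(int k := \<not> c (int k))) \<in> E v \<longleftrightarrow> (x, c) \<in> E v" for x c v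
    unfolding E_def by (simp add: partial_act_flip space_joint)
  note half = half_of_flip_invariant[OF E flip]
  have sw: "W (act_block (int k) x) = v \<longleftrightarrow> W x = word_swap k v" if x: "x \<in> X" for x
    using word_swap[OF x k] word_swap_involution[OF _ k] v x by (metis image_eqI)
  have "{w \<in> space joint. partial_act (Suc k) w \<in> {x \<in> X. W x = v}}
     = {w \<in> E v. \<not> snd w (int k)} \<union> {w \<in> E (word_swap k v). snd w (int k)}"
  proof (intro equalityI subsetI)
    fix w assume "w \<in> {w \<in> space joint. partial_act (Suc k) w \<in> {x \<in> X. W x = v}}"
    then have w: "w \<in> space joint" "W (partial_act (Suc k) w) = v" by auto
    note pX = partial_act_in_X[OF w(1), of k]
    show "w \<in> {w \<in> E v. \<not> snd w (int k)} \<union> {w \<in> E (word_swap k v). snd w (int k)}"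
      using w pX sw[OF pX] unfolding partial_act_Suc[OF w(1)] E_def by (cases "snd w (int k)") simp_all
  next
    fix w assume w: "w \<in> {w \<in> E v. \<not> snd w (int k)} \<union> {w \<in> E (word_swap k v). snd w (int k)}"
    then have ws: "w \<in> space joint" unfolding E_def by blast
    note pX = partial_act_in_X[OF ws, of k]
    have "act_block (int k) (partial_act k w) \<in> X"
      by (rule block_involutionD(1)[OF block_involution_act_block pX])
    then show "w \<in> {w \<in> space joint. partial_act (Suc k) w \<in> {x \<in> X. W x = v}}"
      using w ws pX sw[OF pX] unfolding mem_Collect_eq partial_act_Suc[OF ws] E_def by (cases "snd w (int k)") simp_all
  qed
  moreover have "measure joint ({w \<in> E v. \<not> snd w (int k)} \<union> {w \<in> E (word_swap k v). snd w (int k)})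
    = measure joint {w \<in> E v. \<not> snd w (int k)} + measure joint {w \<in> E (word_swap k v). snd w (int k)}"
  proof (rule joint.finite_measure_Union)
    have c: "{w \<in> space joint. snd w \<in> {c. c (int k)}} \<in> sets joint" by (rule sets_joint_snd[OF sets_coin])
    have "{w \<in> E u. snd w (int k)} = E u \<inter> {w \<in> space joint. snd w \<in> {c. c (int k)}}" for u unfolding E_def by blast
    moreover have "E (word_swap k v) \<inter> {w \<in> space joint. snd w \<in> {c. c (int k)}} \<in> sets joint" by (rule sets.Int[OF E c])
    ultimately show "{w \<in> E (word_swap k v). snd w (int k)} \<in> sets joint" by (simp only:)
    have "{w \<in> E u. \<not> snd w (int k)} = E u - {w \<in> space joint. snd w \<in> {c. c (int k)}}" for u unfolding E_def by blast
    moreover have "E v - {w \<in> space joint. snd w \<in> {c. c (int k)}} \<in> sets joint" by (rule sets.Diff[OF E c])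
    ultimately show "{w \<in> E v. \<not> snd w (int k)} \<in> sets joint" by (simp only:)
  qed auto
  ultimately show ?thesis unfolding word_prob_def half using half E_def by (simp add: add_divide_distrib)
qed

text \<open>
  Block \<open>k\<close> is untouched during the first \<open>k\<close> steps and, by invariance of \<open>\<mu>\<close>, distributed like
  block \<open>0\<close>.
\<close>

lemma block_prob_eq_sum:
  assumes k: "k < m"
  shows "block_word_prob b = (\<Sum>v\<in>{v \<in> W ` X. block_of_word k v = b}. word_prob k v)"
proof -
  have fin: "finite {v \<in> W ` X. block_of_word k v = b}" using finite_words by simp
  have "(\<Sum>v\<in>{v \<in> W ` X. block_of_word k v = b}. word_prob k v)
     = measure joint (\<Union>v\<in>{v \<in> W ` X. block_of_word k v = b}. {w \<in> space joint. partial_act k w \<in> {x \<in> X. W x = v}})"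
    unfolding word_prob_def
  proof (rule joint.finite_measure_finite_Union[symmetric, OF fin])
    have "{w \<in> space joint. partial_act k w \<in> {x \<in> X. W x = v}} \<in> sets joint" for v
      by (intro partial_act_event word_event_sets) simp
    then show "(\<lambda>v. {w \<in> space joint. partial_act k w \<in> {x \<in> X. W x = v}}) ` {v \<in> W ` X. block_of_word k v = b} \<subseteq> sets joint"
      by blast
  qed (auto simp: disjoint_family_on_def)
  also have "(\<Union>v\<in>{v \<in> W ` X. block_of_word k v = b}. {w \<in> space joint. partial_act k w \<in> {x \<in> X. W x = v}})
     = {w \<in> space joint. fst w \<in> translate (int k * N) -` {x \<in> X. word {0..<N} x = b} \<inter> X}"
  proof -
    have "block_of_word k (W (partial_act k w)) = b \<longleftrightarrow> word {0..<N} (translate (int k * N) (fst w)) = b"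
      if w: "w \<in> space joint" for w
    proof -
      have "partial_act k w (i + int k * N) = fst w (i + int k * N)" if "i \<in> {0..<N}" for i
      proof (rule partial_act_later_block)
        have "(i + int k * N) div N = int k" using that by (simp flip: block_iff)
        then show "int k \<le> (i + int k * N) div N" by simp
      qed
      then have "word {0..<N} (translate (int k * N) (partial_act k w)) = word {0..<N} (translate (int k * N) (fst w))"
        unfolding word_eq_iff by simp
      then show ?thesis unfolding block_of_word[OF k] by simp
    qed
    note block = this
    have mem: "partial_act k w \<in> X" "fst w \<in> X" "translate (int k * N) (fst w) \<in> X" if "w \<in> space joint" for w
      using that partial_act_in_X translate_X by (auto simp: space_joint)
    show ?thesis
    proof (intro equalityI subsetI)
      fix w assume "w \<in> (\<Union>v\<in>{v \<in> W ` X. block_of_word k v = b}. {w \<in> space joint. partial_act k w \<in> {x \<in> X. W x = v}})"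
      then obtain v where "block_of_word k v = b" "w \<in> space joint" "W (partial_act k w) = v" by blast
      then have w: "w \<in> space joint" "block_of_word k (W (partial_act k w)) = b" by (simp_all only:)
      show "w \<in> {w \<in> space joint. fst w \<in> translate (int k * N) -` {x \<in> X. word {0..<N} x = b} \<inter> X}"
        using w(1) block[OF w(1)] w(2) mem[OF w(1)] by simp
    next
      fix w assume "w \<in> {w \<in> space joint. fst w \<in> translate (int k * N) -` {x \<in> X. word {0..<N} x = b} \<inter> X}"
      then have w: "w \<in> space joint" "word {0..<N} (translate (int k * N) (fst w)) = b" by simp_all
      have "block_of_word k (W (partial_act k w)) = b" unfolding block[OF w(1)] by (rule w(2))
      then show "w \<in> (\<Union>v\<in>{v \<in> W ` X. block_of_word k v = b}. {w \<in> space joint. partial_act k w \<in> {x \<in> X. W x = v}})"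
        using w(1) mem(1)[OF w(1)] by blast
    qed
  qed
  also have "measure joint \<dots> = measure \<mu> (translate (int k * N) -` {x \<in> X. word {0..<N} x = b} \<inter> X)"
    by (intro measure_fst_event cylinder_sets translate_vimage_cylinder word_event) simp
  also have "\<dots> = measure (distr \<mu> \<mu> (translate (int k * N))) {x \<in> X. word {0..<N} x = b}"
    using measure_distr[OF measurable_translate_invariant[OF inv], of "{x \<in> X. word {0..<N} x = b}" "int k * N"]
      word_event_sets[of "{0..<N}" b] sets_\<mu> by (simp add: space_\<mu>)
  also have "\<dots> = block_word_prob b" unfolding distr_translate[OF inv] block_word_prob_def ..
  finally show ?thesis ..
qed

text \<open>
  The coin symmetrizes the law of the words; the gain is at least the part of it visible in block \<open>k\<close>.
\<close>

lemma word_prob_entropy_step: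
  assumes k: "k < m"
  shows "- (\<Sum>v\<in>W ` X. word_prob k v * ln (word_prob k v)) + block_gain / 2
     \<le> - (\<Sum>v\<in>W ` X. word_prob (Suc k) v * ln (word_prob (Suc k) v))"
proof -
  have finV: "finite (W ` X)" and finB: "finite (word {0..<N} ` X)" by (simp_all add: finite_words)
  have "block_gain \<le> (\<Sum>v\<in>W ` X. divergence_to_mean (word_prob k v) (word_prob k (word_swap k v)))"
    unfolding block_gain_def
  proof (rule divergence_to_mean_image_le[OF finV])
    show "0 \<le> word_prob k v" for v by (simp add: word_prob_def)
    show "block_of_word k ` W ` X \<subseteq> word {0..<N} ` X"
      using block_of_word[OF k] translate_X by auto
  qed (use finB word_swap_involution[OF _ k] block_word_swap_involution block_prob_eq_sum[OF k] in blast)+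
  moreover have "(\<Sum>v\<in>W ` X. word_prob (Suc k) v * ln (word_prob (Suc k) v))
    = (\<Sum>v\<in>W ` X. (word_prob k v + word_prob k (word_swap k v)) / 2 * ln ((word_prob k v + word_prob k (word_swap k v)) / 2))"
    by (intro sum.cong refl) (simp only: word_prob_Suc[OF k])
  moreover have "(\<Sum>v\<in>W ` X. word_prob k v * ln (word_prob k v))
     - (\<Sum>v\<in>W ` X. (word_prob k v + word_prob k (word_swap k v)) / 2 * ln ((word_prob k v + word_prob k (word_swap k v)) / 2))
     = (\<Sum>v\<in>W ` X. divergence_to_mean (word_prob k v) (word_prob k (word_swap k v))) / 2"
    by (rule symmetrization_entropy_gain[OF finV]) (rule word_swap_involution[OF _ k], assumption)+
  ultimately show ?thesis by linarith
qed

lemma word_prob_entropy: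
  assumes "k \<le> m"
  shows "fun_entropy \<mu> W + real k * block_gain / 2 \<le> - (\<Sum>v\<in>W ` X. word_prob k v * ln (word_prob k v))"
  using assms
proof (induction k)
  case 0
  have "word_prob 0 v = measure \<mu> {x \<in> X. W x = v}" for v
    unfolding word_prob_def partial_act_0 by (intro measure_fst_event word_event_sets) simp
  then show ?case by (simp add: fun_entropy_word[OF space_\<mu>])
next
  case (Suc k)
  then show ?case using word_prob_entropy_step[of k] by (simp add: algebra_simps add_divide_distrib)
qed

theorem randomized_entropy_gain:
  "fun_entropy \<mu> W + real m * block_gain / 2 \<le> fun_entropy randomized W"
proof -
  have "measure randomized {x \<in> X. W x = v} = word_prob m v" for v
  proof -
    have "measure randomized {x \<in> X. W x = v} = measure joint ((\<lambda>w. act_blocks {j. snd w j} (fst w)) -` {x \<in> X. W x = v} \<inter> space joint)"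
      unfolding randomized_def by (intro measure_distr measurable_randomize word_event_sets) simp
    also have "(\<lambda>w. act_blocks {j. snd w j} (fst w)) -` {x \<in> X. W x = v} \<inter> space joint
       = {w \<in> space joint. partial_act m w \<in> {x \<in> X. W x = v}}"
    proof -
      have "W (act_blocks {j. snd w j} (fst w)) = W (partial_act m w)" for w
        unfolding word_eq_iff partial_act_def
      proof (intro ballI act_blocks_eqI)
        fix i assume i: "i \<in> {0..<int m * N}"
        have "0 \<le> i div N" using i N by (simp add: pos_imp_zdiv_nonneg_iff)
        moreover have "i div N < int m"
        proof (rule ccontr)
          assume "\<not> i div N < int m"
          then have "int m * N \<le> i div N * N" using N by (intro mult_right_mono) auto
          also have "\<dots> \<le> i" using N div_mult_mod_eq[of i N] pos_mod_sign[of N i] by linarith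
          finally show False using i by simp
        qed
        ultimately show "i div N \<in> {j. snd w j} \<longleftrightarrow> i div N \<in> {j. snd w j} \<inter> {0..<int m}" by simp
      qed
      moreover have "act_blocks {j. snd w j} (fst w) \<in> X" "partial_act m w \<in> X" if "w \<in> space joint" for w
        using that partial_act_in_X act_blocks_in_X by (auto simp: space_joint)
      ultimately show ?thesis by auto
    qed
    finally show ?thesis unfolding word_prob_def .
  qed
  then show ?thesis using word_prob_entropy[of m] by (simp add: fun_entropy_word[OF space_randomized])
qed

end

end

section \<open>Measures of relative maximal entropy are invariant under block involutions\<close>

context coin_action
begin

definition phases :: "nat" where "phases = nat N"

lemma phases: "0 < phases" "int phases = N"
  using N by (auto simp: phases_def)

text \<open>
  The randomized measure is invariant under translation by \<open>N\<close> only; its mean over one period is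
  invariant under the shift.
\<close>

definition averaged :: "(int \<Rightarrow> 'a) measure" where
  "averaged = measure_pmf (pmf_of_set {..<phases}) \<bind> (\<lambda>p. distr randomized (borel_on X) (translate (int p)))"

sublocale randomized: prob_space randomized by (rule prob_space_randomized)

lemma measurable_translate_randomized: "translate k \<in> randomized \<rightarrow>\<^sub>M borel_on X"
  using measurable_translate sets_randomized by (simp cong: measurable_cong_sets)

lemma kernel_averaged:
  "(\<lambda>p. distr randomized (borel_on X) (translate (int p))) \<in> measure_pmf q \<rightarrow>\<^sub>M subprob_algebra (borel_on X)"
proof -
  have "distr randomized (borel_on X) (translate (int p)) \<in> space (subprob_algebra (borel_on X))" for p
    unfolding space_subprob_algebra
    using prob_space_imp_subprob_space[OF randomized.prob_space_distr[OF measurable_translate_randomized]] by simp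
  then show ?thesis by simp
qed

lemma sets_averaged: "sets averaged = sets (borel_on X)"
  unfolding averaged_def by (rule sets_bind) auto

lemma space_averaged: "space averaged = X"
  using sets_eq_imp_space_eq[OF sets_averaged] by simp

lemma emeasure_averaged:
  assumes B: "B \<in> sets (borel_on X)"
  shows "emeasure averaged B = ennreal ((\<Sum>p<phases. measure randomized (translate (int p) -` B \<inter> X)) / real phases)"
proof -
  have "emeasure averaged B = (\<integral>\<^sup>+p. emeasure (distr randomized (borel_on X) (translate (int p))) B \<partial>measure_pmf (pmf_of_set {..<phases}))"
    unfolding averaged_def by (rule emeasure_bind[OF _ kernel_averaged B]) simp
  also have "\<dots> = (\<Sum>p<phases. emeasure (distr randomized (borel_on X) (translate (int p))) B) / ennreal (real (card {..<phases}))"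
    using phases by (subst nn_integral_pmf_of_set) (auto simp: ennreal_of_nat_eq_real_of_nat)
  also have "(\<Sum>p<phases. emeasure (distr randomized (borel_on X) (translate (int p))) B)
     = ennreal (\<Sum>p<phases. measure randomized (translate (int p) -` B \<inter> X))"
    using emeasure_distr[OF measurable_translate_randomized B]
    by (simp add: randomized.emeasure_eq_measure space_randomized)
  finally show ?thesis using phases by (simp add: divide_ennreal sum_nonneg)
qed

lemma prob_space_averaged: "prob_space averaged"
proof
  have "translate (int p) -` X \<inter> X = X" for p using translate_X by auto
  then have "emeasure averaged X = 1"
    using emeasure_averaged[of X] sets.top[of "borel_on X"] phases randomized.prob_space
    by (simp add: space_randomized)
  then show "emeasure averaged (space averaged) = 1" by (simp add: space_averaged)
qed

sublocale averaged: prob_space averaged by (rule prob_space_averaged)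

lemma measure_averaged:
  assumes B: "B \<in> sets (borel_on X)"
  shows "measure averaged B = (\<Sum>p<phases. measure randomized (translate (int p) -` B \<inter> X)) / real phases"
  using emeasure_averaged[OF B] by (simp add: averaged.emeasure_eq_measure sum_nonneg)

lemma randomized_translate_phases:
  assumes B: "B \<in> sets (borel_on X)"
  shows "measure randomized (translate (int phases) -` B \<inter> X) = measure randomized B"
proof -
  have "measure randomized B = measure (distr randomized (borel_on X) (translate N)) B"
    by (simp only: distr_randomized_translate)
  also have "\<dots> = measure randomized (translate (int phases) -` B \<inter> X)"
    using measure_distr[OF measurable_translate_randomized B] phases by (simp add: space_randomized)
  finally show ?thesis ..
qed

lemma measurable_translate_averaged: "translate k \<in> averaged \<rightarrow>\<^sub>M averaged"
  using measurable_translate sets_averaged by (simp cong: measurable_cong_sets)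

lemma invariant_averaged: "invariant_measure X averaged"
  unfolding invariant_measure_def
proof (intro conjI prob_space_averaged sets_averaged)
  show "distr averaged averaged shift = averaged"
  proof (rule measure_eqI)
    fix B assume "B \<in> sets (distr averaged averaged shift)"
    then have B: "B \<in> sets (borel_on X)" by (simp add: sets_averaged)
    define g where "g p = measure randomized (translate (int p) -` B \<inter> X)" for p
    have B1: "translate 1 -` B \<inter> X \<in> sets (borel_on X)"
      using measurable_sets[OF measurable_translate B] by simp
    have "translate (int p) -` (translate 1 -` B \<inter> X) \<inter> X = translate (int (Suc p)) -` B \<inter> X" for p
      using translate_X by auto
    then have "measure averaged (translate 1 -` B \<inter> X) = (\<Sum>p<phases. g (Suc p)) / real phases"
      unfolding measure_averaged[OF B1] g_def by simp
    also have "(\<Sum>p<phases. g (Suc p)) = (\<Sum>p<phases. g p)"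
    proof -
      have "g phases = g 0" using randomized_translate_phases[OF B] sets.sets_into_space[OF B]
        by (simp add: g_def Int_absorb2 vimage_def)
      then show ?thesis
        using sum.lessThan_Suc_shift[of g phases] by simp
    qed
    also have "\<dots> / real phases = measure averaged B" unfolding measure_averaged[OF B] g_def ..
    finally have "measure averaged (translate 1 -` B \<inter> X) = measure averaged B" .
    then show "emeasure (distr averaged averaged shift) B = emeasure averaged B"
      using B emeasure_distr[OF measurable_translate_averaged[of 1], of B]
      by (simp add: shift_eq_translate sets_averaged space_averaged averaged.emeasure_eq_measure)
  qed simp
qed

lemma averaged_code: "distr averaged (borel_on Y) \<pi> = distr \<mu> (borel_on Y) \<pi>"
proof (rule measure_eqI)
  fix B assume "B \<in> sets (distr averaged (borel_on Y) \<pi>)"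
  then have B: "B \<in> sets (borel_on Y)" by simp
  have m\<mu>: "\<pi> \<in> \<mu> \<rightarrow>\<^sub>M borel_on Y" "\<pi> \<in> randomized \<rightarrow>\<^sub>M borel_on Y" "\<pi> \<in> averaged \<rightarrow>\<^sub>M borel_on Y"
    using measurable_code sets_\<mu> sets_randomized sets_averaged by (simp_all cong: measurable_cong_sets)
  have PB: "\<pi> -` B \<inter> X \<in> sets (borel_on X)" if "B \<in> sets (borel_on Y)" for B
    using measurable_sets[OF measurable_code that] by simp
  have rand: "measure randomized (\<pi> -` B \<inter> X) = measure \<mu> (\<pi> -` B \<inter> X)" if "B \<in> sets (borel_on Y)" for B
    using measure_distr[OF m\<mu>(1) that] measure_distr[OF m\<mu>(2) that] distr_randomized_code
    by (simp add: space_\<mu> space_randomized)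
  have "measure randomized (translate (int p) -` (\<pi> -` B \<inter> X) \<inter> X) = measure \<mu> (\<pi> -` B \<inter> X)" for p
  proof -
    have TB: "translate (int p) -` B \<inter> Y \<in> sets (borel_on Y)"
      using measurable_sets[OF measurable_translate_Y B] by simp
    have "translate (int p) -` (\<pi> -` B \<inter> X) \<inter> X = \<pi> -` (translate (int p) -` B \<inter> Y) \<inter> X"
      using translate_X code_translate code_in_Y by auto
    then have "measure randomized (translate (int p) -` (\<pi> -` B \<inter> X) \<inter> X) = measure \<mu> (translate (int p) -` (\<pi> -` B \<inter> X) \<inter> X)"
      using rand[OF TB] by simp
    also have "\<dots> = measure (distr \<mu> \<mu> (translate (int p))) (\<pi> -` B \<inter> X)"
      using measure_distr[OF measurable_translate_invariant[OF inv], of "\<pi> -` B \<inter> X" "int p"] PB[OF B] sets_\<mu>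
      by (simp add: space_\<mu>)
    finally show ?thesis by (simp only: distr_translate[OF inv])
  qed
  then have "measure averaged (\<pi> -` B \<inter> X) = measure \<mu> (\<pi> -` B \<inter> X)"
    using measure_averaged[OF PB[OF B]] phases by simp
  then show "emeasure (distr averaged (borel_on Y) \<pi>) B = emeasure (distr \<mu> (borel_on Y) \<pi>) B"
    using emeasure_distr[OF m\<mu>(1) B] emeasure_distr[OF m\<mu>(3) B]
    by (simp add: averaged.emeasure_eq_measure \<mu>.emeasure_eq_measure space_\<mu> space_averaged)
qed simp

text \<open>
  Entropy is concave, so the mean over the phases has at least the mean of the entropies. For every
  phase a word over \<open>Suc m\<close> blocks contains \<open>m\<close> complete blocks.
\<close>

lemma averaged_entropy:
  "fun_entropy randomized (word {0..<int m * N}) \<le> fun_entropy averaged (word {0..<int (Suc m) * N})"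
proof -
  define J where "J = {0..<int (Suc m) * N}"
  define q where "q p v = measure randomized {x \<in> X. word J (translate (int p) x) = v}" for p v
  define h where "h = fun_entropy randomized (word {0..<int m * N})"
  have J: "finite J" by (simp add: J_def)
  have simple: "simple_function randomized (word I)" if "finite I" for I
    using simple_function_word_on[OF sets_randomized that] by (simp add: word_def[abs_def])
  have mtr: "translate k \<in> randomized \<rightarrow>\<^sub>M randomized" for k
    using measurable_translate sets_randomized by (simp cong: measurable_cong_sets)
  have simple_tr: "simple_function randomized (\<lambda>x. word I (translate k x))" if "finite I" for I k
    by (rule randomized.simple_function_measurable_comp[OF mtr simple[OF that]])
  have avg: "measure averaged {x \<in> X. word J x = v} = (\<Sum>p<phases. q p v) / real phases" for v
  proof -
    have "translate (int p) -` {x \<in> X. word J x = v} \<inter> X = {x \<in> X. word J (translate (int p) x) = v}" for p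
      using translate_X by auto
    then show ?thesis unfolding measure_averaged[OF word_event_sets[OF J]] q_def by simp
  qed
  have fe: "fun_entropy randomized (\<lambda>x. word J (translate (int p) x)) = - (\<Sum>v\<in>word J ` X. q p v * ln (q p v))" for p
  proof -
    have "(\<lambda>x. word J (translate (int p) x)) ` space randomized \<subseteq> word J ` X"
      using translate_X by (auto simp: space_randomized)
    moreover have "(\<lambda>x. word J (translate (int p) x)) -` {v} \<inter> space randomized = {x \<in> X. word J (translate (int p) x) = v}" for v
      by (auto simp: space_randomized)
    ultimately show ?thesis using finite_words[OF J] by (subst fun_entropy_superset) (auto simp: q_def)
  qed
  have low: "h \<le> fun_entropy randomized (\<lambda>x. word J (translate (int p) x))" if p: "p < phases" for p
  proof -
    have pN: "int p \<le> N" using p phases by linarith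
    have "h = fun_entropy randomized (\<lambda>x. word {0..<int m * N} (translate N x))"
    proof -
      have "distr randomized randomized (translate N) = distr randomized (borel_on X) (translate N)"
        by (rule distr_cong) (auto simp: sets_randomized)
      then have "distr randomized randomized (translate N) = randomized" by (simp only: distr_randomized_translate)
      from randomized.fun_entropy_measure_preserving[OF mtr this simple] show ?thesis unfolding h_def by simp
    qed
    also have "\<dots> \<le> fun_entropy randomized (\<lambda>x. word J (translate (int p) x))"
    proof (rule randomized.fun_entropy_coarser[OF simple_tr[OF J]])
      fix x y assume eq: "word J (translate (int p) x) = word J (translate (int p) y)"
      have "x (i + N) = y (i + N)" if i: "i \<in> {0..<int m * N}" for i
      proof -
        have "i + N - int p \<in> J" using i pN N by (auto simp: J_def algebra_simps)
        then have "translate (int p) x (i + N - int p) = translate (int p) y (i + N - int p)"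
          using eq unfolding word_eq_iff by blast
        then show ?thesis by simp
      qed
      then show "word {0..<int m * N} (translate N x) = word {0..<int m * N} (translate N y)"
        unfolding word_eq_iff by simp
    qed
    finally show ?thesis .
  qed
  have gibbs: "(\<Sum>v\<in>word J ` X. q p v * ln ((\<Sum>p<phases. q p v) / real phases)) \<le> - h" if p: "p < phases" for p
  proof -
    have "(\<Sum>v\<in>word J ` X. q p v * ln ((\<Sum>p<phases. q p v) / real phases)) \<le> (\<Sum>v\<in>word J ` X. q p v * ln (q p v))"
    proof (rule gibbs_inequality[OF finite_words[OF J]])
      fix v
      show "0 \<le> q p v" "0 \<le> (\<Sum>p<phases. q p v) / real phases" by (auto simp: q_def sum_nonneg)
      assume "0 < q p v"
      moreover have "q p v \<le> (\<Sum>p<phases. q p v)" using p by (intro member_le_sum) (auto simp: q_def)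
      ultimately show "0 < (\<Sum>p<phases. q p v) / real phases" using phases by simp
    next
      have one: "(\<Sum>v\<in>word J ` X. q p v) = 1" for p
      proof -
        have "(\<Sum>v\<in>word J ` X. q p v) = measure randomized (\<Union>v\<in>word J ` X. {x \<in> X. word J (translate (int p) x) = v})"
          unfolding q_def
        proof (rule randomized.finite_measure_finite_Union[symmetric, OF finite_words[OF J]])
          have "{x \<in> X. word J (translate (int p) x) = v} = translate (int p) -` {x \<in> X. word J x = v} \<inter> X" for v
            using translate_X by auto
          then have "{x \<in> X. word J (translate (int p) x) = v} \<in> sets randomized" for v
            using cylinder_sets[OF translate_vimage_cylinder[OF word_event[OF J]]] sets_randomized by simp
          then show "(\<lambda>v. {x \<in> X. word J (translate (int p) x) = v}) ` word J ` X \<subseteq> sets randomized" by blast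
        qed (auto simp: disjoint_family_on_def)
        also have "(\<Union>v\<in>word J ` X. {x \<in> X. word J (translate (int p) x) = v}) = space randomized"
          using translate_X by (auto simp: space_randomized)
        finally show ?thesis by (simp add: randomized.prob_space)
      qed
      have "(\<Sum>v\<in>word J ` X. (\<Sum>p<phases. q p v) / real phases) = (\<Sum>p<phases. (\<Sum>v\<in>word J ` X. q p v)) / real phases"
        by (subst sum.swap) (simp add: sum_divide_distrib)
      then show "(\<Sum>v\<in>word J ` X. (\<Sum>p<phases. q p v) / real phases) \<le> (\<Sum>v\<in>word J ` X. q p v)"
        using phases by (simp add: one)
    qed
    then show ?thesis using low[OF p] fe by simp
  qed
  have "fun_entropy averaged (word J) = - (\<Sum>v\<in>word J ` X. (\<Sum>p<phases. q p v) / real phases * ln ((\<Sum>p<phases. q p v) / real phases))"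
    by (simp add: fun_entropy_word[OF space_averaged] avg)
  also have "(\<Sum>v\<in>word J ` X. (\<Sum>p<phases. q p v) / real phases * ln ((\<Sum>p<phases. q p v) / real phases))
     = (\<Sum>p<phases. \<Sum>v\<in>word J ` X. q p v * ln ((\<Sum>p<phases. q p v) / real phases)) / real phases"
    by (subst sum.swap) (simp add: sum_divide_distrib sum_distrib_right)
  also have "- \<dots> \<ge> - ((\<Sum>p<phases. - h) / real phases)"
    using gibbs by (intro le_imp_neg_le divide_right_mono sum_mono) auto
  also have "- ((\<Sum>p<phases. - h) / real phases) = h" using phases by simp
  finally show ?thesis unfolding h_def J_def .
qed

text \<open>
  A word over \<open>Suc m\<close> blocks has gained \<open>m * block_gain / 2\<close>; divide by its length \<open>Suc m * N\<close>.
\<close>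

theorem entropy_rate_averaged:
  "entropy_rate \<mu> + block_gain / (2 * real_of_int N) \<le> entropy_rate averaged"
proof -
  have word_entropy: "word_entropy M (m * phases) = fun_entropy M (word {0..<int m * N})" 
    if "invariant_measure X M" for M m
    using word_entropy_def[OF that, of "m * phases"] phases by (simp add: word_def[abs_def])
  have inf: "filterlim (\<lambda>m. m * phases) sequentially sequentially" 
    using phases by (intro filterlim_subseq) (auto simp: strict_mono_def)
  have inf': "filterlim (\<lambda>m. Suc m * phases) sequentially sequentially"
    using phases by (intro filterlim_subseq) (auto simp: strict_mono_def)
  have l1: "(\<lambda>m. word_entropy \<mu> (m * phases) / real (m * phases)) \<longlonglongrightarrow> entropy_rate \<mu>"
    using filterlim_compose[OF word_entropy_tendsto[OF inv] inf] .
  have l2: "(\<lambda>m. word_entropy averaged (Suc m * phases) / real (Suc m * phases)) \<longlonglongrightarrow> entropy_rate averaged"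
    using filterlim_compose[OF word_entropy_tendsto[OF invariant_averaged] inf'] .
  have l3: "(\<lambda>m. real m / real (Suc m)) \<longlonglongrightarrow> 1" by (rule LIMSEQ_n_over_Suc_n)
  have "(\<lambda>m. (word_entropy \<mu> (m * phases) / real (m * phases) + block_gain / (2 * real_of_int N)) * (real m / real (Suc m)))
     \<longlonglongrightarrow> (entropy_rate \<mu> + block_gain / (2 * real_of_int N)) * 1"
    by (intro tendsto_intros l1 l3)
  moreover have "eventually (\<lambda>m. (word_entropy \<mu> (m * phases) / real (m * phases) + block_gain / (2 * real_of_int N)) * (real m / real (Suc m))
     \<le> word_entropy averaged (Suc m * phases) / real (Suc m * phases)) sequentially"
    using eventually_ge_at_top[of 1]
  proof eventually_elim
    case (elim m)
    have pN: "real phases = real_of_int N" using phases by (metis of_int_of_nat_eq)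
    have "word_entropy \<mu> (m * phases) + real m * block_gain / 2 \<le> word_entropy averaged (Suc m * phases)"
      using randomized_entropy_gain[of m] averaged_entropy[of m]
      unfolding word_entropy[OF inv] word_entropy[OF invariant_averaged] by linarith
    then have "(word_entropy \<mu> (m * phases) + real m * block_gain / 2) / real (Suc m * phases)
       \<le> word_entropy averaged (Suc m * phases) / real (Suc m * phases)"
      by (intro divide_right_mono) auto
    moreover have "(word_entropy \<mu> (m * phases) / real (m * phases) + block_gain / (2 * real_of_int N)) * (real m / real (Suc m))
       = (word_entropy \<mu> (m * phases) + real m * block_gain / 2) / real (Suc m * phases)"
      unfolding pN[symmetric]
    proof -
      have "(w / (a * p) + g / (2 * p)) * (a / (1 + a)) = (w + a * g / 2) / ((1 + a) * p)" if "0 < a" "0 < p" for a p g w :: real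
      proof -
        have "(w / (a * p) + g / (2 * p)) = (w + a * g / 2) / (a * p)" using that by (simp add: add_divide_distrib)
        then show ?thesis using that by simp
      qed
      from this[of "real m" "real phases"] show "(word_entropy \<mu> (m * phases) / real (m * phases) + block_gain / (2 * real phases)) * (real m / real (Suc m))
         = (word_entropy \<mu> (m * phases) + real m * block_gain / 2) / real (Suc m * phases)"
        using elim phases(1) by (simp only: of_nat_mult of_nat_Suc of_nat_0_less_iff)
    qed
    ultimately show ?case by simp
  qed
  ultimately show ?thesis using l2 by (intro tendsto_le[OF sequentially_bot l2]) auto
qed

lemma block_gain_pos:
  assumes x: "x \<in> X" "measure \<mu> {z \<in> X. word {0..<N} z = word {0..<N} x} \<noteq> measure \<mu> {z \<in> X. word {0..<N} z = word {0..<N} (T x)}"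
  shows "0 < block_gain"
  unfolding block_gain_def
proof (rule sum_pos2[OF finite_words, of _ "word {0..<N} x"])
  show "0 < divergence_to_mean (block_word_prob (word {0..<N} x)) (block_word_prob (block_word_swap (word {0..<N} x)))"
    unfolding block_word_swap[OF x(1)] using x(2) by (intro divergence_to_mean_pos) (auto simp: block_word_prob_def)
qed (use x in \<open>auto intro!: divergence_to_mean_nonneg simp: block_word_prob_def\<close>)

end

context sliding_block_code
begin

text \<open>
  Otherwise randomizing and averaging give a measure in the same fibre with larger entropy.
\<close>

lemma maximal_entropy_block_word:
  assumes \<mu>: "\<mu> \<in> invariant_fibre X Y \<pi> \<nu>"
    and max: "\<And>\<mu>'. \<mu>' \<in> invariant_fibre X Y \<pi> \<nu> \<Longrightarrow> measure_entropy \<mu>' shift \<le> measure_entropy \<mu> shift"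
    and N: "0 < N" and T: "block_involution {0..<N} T" and x: "x \<in> X"
  shows "measure \<mu> {z \<in> X. restrict z {0..<N} = restrict x {0..<N}} = measure \<mu> {z \<in> X. restrict z {0..<N} = restrict (T x) {0..<N}}"
proof (rule ccontr)
  assume ne: "\<not> ?thesis"
  have inv: "invariant_measure X \<mu>" using \<mu> by (simp add: invariant_fibre_def)
  interpret coin_action X Y \<pi> A K r N T \<mu> by unfold_locales (fact N T inv)+
  have "0 < block_gain" by (rule block_gain_pos[OF x]) (use ne in \<open>simp add: word_def\<close>)
  then have "entropy_rate \<mu> < entropy_rate averaged"
    using entropy_rate_averaged N by (smt (verit) divide_pos_pos of_int_0_less_iff)
  moreover have "averaged \<in> invariant_fibre X Y \<pi> \<nu>"
    using \<mu> invariant_averaged averaged_code by (simp add: invariant_fibre_def)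
  ultimately show False
    using max[of averaged] measure_entropy_eq_entropy_rate[OF inv] measure_entropy_eq_entropy_rate[OF invariant_averaged]
    by simp
qed

lemma measure_eq_sum_words:
  assumes M: "finite_measure M" "sets M = sets (borel_on X)" and J: "finite J" and C: "determined_on J X C"
  shows "measure M C = (\<Sum>v\<in>(\<lambda>x. restrict x J) ` C. measure M {z \<in> X. restrict z J = v})"
proof -
  have CX: "C \<subseteq> X" using C by (simp add: determined_on_def)
  have fin: "finite ((\<lambda>x. restrict x J) ` C)"
  proof (rule finite_subset)
    show "(\<lambda>x. restrict x J) ` C \<subseteq> PiE J (\<lambda>_. A)" using alphabet CX by auto
  qed (simp add: finite_PiE finite_A J)
  have ev: "{z \<in> X. restrict z J = v} \<in> sets M" for v
    unfolding M(2) by (intro cylinder_sets cylindersI[OF J]) (auto simp: determined_on_def fun_eq_iff restrict_def)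
  have "(\<Sum>v\<in>(\<lambda>x. restrict x J) ` C. measure M {z \<in> X. restrict z J = v})
     = measure M (\<Union>v\<in>(\<lambda>x. restrict x J) ` C. {z \<in> X. restrict z J = v})"
    using fin ev by (intro finite_measure.finite_measure_finite_Union[OF M(1), symmetric]) (auto simp: disjoint_family_on_def)
  also have "(\<Union>v\<in>(\<lambda>x. restrict x J) ` C. {z \<in> X. restrict z J = v}) = C"
  proof (intro equalityI subsetI)
    fix z assume "z \<in> (\<Union>v\<in>(\<lambda>x. restrict x J) ` C. {z \<in> X. restrict z J = v})"
    then obtain x where x: "x \<in> C" "z \<in> X" "restrict z J = restrict x J" by auto
    have "x \<in> C \<longleftrightarrow> z \<in> C"
      by (rule determined_onD[OF C]) (use x CX in \<open>auto simp: restrict_eq_iff\<close>)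
    then show "z \<in> C" using x by simp
  qed (use CX in auto)
  finally show ?thesis ..
qed

lemma maximal_entropy_preserves_cylinder_origin:
  assumes \<mu>: "\<mu> \<in> invariant_fibre X Y \<pi> \<nu>"
    and max: "\<And>\<mu>'. \<mu>' \<in> invariant_fibre X Y \<pi> \<nu> \<Longrightarrow> measure_entropy \<mu>' shift \<le> measure_entropy \<mu> shift"
    and N: "0 < N" and T: "block_involution {0..<N} T" and C: "determined_on {0..<N} X C"
  shows "measure \<mu> (T -` C \<inter> X) = measure \<mu> C"
proof -
  let ?J = "{0..<N}"
  have inv: "invariant_measure X \<mu>" using \<mu> by (simp add: invariant_fibre_def)
  have fm: "finite_measure \<mu>" using invariant_measureD(1)[OF inv] by (rule prob_space.finite_measure)
  note sM = invariant_measureD(2)[OF inv]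
  have CX: "C \<subseteq> X" using C by (simp add: determined_on_def)
  have TC: "determined_on ?J X (T -` C \<inter> X)"
    unfolding determined_on_def
  proof (intro conjI ballI impI)
    fix x x' assume x: "x \<in> T -` C \<inter> X" "x' \<in> X" and eq: "\<forall>i\<in>?J. x i = x' i"
    have "T x i = T x' i" if "i \<in> ?J" for i
      by (rule block_involution_local[OF T]) (use x eq that in blast)+
    then have "T x \<in> C \<longleftrightarrow> T x' \<in> C"
      using x block_involutionD(1)[OF T] by (intro determined_onD[OF C]) blast+
    then show "x' \<in> T -` C \<inter> X" using x by simp
  qed auto
  have T_word: "restrict (T x) ?J = restrict (T y) ?J" if "x \<in> X" "y \<in> X" "restrict x ?J = restrict y ?J" for x y
    using that block_involution_local[OF T, of x y] unfolding restrict_eq_iff by blast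
  define rep where "rep v = inv_into X (\<lambda>x. restrict x ?J) v" for v
  have rep: "rep (restrict x ?J) \<in> X" "restrict (rep (restrict x ?J)) ?J = restrict x ?J" if "x \<in> X" for x
    using that inv_into_into[of "restrict x ?J" "\<lambda>x. restrict x ?J" X] f_inv_into_f[of "restrict x ?J" "\<lambda>x. restrict x ?J" X]
    unfolding rep_def by blast+
  define t where "t v = restrict (T (rep v)) ?J" for v
  have t: "t (restrict x ?J) = restrict (T x) ?J" if "x \<in> X" for x
    unfolding t_def using that rep by (intro T_word) auto
  have bij: "bij_betw t ((\<lambda>x. restrict x ?J) ` (T -` C \<inter> X)) ((\<lambda>x. restrict x ?J) ` C)"
  proof (rule bij_betwI[of _ _ _ t])
    show "t \<in> (\<lambda>x. restrict x ?J) ` (T -` C \<inter> X) \<rightarrow> (\<lambda>x. restrict x ?J) ` C" using t by auto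
    show "t \<in> (\<lambda>x. restrict x ?J) ` C \<rightarrow> (\<lambda>x. restrict x ?J) ` (T -` C \<inter> X)"
    proof
      fix v assume "v \<in> (\<lambda>x. restrict x ?J) ` C"
      then obtain x where x: "x \<in> C" "v = restrict x ?J" by blast
      have "T x \<in> T -` C \<inter> X" using block_involutionD(1,2)[OF T, of x] x CX by auto
      then show "t v \<in> (\<lambda>x. restrict x ?J) ` (T -` C \<inter> X)" using t[of x] x CX by blast
    qed
    have tt: "t (t (restrict x ?J)) = restrict x ?J" if "x \<in> X" for x
      using t[OF that] t[OF block_involutionD(1)[OF T that]] block_involutionD(2)[OF T that] by simp
    show "t (t v) = v" if "v \<in> (\<lambda>x. restrict x ?J) ` (T -` C \<inter> X)" for v using that tt by blast
    show "t (t v) = v" if "v \<in> (\<lambda>x. restrict x ?J) ` C" for v using that tt CX by blast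
  qed
  have "measure \<mu> (T -` C \<inter> X) = (\<Sum>v\<in>(\<lambda>x. restrict x ?J) ` (T -` C \<inter> X). measure \<mu> {z \<in> X. restrict z ?J = v})"
    by (rule measure_eq_sum_words[OF fm sM _ TC]) simp
  also have "\<dots> = (\<Sum>v\<in>(\<lambda>x. restrict x ?J) ` (T -` C \<inter> X). measure \<mu> {z \<in> X. restrict z ?J = t v})"
  proof (rule sum.cong[OF refl])
    fix v assume "v \<in> (\<lambda>x. restrict x ?J) ` (T -` C \<inter> X)"
    then obtain x where x: "x \<in> X" "v = restrict x ?J" by blast
    show "measure \<mu> {z \<in> X. restrict z ?J = v} = measure \<mu> {z \<in> X. restrict z ?J = t v}"
      unfolding x(2) t[OF x(1)] by (rule maximal_entropy_block_word[OF \<mu> max N T x(1)])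
  qed
  also have "\<dots> = (\<Sum>v\<in>(\<lambda>x. restrict x ?J) ` C. measure \<mu> {z \<in> X. restrict z ?J = v})"
    by (rule sum.reindex_bij_betw[OF bij])
  also have "\<dots> = measure \<mu> C"
    by (rule measure_eq_sum_words[OF fm sM _ C, symmetric]) simp
  finally show ?thesis .
qed

text \<open>
  A common interval contains \<open>J\<close> and the window of a given cylinder. Translating it to the origin
  reduces the claim to the probabilities of words on \<open>{0..<N}\<close>.
\<close>

theorem maximal_entropy_block_involution:
  assumes \<mu>: "\<mu> \<in> invariant_fibre X Y \<pi> \<nu>"
    and max: "\<And>\<mu>'. \<mu>' \<in> invariant_fibre X Y \<pi> \<nu> \<Longrightarrow> measure_entropy \<mu>' shift \<le> measure_entropy \<mu> shift"
    and J: "finite J" and T: "block_involution J T"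
  shows "distr \<mu> \<mu> T = \<mu>"
proof -
  have inv: "invariant_measure X \<mu>" using \<mu> by (simp add: invariant_fibre_def)
  interpret prob_space \<mu> by (rule invariant_measureD(1)[OF inv])
  note sM = invariant_measureD(2)[OF inv] and spM = invariant_measureD(4)[OF inv]
  have mT: "T \<in> \<mu> \<rightarrow>\<^sub>M \<mu>" using measurable_block_involution[OF T J] sM by (simp cong: measurable_cong_sets)
  have cyl: "measure \<mu> (T -` C \<inter> X) = measure \<mu> C" if C: "C \<in> cylinders X" for C
  proof -
    obtain J' where J': "finite J'" "determined_on J' X C" using C by (auto simp: cylinders_def)
    have "finite (insert 0 (J \<union> J'))" using J J' by simp
    then obtain a b where ab: "insert 0 (J \<union> J') \<subseteq> {a..b}"
      by (metis Max_ge Min_le atLeastAtMost_iff subsetI)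
    define N where "N = b - a + 1"
    have N: "0 < N" using ab by (auto simp: N_def)
    have sub: "J \<subseteq> {a..<a + N}" "J' \<subseteq> {a..<a + N}" using ab by (auto simp: N_def)
    define T' where "T' x = translate (- (- a)) (T (translate (- a) x))" for x
    have img: "(\<lambda>i. i + - a) ` {a..<a + N} = {0..<N}"
    proof (intro equalityI subsetI)
      fix i assume "i \<in> {0..<N}"
      then show "i \<in> (\<lambda>i. i + - a) ` {a..<a + N}" by (intro image_eqI[of _ _ "i + a"]) auto
    qed auto
    have T': "block_involution {0..<N} T'"
      using block_involution_translate[OF block_involution_mono[OF T sub(1)], of "- a"] unfolding img T'_def .
    define C' where "C' = translate (- a) -` C \<inter> X"
    have C': "determined_on {0..<N} X C'"
      unfolding determined_on_def
    proof (intro conjI ballI impI)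
      fix x x' assume x: "x \<in> C'" "x' \<in> X" and eq: "\<forall>i\<in>{0..<N}. x i = x' i"
      have "translate (- a) x \<in> C \<longleftrightarrow> translate (- a) x' \<in> C"
      proof (rule determined_onD[OF J'(2)])
        show "translate (- a) x \<in> X" "translate (- a) x' \<in> X" using x translate_X by (auto simp: C'_def)
        fix i assume "i \<in> J'"
        then have "i - a \<in> {0..<N}" using sub(2) by auto
        then show "translate (- a) x i = translate (- a) x' i" using eq by simp
      qed
      then show "x' \<in> C'" using x by (simp add: C'_def)
    qed (simp add: C'_def)
    have tr: "measure \<mu> (translate (- a) -` B \<inter> X) = measure \<mu> B" if B: "B \<in> sets (borel_on X)" for B
      using measure_distr[OF measurable_translate_invariant[OF inv], of B "- a"] B sM
      by (simp add: distr_translate[OF inv] spM)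
    have "T' -` C' \<inter> X = translate (- a) -` (T -` C \<inter> X) \<inter> X"
    proof -
      have "translate (- a) (T' x) = T (translate (- a) x)" for x by (simp add: T'_def)
      then show ?thesis using translate_X block_involutionD(1)[OF T'] by (auto simp: C'_def)
    qed
    then have "measure \<mu> (T -` C \<inter> X) = measure \<mu> (T' -` C' \<inter> X)"
      using tr[OF cylinder_sets[OF block_involution_vimage_cylinder[OF T J C]]] by simp
    also have "\<dots> = measure \<mu> C'" by (rule maximal_entropy_preserves_cylinder_origin[OF \<mu> max N T' C'])
    also have "\<dots> = measure \<mu> C" unfolding C'_def by (rule tr[OF cylinder_sets[OF C]])
    finally show ?thesis .
  qed
  show ?thesis
  proof (rule measure_eqI_cylinders[of _ X])
    show "finite_measure (distr \<mu> \<mu> T)" using prob_space_distr[OF mT] by (rule prob_space.finite_measure)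
    fix C assume C: "C \<in> cylinders X"
    then have "C \<in> sets \<mu>" using cylinder_sets sM by blast
    then show "emeasure (distr \<mu> \<mu> T) C = emeasure \<mu> C"
      using cyl[OF C] by (simp add: emeasure_distr[OF mT] emeasure_eq_measure spM)
  qed (simp_all add: sM)
qed

end

section \<open>The relatively independent joining\<close>

context sliding_block_code
begin

lemma invariant_fibreD:
  assumes "\<mu> \<in> invariant_fibre X Y \<pi> \<nu>"
  shows "prob_space \<mu>" "sets \<mu> = sets (borel_on X)" "space \<mu> = X" "distr \<mu> (borel_on Y) \<pi> = \<nu>"
    "invariant_measure X \<mu>" "sets \<nu> = sets (borel_on Y)" "space \<nu> = Y" "prob_space \<nu>"
proof -
  have inv: "invariant_measure X \<mu>" and d: "distr \<mu> (borel_on Y) \<pi> = \<nu>" using assms by (auto simp: invariant_fibre_def)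
  note D = invariant_measureD[OF inv]
  have m: "\<pi> \<in> \<mu> \<rightarrow>\<^sub>M borel_on Y" using measurable_code D(2) by (simp cong: measurable_cong_sets)
  have s: "sets \<nu> = sets (borel_on Y)" using d by (metis sets_distr)
  show "sets \<nu> = sets (borel_on Y)" by (rule s)
  show "space \<nu> = Y" using sets_eq_imp_space_eq[OF s] by simp
  show "prob_space \<nu>" using prob_space.prob_space_distr[OF D(1) m] d by simp
qed (use assms invariant_measureD[of X \<mu>] in \<open>auto simp: invariant_fibre_def\<close>)

lemma code_measurable_on:
  assumes "\<mu> \<in> invariant_fibre X Y \<pi> \<nu>" shows "\<pi> \<in> \<mu> \<rightarrow>\<^sub>M borel_on Y"
  using measurable_code invariant_fibreD(2)[OF assms] by (simp cong: measurable_cong_sets)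

abbreviation cond_mass :: "(int \<Rightarrow> 'a) measure \<Rightarrow> (int \<Rightarrow> 'a) set \<Rightarrow> (int \<Rightarrow> 'b) \<Rightarrow> real" where
  "cond_mass \<mu> B y \<equiv> fibre_cond_exp X Y \<pi> \<mu> B y"

abbreviation pullback :: "(int \<Rightarrow> 'a) measure" where
  "pullback \<equiv> vimage_algebra X \<pi> (borel_on Y)"

lemma sets_pullback: "sets pullback = {\<pi> -` B \<inter> X | B. B \<in> sets (borel_on Y)}"
  by (rule sets_vimage_algebra2) (auto simp: code_in_Y)

lemma subalgebra_pullback:
  assumes "\<mu> \<in> invariant_fibre X Y \<pi> \<nu>" shows "subalgebra \<mu> pullback"
  unfolding subalgebra_def
proof (intro conjI)
  show "space pullback = space \<mu>" by (simp add: invariant_fibreD(3)[OF assms])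
  show "sets pullback \<subseteq> sets \<mu>"
    unfolding sets_pullback using measurable_sets[OF code_measurable_on[OF assms]] invariant_fibreD(3)[OF assms] by auto
qed

lemma finite_measure_subalgebra_pullback:
  assumes "\<mu> \<in> invariant_fibre X Y \<pi> \<nu>" shows "finite_measure_subalgebra \<mu> pullback"
  unfolding finite_measure_subalgebra_def finite_measure_subalgebra_axioms_def
  using subalgebra_pullback[OF assms] invariant_fibreD(1)[OF assms] prob_space.finite_measure by blast

lemma borel_measurable_cond_mass: "cond_mass \<mu> C \<in> borel_measurable (borel_on Y)"
proof (rule measurableI)
  fix D :: "real set" assume D: "D \<in> sets borel"
  define g where "g = real_cond_exp \<mu> pullback (indicator C)"
  have "g \<in> borel_measurable pullback" unfolding g_def by simp
  then have "g -` D \<inter> X \<in> sets pullback" using measurable_sets[of g pullback borel D] D by simp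
  then obtain B where B: "B \<in> sets (borel_on Y)" "g -` D \<inter> X = \<pi> -` B \<inter> X" unfolding sets_pullback by blast
  have "cond_mass \<mu> C -` D \<inter> space (borel_on Y) = B"
  proof -
    have BY: "B \<subseteq> Y" using sets.sets_into_space[OF B(1)] by simp
    have "cond_mass \<mu> C y \<in> D \<longleftrightarrow> y \<in> B" if y: "y \<in> Y" for y
    proof -
      obtain x where x: "x \<in> X" "\<pi> x = y" using y code_image by blast
      have "cond_mass \<mu> C y = g x" using fibre_cond_exp_apply[OF code_image x(1), of \<mu> C] x(2) by (simp add: g_def)
      moreover have "g x \<in> D \<longleftrightarrow> x \<in> g -` D \<inter> X" using x(1) by simp
      moreover have "x \<in> \<pi> -` B \<inter> X \<longleftrightarrow> y \<in> B" using x by simp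
      ultimately show ?thesis unfolding B(2) by simp
    qed
    then show ?thesis using BY by auto
  qed
  then show "cond_mass \<mu> C -` D \<inter> space (borel_on Y) \<in> sets (borel_on Y)" using B(1) by simp
qed simp

context
  fixes \<mu> :: "(int \<Rightarrow> 'a) measure" and \<nu> :: "(int \<Rightarrow> 'b) measure"
  assumes \<mu>: "\<mu> \<in> invariant_fibre X Y \<pi> \<nu>"
begin

interpretation prob_space \<mu> by (rule invariant_fibreD(1)[OF \<mu>])

interpretation base: prob_space \<nu> by (rule invariant_fibreD(8)[OF \<mu>])

interpretation finite_measure_subalgebra \<mu> pullback by (rule finite_measure_subalgebra_pullback[OF \<mu>])

lemma borel_measurable_cond_mass': "cond_mass \<mu> C \<in> borel_measurable \<nu>"
  using borel_measurable_cond_mass invariant_fibreD(6)[OF \<mu>] by (simp cong: measurable_cong_sets)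

lemma AE_code: "{y \<in> Y. P y} \<in> sets (borel_on Y) \<Longrightarrow> (AE y in \<nu>. P y) \<longleftrightarrow> (AE x in \<mu>. P (\<pi> x))"
  using AE_distr_iff[OF code_measurable_on[OF \<mu>], of P] unfolding invariant_fibreD(4)[OF \<mu>] by simp

lemma cond_mass_bounds:
  assumes C: "C \<in> sets (borel_on X)"
  shows "AE y in \<nu>. 0 \<le> cond_mass \<mu> C y \<and> cond_mass \<mu> C y \<le> 1"
proof -
  have int: "integrable \<mu> (indicator C :: _ \<Rightarrow> real)" using C invariant_fibreD(2)[OF \<mu>] by (simp add: emeasure_eq_measure)
  have "AE x in \<mu>. 0 \<le> real_cond_exp \<mu> pullback (indicator C) x"
    by (rule real_cond_exp_ge_c[OF int]) simp
  moreover have "AE x in \<mu>. real_cond_exp \<mu> pullback (indicator C) x \<le> 1"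
    by (rule real_cond_exp_le_c[OF int]) (simp add: indicator_def)
  ultimately have "AE x in \<mu>. 0 \<le> cond_mass \<mu> C (\<pi> x) \<and> cond_mass \<mu> C (\<pi> x) \<le> 1"
    using AE_space
  proof eventually_elim
    case (elim x)
    then show ?case using fibre_cond_exp_apply[OF code_image, of x \<mu> C] by (simp add: invariant_fibreD(3)[OF \<mu>])
  qed
  moreover have "{y \<in> Y. 0 \<le> cond_mass \<mu> C y \<and> cond_mass \<mu> C y \<le> 1} = cond_mass \<mu> C -` {0..1} \<inter> space (borel_on Y)" by auto
  then have "{y \<in> Y. 0 \<le> cond_mass \<mu> C y \<and> cond_mass \<mu> C y \<le> 1} \<in> sets (borel_on Y)"
    using measurable_sets[OF borel_measurable_cond_mass, of "{0..1}" \<mu> C] by simp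
  ultimately show ?thesis by (subst AE_code)
qed

lemma integrable_cond_mass:
  assumes C: "C \<in> sets (borel_on X)" shows "integrable \<nu> (cond_mass \<mu> C)"
proof (rule base.integrable_const_bound[of _ 1])
  show "AE y in \<nu>. norm (cond_mass \<mu> C y) \<le> 1" using cond_mass_bounds[OF C] by eventually_elim auto
qed (rule borel_measurable_cond_mass')

lemma set_integral_cond_mass:
  assumes C: "C \<in> sets (borel_on X)" and B: "B \<in> sets (borel_on Y)"
  shows "(\<integral>y\<in>B. cond_mass \<mu> C y \<partial>\<nu>) = measure \<mu> (C \<inter> \<pi> -` B)"
proof -
  have int: "integrable \<mu> (indicator C :: _ \<Rightarrow> real)" using C invariant_fibreD(2)[OF \<mu>] by (simp add: emeasure_eq_measure)
  have PB: "\<pi> -` B \<inter> X \<in> sets pullback" unfolding sets_pullback using B by blast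
  have "(\<integral>y\<in>B. cond_mass \<mu> C y \<partial>\<nu>) = (\<integral>y. indicator B y * cond_mass \<mu> C y \<partial>distr \<mu> (borel_on Y) \<pi>)"
    by (simp add: set_lebesgue_integral_def invariant_fibreD(4)[OF \<mu>])
  also have "\<dots> = (\<integral>x. indicator B (\<pi> x) * cond_mass \<mu> C (\<pi> x) \<partial>\<mu>)"
    using B borel_measurable_cond_mass by (intro integral_distr code_measurable_on[OF \<mu>]) auto
  also have "\<dots> = (\<integral>x. indicator (\<pi> -` B \<inter> X) x * real_cond_exp \<mu> pullback (indicator C) x \<partial>\<mu>)"
    using fibre_cond_exp_apply[OF code_image]
    by (intro Bochner_Integration.integral_cong refl) (auto simp: invariant_fibreD(3)[OF \<mu>] indicator_def)
  also have "\<dots> = (\<integral>x\<in>\<pi> -` B \<inter> X. real_cond_exp \<mu> pullback (indicator C) x \<partial>\<mu>)"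
    by (simp add: set_lebesgue_integral_def)
  also have "\<dots> = (\<integral>x\<in>\<pi> -` B \<inter> X. indicator C x \<partial>\<mu>)"
    by (rule real_cond_exp_intA[OF int PB, symmetric])
  also have "\<dots> = (\<integral>x. indicator (C \<inter> \<pi> -` B) x \<partial>\<mu>)"
    unfolding set_lebesgue_integral_def
    by (intro Bochner_Integration.integral_cong refl) (auto simp: invariant_fibreD(3)[OF \<mu>] indicator_def)
  also have "\<dots> = measure \<mu> (C \<inter> \<pi> -` B)"
  proof -
    have "C \<inter> \<pi> -` B = C \<inter> (\<pi> -` B \<inter> X)" using sets.sets_into_space[OF C] by auto
    then have "C \<inter> \<pi> -` B \<in> sets \<mu>"
      using C PB subalgebra_pullback[OF \<mu>] invariant_fibreD(2)[OF \<mu>] by (auto simp: subalgebra_def)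
    then show ?thesis by simp
  qed
  finally show ?thesis .
qed

lemma integral_cond_mass:
  assumes B: "B \<in> sets (borel_on X)" shows "(\<integral>y. cond_mass \<mu> B y \<partial>\<nu>) = measure \<mu> B"
proof -
  have Y: "Y \<in> sets (borel_on Y)" using sets.top[of "borel_on Y"] by simp
  have "(\<integral>y\<in>Y. cond_mass \<mu> B y \<partial>\<nu>) = (\<integral>y. cond_mass \<mu> B y \<partial>\<nu>)"
    unfolding set_lebesgue_integral_def
    by (intro Bochner_Integration.integral_cong refl) (simp add: invariant_fibreD(7)[OF \<mu>])
  moreover have "B \<inter> \<pi> -` Y = B" using sets.sets_into_space[OF B] code_in_Y by auto
  ultimately show ?thesis using set_integral_cond_mass[OF B Y] by simp
qed

text \<open>
  The defining property of a conditional expectation, expressed on the base \<open>Y\<close>.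
\<close>

lemma cond_mass_unique:
  assumes C: "C \<in> sets (borel_on X)" and k: "integrable \<nu> k"
    and eq: "\<And>B. B \<in> sets (borel_on Y) \<Longrightarrow> (\<integral>y\<in>B. k y \<partial>\<nu>) = measure \<mu> (C \<inter> \<pi> -` B)"
  shows "AE y in \<nu>. k y = cond_mass \<mu> C y"
proof (rule density_unique_real[OF k integrable_cond_mass[OF C]])
  fix B assume "B \<in> sets \<nu>"
  then have B: "B \<in> sets (borel_on Y)" using invariant_fibreD(6)[OF \<mu>] by blast
  show "(\<integral>y\<in>B. k y \<partial>\<nu>) = (\<integral>y\<in>B. cond_mass \<mu> C y \<partial>\<nu>)"
    unfolding eq[OF B] set_integral_cond_mass[OF C B] ..
qed

lemma preimage_sets: "B \<in> sets (borel_on Y) \<Longrightarrow> \<pi> -` B \<inter> X \<in> sets \<mu>"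
  using measurable_sets[OF code_measurable_on[OF \<mu>]] invariant_fibreD(3)[OF \<mu>] by auto

lemma preimage_Int_sets:
  assumes "C \<in> sets (borel_on X)" "B \<in> sets (borel_on Y)" shows "C \<inter> \<pi> -` B \<in> sets \<mu>"
proof -
  have "C \<inter> \<pi> -` B = C \<inter> (\<pi> -` B \<inter> X)" using sets.sets_into_space[OF assms(1)] by auto
  then show ?thesis using preimage_sets[OF assms(2)] assms(1) invariant_fibreD(2)[OF \<mu>] by auto
qed

lemma set_integrable_cond_mass:
  assumes "C \<in> sets (borel_on X)" "B \<in> sets (borel_on Y)"
  shows "set_integrable \<nu> B (cond_mass \<mu> C)"
  unfolding set_integrable_def
  using integrable_mult_indicator[OF _ integrable_cond_mass[OF assms(1)], of B] assms(2) invariant_fibreD(6)[OF \<mu>] by simp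

lemma cond_mass_Un:
  assumes C: "C \<in> sets (borel_on X)" "D \<in> sets (borel_on X)" "C \<inter> D = {}"
  shows "AE y in \<nu>. cond_mass \<mu> (C \<union> D) y = cond_mass \<mu> C y + cond_mass \<mu> D y"
proof -
  have "AE y in \<nu>. cond_mass \<mu> C y + cond_mass \<mu> D y = cond_mass \<mu> (C \<union> D) y"
  proof (rule cond_mass_unique)
    fix B assume B: "B \<in> sets (borel_on Y)"
    have "(\<integral>y\<in>B. (cond_mass \<mu> C y + cond_mass \<mu> D y) \<partial>\<nu>) = measure \<mu> (C \<inter> \<pi> -` B) + measure \<mu> (D \<inter> \<pi> -` B)"
      using set_integral_add(2)[OF set_integrable_cond_mass[OF C(1) B] set_integrable_cond_mass[OF C(2) B]]
      by (simp add: set_integral_cond_mass C B)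
    also have "\<dots> = measure \<mu> ((C \<inter> \<pi> -` B) \<union> (D \<inter> \<pi> -` B))"
      using C preimage_Int_sets B by (intro finite_measure_Union[symmetric]) auto
    also have "(C \<inter> \<pi> -` B) \<union> (D \<inter> \<pi> -` B) = (C \<union> D) \<inter> \<pi> -` B" by auto
    finally show "(\<integral>y\<in>B. (cond_mass \<mu> C y + cond_mass \<mu> D y) \<partial>\<nu>) = measure \<mu> ((C \<union> D) \<inter> \<pi> -` B)" .
  qed (use C integrable_cond_mass in auto)
  then show ?thesis by eventually_elim simp
qed

lemma cond_mass_space: "AE y in \<nu>. cond_mass \<mu> X y = 1"
proof -
  have X: "X \<in> sets (borel_on X)" using sets.top[of "borel_on X"] by simp
  have "AE y in \<nu>. 1 = cond_mass \<mu> X y"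
  proof (rule cond_mass_unique[OF X])
    fix B assume B: "B \<in> sets (borel_on Y)"
    then have "B \<in> sets \<nu>" using invariant_fibreD(6)[OF \<mu>] by simp
    then have "(\<integral>y\<in>B. (1::real) \<partial>\<nu>) = measure \<nu> B"
      by (simp add: set_lebesgue_integral_def)
    also have "\<dots> = measure (distr \<mu> (borel_on Y) \<pi>) B" by (simp only: invariant_fibreD(4)[OF \<mu>])
    also have "\<dots> = measure \<mu> (\<pi> -` B \<inter> space \<mu>)" by (rule measure_distr[OF code_measurable_on[OF \<mu>] B])
    also have "\<pi> -` B \<inter> space \<mu> = X \<inter> \<pi> -` B" by (auto simp: invariant_fibreD(3)[OF \<mu>])
    finally show "(\<integral>y\<in>B. (1::real) \<partial>\<nu>) = measure \<mu> (X \<inter> \<pi> -` B)" .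
  qed simp
  then show ?thesis by eventually_elim simp
qed

text \<open>
  There are only countably many cylinders, so for almost every \<open>y\<close> the conditional masses are additive
  on them and extend to a measure. On the exceptional null set any probability measure will do.
\<close>

lemma disintegration_on_cylinders:
  "\<exists>\<kappa>. \<kappa> \<in> \<nu> \<rightarrow>\<^sub>M subprob_algebra (borel_on X) \<and>
     (\<forall>C\<in>cylinders X. AE y in \<nu>. emeasure (\<kappa> y) C = ennreal (cond_mass \<mu> C y))"
proof -
  have cs: "countable (cylinders X)" by (rule countable_cylinders[OF finite_A]) (rule alphabet)
  have cyl: "C \<in> sets (borel_on X)" if "C \<in> cylinders X" for C using that by (rule cylinder_sets)
  define good where "good y \<longleftrightarrow> (\<forall>C\<in>cylinders X. 0 \<le> cond_mass \<mu> C y) \<and>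
    (\<forall>C\<in>cylinders X. \<forall>D\<in>cylinders X. C \<inter> D = {} \<longrightarrow> cond_mass \<mu> (C \<union> D) y = cond_mass \<mu> C y + cond_mass \<mu> D y) \<and>
    cond_mass \<mu> X y = 1" for y
  have "AE y in \<nu>. \<forall>C\<in>cylinders X. 0 \<le> cond_mass \<mu> C y"
    unfolding AE_ball_countable[OF cs]
  proof
    fix C assume "C \<in> cylinders X"
    from cond_mass_bounds[OF cyl[OF this]] show "AE y in \<nu>. 0 \<le> cond_mass \<mu> C y" by eventually_elim simp
  qed
  moreover have "AE y in \<nu>. \<forall>C\<in>cylinders X. \<forall>D\<in>cylinders X. C \<inter> D = {} \<longrightarrow> cond_mass \<mu> (C \<union> D) y = cond_mass \<mu> C y + cond_mass \<mu> D y"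
    unfolding AE_ball_countable[OF cs]
  proof (intro ballI)
    fix C D assume CD: "C \<in> cylinders X" "D \<in> cylinders X"
    show "AE y in \<nu>. C \<inter> D = {} \<longrightarrow> cond_mass \<mu> (C \<union> D) y = cond_mass \<mu> C y + cond_mass \<mu> D y"
    proof (cases "C \<inter> D = {}")
      case True
      from cond_mass_Un[OF cyl[OF CD(1)] cyl[OF CD(2)] True] show ?thesis by eventually_elim simp
    qed simp
  qed
  ultimately have "AE y in \<nu>. good y"
    using cond_mass_space unfolding good_def by eventually_elim simp
  then obtain Z where Z: "Z \<in> null_sets \<nu>" "{y \<in> space \<nu>. \<not> good y} \<subseteq> Z"
    by (auto simp: eventually_ae_filter)
  have "\<exists>M. prob_space M \<and> sets M = sets (borel_on X) \<and> (\<forall>C\<in>cylinders X. emeasure M C = ennreal (cond_mass \<mu> C y))"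
    if y: "good y" for y
  proof -
    have "\<exists>M. sets M = sets (borel_on X) \<and> (\<forall>C\<in>cylinders X. emeasure M C = ennreal (cond_mass \<mu> C y))"
      by (rule cylinder_measure_extension[OF compact_X]) (use y in \<open>auto simp: good_def\<close>)
    then obtain M where M: "sets M = sets (borel_on X)" "\<forall>C\<in>cylinders X. emeasure M C = ennreal (cond_mass \<mu> C y)" by blast
    have "space M = X" using sets_eq_imp_space_eq[OF M(1)] by simp
    then have "prob_space M" using M(2) y by (intro prob_spaceI) (auto simp: good_def)
    then show ?thesis using M by blast
  qed
  then obtain K where K: "\<And>y. good y \<Longrightarrow> prob_space (K y)" "\<And>y. good y \<Longrightarrow> sets (K y) = sets (borel_on X)"
    "\<And>y C. good y \<Longrightarrow> C \<in> cylinders X \<Longrightarrow> emeasure (K y) C = ennreal (cond_mass \<mu> C y)" by metis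
  define \<kappa> where "\<kappa> y = (if y \<in> Z then \<mu> else K y)" for y
  have gd: "good y" if "y \<in> space \<nu>" "y \<notin> Z" for y using that Z(2) by blast
  have Zs: "Z \<in> sets \<nu>" using Z(1) by blast
  have sp: "X \<in> cylinders X" by (rule cylindersI[of "{}"]) (auto simp: determined_on_def)
  have ps: "prob_space (\<kappa> y)" "sets (\<kappa> y) = sets (borel_on X)" if "y \<in> space \<nu>" for y
    using K(1,2)[OF gd[OF that]] prob_space_axioms invariant_fibreD(2)[OF \<mu>] by (auto simp: \<kappa>_def)
  have em: "(\<lambda>y. emeasure (\<kappa> y) C) \<in> borel_measurable \<nu>" if C: "C \<in> cylinders X" for C
  proof -
    have "(\<lambda>y. if y \<in> Z then emeasure \<mu> C else ennreal (cond_mass \<mu> C y)) \<in> borel_measurable \<nu>"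
      using Zs borel_measurable_cond_mass' by (intro measurable_If_set measurable_compose[OF borel_measurable_cond_mass' measurable_ennreal]) auto
    moreover have "emeasure (\<kappa> y) C = (if y \<in> Z then emeasure \<mu> C else ennreal (cond_mass \<mu> C y))" if "y \<in> space \<nu>" for y
      using K(3)[OF gd[OF that] C] by (simp add: \<kappa>_def)
    ultimately show ?thesis by (simp cong: measurable_cong)
  qed
  have "\<kappa> \<in> \<nu> \<rightarrow>\<^sub>M subprob_algebra (borel_on X)"
  proof (rule measurable_subprob_algebra_generated[OF sets_borel_on])
    show "Int_stable (cylinders X)" by (auto simp: Int_stable_def)
    show "cylinders X \<subseteq> Pow X" using cylinders_subset by auto
    show "subprob_space (\<kappa> y)" if "y \<in> space \<nu>" for y using ps(1)[OF that] by (rule prob_space_imp_subprob_space)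
    show "(\<lambda>y. emeasure (\<kappa> y) X) \<in> borel_measurable \<nu>" by (rule em[OF sp])
  qed (use ps em in auto)
  moreover have "AE y in \<nu>. emeasure (\<kappa> y) C = ennreal (cond_mass \<mu> C y)" if C: "C \<in> cylinders X" for C
    using AE_not_in[OF Z(1)] AE_space
  proof eventually_elim
    case (elim y)
    then show ?case using K(3)[OF gd C] by (simp add: \<kappa>_def)
  qed
  ultimately show ?thesis by blast
qed

text \<open>
  For fixed \<open>B\<close> both sides of the identity \<open>nn\<close> below are finite measures in \<open>C\<close>; they agree on
  cylinders, hence on all Borel sets.
\<close>

lemma disintegration:
  "\<exists>\<kappa>. \<kappa> \<in> \<nu> \<rightarrow>\<^sub>M subprob_algebra (borel_on X) \<and>
     (\<forall>C\<in>sets (borel_on X). AE y in \<nu>. emeasure (\<kappa> y) C = ennreal (cond_mass \<mu> C y))"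
proof -
  obtain \<kappa> where \<kappa>: "\<kappa> \<in> \<nu> \<rightarrow>\<^sub>M subprob_algebra (borel_on X)"
    and cyl: "\<And>C. C \<in> cylinders X \<Longrightarrow> AE y in \<nu>. emeasure (\<kappa> y) C = ennreal (cond_mass \<mu> C y)"
    using disintegration_on_cylinders by blast
  have s\<nu>: "sets \<nu> = sets (borel_on Y)" by (rule invariant_fibreD(6)[OF \<mu>])
  have me: "(\<lambda>y. emeasure (\<kappa> y) C) \<in> borel_measurable \<nu>" if "C \<in> sets (borel_on X)" for C
    using measurable_compose[OF \<kappa> measurable_emeasure_subprob_algebra[OF that]] .
  have sub: "subprob_space (\<kappa> y)" if "y \<in> space \<nu>" for y
    using measurable_space[OF \<kappa> that] by (simp add: space_subprob_algebra)
  have nn: "(\<integral>\<^sup>+y. emeasure (\<kappa> y) C * indicator B y \<partial>\<nu>) = emeasure \<mu> (C \<inter> \<pi> -` B)"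
    if C: "C \<in> sets (borel_on X)" and B: "B \<in> sets (borel_on Y)" for C B
  proof -
    define M1 where "M1 = density \<nu> (indicator B) \<bind> \<kappa>"
    define M2 where "M2 = density \<mu> (indicator (\<pi> -` B \<inter> X))"
    have \<kappa>': "\<kappa> \<in> density \<nu> (indicator B) \<rightarrow>\<^sub>M subprob_algebra (borel_on X)" using \<kappa> by simp
    have ne: "space (density \<nu> (indicator B)) \<noteq> {}" using base.not_empty by simp
    have e1: "emeasure M1 C = (\<integral>\<^sup>+y. emeasure (\<kappa> y) C * indicator B y \<partial>\<nu>)" if "C \<in> sets (borel_on X)" for C
    proof -
      have "emeasure M1 C = (\<integral>\<^sup>+y. emeasure (\<kappa> y) C \<partial>density \<nu> (indicator B))"
        unfolding M1_def by (rule emeasure_bind[OF ne \<kappa>' that])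
      also have "\<dots> = (\<integral>\<^sup>+y. indicator B y * emeasure (\<kappa> y) C \<partial>\<nu>)"
        using B s\<nu> me[OF that] by (intro nn_integral_density) auto
      finally show ?thesis by (simp add: mult.commute)
    qed
    have e2: "emeasure M2 C = emeasure \<mu> (C \<inter> \<pi> -` B)" if C: "C \<in> sets (borel_on X)" for C
    proof -
      have "emeasure M2 C = emeasure \<mu> ((\<pi> -` B \<inter> X) \<inter> C)"
        unfolding M2_def using preimage_sets[OF B] C invariant_fibreD(2)[OF \<mu>]
        by (subst emeasure_density) (auto simp flip: indicator_inter_arith)
      also have "(\<pi> -` B \<inter> X) \<inter> C = C \<inter> \<pi> -` B" using sets.sets_into_space[OF C] by auto
      finally show ?thesis .
    qed
    have sM1: "sets M1 = sets (borel_on X)"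
      unfolding M1_def using ne \<kappa> by (intro sets_bind) (auto dest: measurable_space simp: space_subprob_algebra)
    have "M2 = M1"
    proof (rule measure_eqI_cylinders[of _ X])
      show "sets M2 = sets (borel_on X)" by (simp add: M2_def invariant_fibreD(2)[OF \<mu>])
      then have "space M2 = X" using sets_eq_imp_space_eq[of M2 "borel_on X"] by simp
      then show "finite_measure M2"
        using e2[of X] sets.top[of "borel_on X"] by (intro finite_measureI) (simp add: emeasure_eq_measure)
      fix C assume C: "C \<in> cylinders X"
      then have CS: "C \<in> sets (borel_on X)" by (rule cylinder_sets)
      have "emeasure M1 C = (\<integral>\<^sup>+y. ennreal (indicator B y * cond_mass \<mu> C y) \<partial>\<nu>)"
        unfolding e1[OF CS] 
      proof (rule nn_integral_cong_AE)
        show "AE y in \<nu>. emeasure (\<kappa> y) C * indicator B y = ennreal (indicator B y * cond_mass \<mu> C y)"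
          using cyl[OF C] by eventually_elim (simp add: indicator_def)
      qed
      also have "\<dots> = ennreal (\<integral>y\<in>B. cond_mass \<mu> C y \<partial>\<nu>)"
        unfolding set_lebesgue_integral_def real_scaleR_def
      proof (rule nn_integral_eq_integral)
        show "integrable \<nu> (\<lambda>y. indicator B y * cond_mass \<mu> C y)"
          using set_integrable_cond_mass[OF CS B] by (simp add: set_integrable_def)
        show "AE y in \<nu>. 0 \<le> indicator B y * cond_mass \<mu> C y"
          using cond_mass_bounds[OF CS] by eventually_elim simp
      qed
      also have "\<dots> = emeasure M2 C"
        unfolding set_integral_cond_mass[OF CS B] e2[OF CS] by (simp add: emeasure_eq_measure)
      finally show "emeasure M2 C = emeasure M1 C" ..
    qed (rule sM1)
    then show ?thesis using e1[OF C] e2[OF C] by simp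
  qed
  have "AE y in \<nu>. emeasure (\<kappa> y) C = ennreal (cond_mass \<mu> C y)" if C: "C \<in> sets (borel_on X)" for C
  proof -
    have mm: "(\<lambda>y. measure (\<kappa> y) C) \<in> borel_measurable \<nu>" unfolding measure_def using me[OF C] by measurable
    have em: "emeasure (\<kappa> y) C = ennreal (measure (\<kappa> y) C)" if "y \<in> space \<nu>" for y
      using finite_measure.emeasure_eq_measure[OF subprob_space.axioms(1)[OF sub[OF that]]] .
    have le1: "measure (\<kappa> y) C \<le> 1" if "y \<in> space \<nu>" for y
      using subprob_space.subprob_measure_le_1[OF sub[OF that]] .
    have int: "integrable \<nu> (\<lambda>y. measure (\<kappa> y) C)"
      using le1 mm by (intro base.integrable_const_bound[of _ 1]) auto
    have "AE y in \<nu>. measure (\<kappa> y) C = cond_mass \<mu> C y"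
    proof (rule cond_mass_unique[OF C int])
      fix B assume B: "B \<in> sets (borel_on Y)"
      then have BS: "B \<in> sets \<nu>" using s\<nu> by simp
      have "ennreal (\<integral>y\<in>B. measure (\<kappa> y) C \<partial>\<nu>) = (\<integral>\<^sup>+y. ennreal (indicator B y * measure (\<kappa> y) C) \<partial>\<nu>)"
        unfolding set_lebesgue_integral_def real_scaleR_def
        using integrable_mult_indicator[OF BS int] by (intro nn_integral_eq_integral[symmetric]) auto
      also have "\<dots> = (\<integral>\<^sup>+y. emeasure (\<kappa> y) C * indicator B y \<partial>\<nu>)"
        by (intro nn_integral_cong) (simp add: em indicator_def)
      also have "\<dots> = ennreal (measure \<mu> (C \<inter> \<pi> -` B))" unfolding nn[OF C B] by (rule emeasure_eq_measure)
      finally have "ennreal (\<integral>y\<in>B. measure (\<kappa> y) C \<partial>\<nu>) = ennreal (measure \<mu> (C \<inter> \<pi> -` B))" .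
      moreover have "0 \<le> (\<integral>y\<in>B. measure (\<kappa> y) C \<partial>\<nu>)"
        unfolding set_lebesgue_integral_def by (intro Bochner_Integration.integral_nonneg) simp
      ultimately show "(\<integral>y\<in>B. measure (\<kappa> y) C \<partial>\<nu>) = measure \<mu> (C \<inter> \<pi> -` B)" by simp
    qed
    then show ?thesis using AE_space by eventually_elim (simp add: em)
  qed
  then show ?thesis using \<kappa> by blast
qed

text \<open>
  The function \<open>y \<mapsto> cond_mass \<mu> C (\<psi> y)\<close> has the integrals that characterize the left-hand side. The
  inverse \<open>\<psi>'\<close> serves to write a set \<open>B\<close> as a preimage under \<open>\<psi>\<close>.
\<close>

lemma cond_mass_equivariant:
  assumes \<theta>: "\<theta> \<in> borel_on X \<rightarrow>\<^sub>M borel_on X" "distr \<mu> \<mu> \<theta> = \<mu>"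
    and \<psi>: "\<psi> \<in> \<nu> \<rightarrow>\<^sub>M \<nu>" "distr \<nu> \<nu> \<psi> = \<nu>" and \<psi>': "\<psi>' \<in> \<nu> \<rightarrow>\<^sub>M \<nu>" "\<And>y. y \<in> Y \<Longrightarrow> \<psi>' (\<psi> y) = y"
    and eq: "\<And>x. x \<in> X \<Longrightarrow> \<pi> (\<theta> x) = \<psi> (\<pi> x)"
    and C: "C \<in> sets (borel_on X)"
  shows "AE y in \<nu>. cond_mass \<mu> (\<theta> -` C \<inter> X) y = cond_mass \<mu> C (\<psi> y)"
proof -
  have s\<nu>: "sets \<nu> = sets (borel_on Y)" and sp\<nu>: "space \<nu> = Y" by (rule invariant_fibreD[OF \<mu>])+
  have TC: "\<theta> -` C \<inter> X \<in> sets (borel_on X)" using measurable_sets[OF \<theta>(1) C] by simp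
  have \<theta>m: "\<theta> \<in> \<mu> \<rightarrow>\<^sub>M \<mu>" using \<theta>(1) invariant_fibreD(2)[OF \<mu>] by (simp cong: measurable_cong_sets)
  have "AE y in \<nu>. cond_mass \<mu> C (\<psi> y) = cond_mass \<mu> (\<theta> -` C \<inter> X) y"
  proof (rule cond_mass_unique[OF TC])
    show "integrable \<nu> (\<lambda>y. cond_mass \<mu> C (\<psi> y))"
      using integrable_distr[OF \<psi>(1), of "cond_mass \<mu> C"] integrable_cond_mass[OF C] \<psi>(2) by simp
    fix B assume B: "B \<in> sets (borel_on Y)"
    define B' where "B' = \<psi>' -` B \<inter> Y"
    have B': "B' \<in> sets (borel_on Y)" using measurable_sets[OF \<psi>'(1), of B] B s\<nu> sp\<nu> by (simp add: B'_def)
    have \<psi>Y: "\<psi> y \<in> Y" if "y \<in> Y" for y using measurable_space[OF \<psi>(1)] that sp\<nu> by auto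
    have "(\<integral>y\<in>B. cond_mass \<mu> C (\<psi> y) \<partial>\<nu>) = (\<integral>y. indicator B' (\<psi> y) * cond_mass \<mu> C (\<psi> y) \<partial>\<nu>)"
      unfolding set_lebesgue_integral_def
      by (intro Bochner_Integration.integral_cong refl) (auto simp: sp\<nu> B'_def \<psi>Y \<psi>'(2) indicator_def)
    also have "\<dots> = (\<integral>y. indicator B' y * cond_mass \<mu> C y \<partial>distr \<nu> \<nu> \<psi>)"
      using B' s\<nu> borel_measurable_cond_mass' by (intro integral_distr[symmetric] \<psi>(1)) auto
    also have "\<dots> = (\<integral>y\<in>B'. cond_mass \<mu> C y \<partial>\<nu>)" by (simp add: \<psi>(2) set_lebesgue_integral_def)
    also have "\<dots> = measure (distr \<mu> \<mu> \<theta>) (C \<inter> \<pi> -` B')"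
      unfolding set_integral_cond_mass[OF C B'] \<theta>(2) ..
    also have "\<dots> = measure \<mu> (\<theta> -` (C \<inter> \<pi> -` B') \<inter> space \<mu>)"
      by (rule measure_distr[OF \<theta>m preimage_Int_sets[OF C B']])
    also have "\<theta> -` (C \<inter> \<pi> -` B') \<inter> space \<mu> = (\<theta> -` C \<inter> X) \<inter> \<pi> -` B"
      using code_in_Y by (auto simp: invariant_fibreD(3)[OF \<mu>] B'_def eq \<psi>'(2) \<psi>Y)
    finally show "(\<integral>y\<in>B. cond_mass \<mu> C (\<psi> y) \<partial>\<nu>) = measure \<mu> ((\<theta> -` C \<inter> X) \<inter> \<pi> -` B)" .
  qed
  then show ?thesis by eventually_elim simp
qed

end

end

context sliding_block_code
begin

abbreviation pair_space :: "((int \<Rightarrow> 'a) \<times> (int \<Rightarrow> 'a)) measure" where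
  "pair_space \<equiv> borel_on X \<Otimes>\<^sub>M borel_on X"

lemma space_pair_space: "space pair_space = X \<times> X"
  by (simp add: space_pair_measure)

lemma X_borel: "X \<in> sets (borel_on X)"
  using sets.top[of "borel_on X"] by simp

lemma measure_eqI_rectangles:
  assumes M: "sets M = sets pair_space" "sets N = sets pair_space" and fin: "emeasure M (X \<times> X) \<noteq> \<infinity>"
    and eq: "\<And>B C. B \<in> sets (borel_on X) \<Longrightarrow> C \<in> sets (borel_on X) \<Longrightarrow> emeasure M (B \<times> C) = emeasure N (B \<times> C)"
  shows "M = N"
proof (rule measure_eqI_generator_eq[of "{B \<times> C | B C. B \<in> sets (borel_on X) \<and> C \<in> sets (borel_on X)}" "X \<times> X" _ _ "\<lambda>_. X \<times> X"])
  show "Int_stable {B \<times> C | B C. B \<in> sets (borel_on X) \<and> C \<in> sets (borel_on X)}"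
    by (rule Int_stable_pair_measure_generator)
  show "{B \<times> C | B C. B \<in> sets (borel_on X) \<and> C \<in> sets (borel_on X)} \<subseteq> Pow (X \<times> X)"
    using sets.sets_into_space[of _ "borel_on X"] by fastforce
  show "sets M = sigma_sets (X \<times> X) {B \<times> C | B C. B \<in> sets (borel_on X) \<and> C \<in> sets (borel_on X)}"
    "sets N = sigma_sets (X \<times> X) {B \<times> C | B C. B \<in> sets (borel_on X) \<and> C \<in> sets (borel_on X)}"
    using M by (simp_all add: sets_pair_measure)
  show "range (\<lambda>_. X \<times> X) \<subseteq> {B \<times> C | B C. B \<in> sets (borel_on X) \<and> C \<in> sets (borel_on X)}"
    using sets.top[of "borel_on X"] by auto
qed (use fin eq in auto)

context
  fixes \<mu>\<^sub>1 \<mu>\<^sub>2 :: "(int \<Rightarrow> 'a) measure" and \<nu> :: "(int \<Rightarrow> 'b) measure"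
  assumes \<mu>1: "\<mu>\<^sub>1 \<in> invariant_fibre X Y \<pi> \<nu>" and \<mu>2: "\<mu>\<^sub>2 \<in> invariant_fibre X Y \<pi> \<nu>"
begin

interpretation base: prob_space \<nu> by (rule invariant_fibreD(8)[OF \<mu>1])

abbreviation joining where "joining \<equiv> relatively_independent_joining X Y \<pi> \<nu> \<mu>\<^sub>1 \<mu>\<^sub>2"

text \<open>
  The joining mixes, over \<open>\<nu>\<close>, the products of the two conditional measures.
\<close>

lemma joining_exists:
  "\<exists>\<Lambda>. sets \<Lambda> = sets pair_space \<and> (\<forall>B\<in>sets (borel_on X). \<forall>C\<in>sets (borel_on X).
     emeasure \<Lambda> (B \<times> C) = ennreal (\<integral>y. cond_mass \<mu>\<^sub>1 B y * cond_mass \<mu>\<^sub>2 C y \<partial>\<nu>))"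
proof -
  obtain \<kappa>\<^sub>1 where \<kappa>1: "\<kappa>\<^sub>1 \<in> \<nu> \<rightarrow>\<^sub>M subprob_algebra (borel_on X)"
    "\<forall>C\<in>sets (borel_on X). AE y in \<nu>. emeasure (\<kappa>\<^sub>1 y) C = ennreal (cond_mass \<mu>\<^sub>1 C y)" using disintegration[OF \<mu>1] by blast
  obtain \<kappa>\<^sub>2 where \<kappa>2: "\<kappa>\<^sub>2 \<in> \<nu> \<rightarrow>\<^sub>M subprob_algebra (borel_on X)"
    "\<forall>C\<in>sets (borel_on X). AE y in \<nu>. emeasure (\<kappa>\<^sub>2 y) C = ennreal (cond_mass \<mu>\<^sub>2 C y)" using disintegration[OF \<mu>2] by blast
  define \<Lambda> where "\<Lambda> = \<nu> \<bind> (\<lambda>y. \<kappa>\<^sub>1 y \<Otimes>\<^sub>M \<kappa>\<^sub>2 y)"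
  have k: "(\<lambda>y. \<kappa>\<^sub>1 y \<Otimes>\<^sub>M \<kappa>\<^sub>2 y) \<in> \<nu> \<rightarrow>\<^sub>M subprob_algebra pair_space"
    by (rule measurable_pair_measure[OF \<kappa>1(1) \<kappa>2(1)])
  have "sets \<Lambda> = sets pair_space"
    unfolding \<Lambda>_def using base.not_empty measurable_space[OF k] by (intro sets_bind) (auto simp: space_subprob_algebra)
  moreover have "emeasure \<Lambda> (B \<times> C) = ennreal (\<integral>y. cond_mass \<mu>\<^sub>1 B y * cond_mass \<mu>\<^sub>2 C y \<partial>\<nu>)"
    if B: "B \<in> sets (borel_on X)" and C: "C \<in> sets (borel_on X)" for B C
  proof -
    have "emeasure \<Lambda> (B \<times> C) = (\<integral>\<^sup>+y. emeasure (\<kappa>\<^sub>1 y \<Otimes>\<^sub>M \<kappa>\<^sub>2 y) (B \<times> C) \<partial>\<nu>)"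
      unfolding \<Lambda>_def using B C by (intro emeasure_bind[OF base.not_empty k]) auto
    also have "\<dots> = (\<integral>\<^sup>+y. ennreal (cond_mass \<mu>\<^sub>1 B y * cond_mass \<mu>\<^sub>2 C y) \<partial>\<nu>)"
    proof (rule nn_integral_cong_AE)
      show "AE y in \<nu>. emeasure (\<kappa>\<^sub>1 y \<Otimes>\<^sub>M \<kappa>\<^sub>2 y) (B \<times> C) = ennreal (cond_mass \<mu>\<^sub>1 B y * cond_mass \<mu>\<^sub>2 C y)"
        using \<kappa>1(2)[rule_format, OF B] \<kappa>2(2)[rule_format, OF C] cond_mass_bounds[OF \<mu>1 B] cond_mass_bounds[OF \<mu>2 C] AE_space
      proof eventually_elim
        case (elim y)
        have s: "subprob_space (\<kappa>\<^sub>2 y)" "sets (\<kappa>\<^sub>1 y) = sets (borel_on X)" "sets (\<kappa>\<^sub>2 y) = sets (borel_on X)"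
          using measurable_space[OF \<kappa>1(1) elim(5)] measurable_space[OF \<kappa>2(1) elim(5)] by (auto simp: space_subprob_algebra)
        interpret sf: subprob_space "\<kappa>\<^sub>2 y" by (rule s(1))
        have "emeasure (\<kappa>\<^sub>1 y \<Otimes>\<^sub>M \<kappa>\<^sub>2 y) (B \<times> C) = emeasure (\<kappa>\<^sub>1 y) B * emeasure (\<kappa>\<^sub>2 y) C"
          using B C s by (intro sf.emeasure_pair_measure_Times) auto
        then show ?case using elim by (simp add: ennreal_mult)
      qed
    qed
    also have "\<dots> = ennreal (\<integral>y. cond_mass \<mu>\<^sub>1 B y * cond_mass \<mu>\<^sub>2 C y \<partial>\<nu>)"
    proof (rule nn_integral_eq_integral)
      show "AE y in \<nu>. 0 \<le> cond_mass \<mu>\<^sub>1 B y * cond_mass \<mu>\<^sub>2 C y"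
        using cond_mass_bounds[OF \<mu>1 B] cond_mass_bounds[OF \<mu>2 C] by eventually_elim simp
      show "integrable \<nu> (\<lambda>y. cond_mass \<mu>\<^sub>1 B y * cond_mass \<mu>\<^sub>2 C y)"
      proof (rule base.integrable_const_bound[of _ 1])
        show "AE y in \<nu>. norm (cond_mass \<mu>\<^sub>1 B y * cond_mass \<mu>\<^sub>2 C y) \<le> 1"
          using cond_mass_bounds[OF \<mu>1 B] cond_mass_bounds[OF \<mu>2 C] by eventually_elim (simp add: mult_le_one)
      qed (intro borel_measurable_times borel_measurable_cond_mass' \<mu>1 \<mu>2)
    qed
    finally show ?thesis .
  qed
  ultimately show ?thesis by blast
qed

lemma joining_spec:
  "sets joining = sets pair_space"
  "B \<in> sets (borel_on X) \<Longrightarrow> C \<in> sets (borel_on X) \<Longrightarrow>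
     emeasure joining (B \<times> C) = ennreal (\<integral>y. cond_mass \<mu>\<^sub>1 B y * cond_mass \<mu>\<^sub>2 C y \<partial>\<nu>)"
proof -
  have "\<exists>!\<Lambda>. sets \<Lambda> = sets pair_space \<and> (\<forall>B\<in>sets (borel_on X). \<forall>C\<in>sets (borel_on X).
     emeasure \<Lambda> (B \<times> C) = ennreal (\<integral>y. cond_mass \<mu>\<^sub>1 B y * cond_mass \<mu>\<^sub>2 C y \<partial>\<nu>))"
  proof (rule ex_ex1I[OF joining_exists], elim conjE)
    fix M N
    assume M: "sets M = sets pair_space" "sets N = sets pair_space"
      "\<forall>B\<in>sets (borel_on X). \<forall>C\<in>sets (borel_on X). emeasure M (B \<times> C) = ennreal (\<integral>y. cond_mass \<mu>\<^sub>1 B y * cond_mass \<mu>\<^sub>2 C y \<partial>\<nu>)"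
      "\<forall>B\<in>sets (borel_on X). \<forall>C\<in>sets (borel_on X). emeasure N (B \<times> C) = ennreal (\<integral>y. cond_mass \<mu>\<^sub>1 B y * cond_mass \<mu>\<^sub>2 C y \<partial>\<nu>)"
    have "X \<in> sets (borel_on X)" using sets.top[of "borel_on X"] by simp
    then have "emeasure M (X \<times> X) \<noteq> \<infinity>" using M(3) by simp
    then show "M = N" using M by (intro measure_eqI_rectangles) simp_all
  qed
  from theI'[OF this] show "sets joining = sets pair_space"
    "B \<in> sets (borel_on X) \<Longrightarrow> C \<in> sets (borel_on X) \<Longrightarrow>
     emeasure joining (B \<times> C) = ennreal (\<integral>y. cond_mass \<mu>\<^sub>1 B y * cond_mass \<mu>\<^sub>2 C y \<partial>\<nu>)"
    unfolding relatively_independent_joining_def by blast+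
qed

lemma space_joining: "space joining = X \<times> X"
  using sets_eq_imp_space_eq[OF joining_spec(1)] space_pair_space by simp

lemma joining_fst:
  assumes B: "B \<in> sets (borel_on X)" shows "emeasure joining (B \<times> X) = emeasure \<mu>\<^sub>1 B"
proof -
  interpret prob_space \<mu>\<^sub>1 by (rule invariant_fibreD(1)[OF \<mu>1])
  have "(\<integral>y. cond_mass \<mu>\<^sub>1 B y * cond_mass \<mu>\<^sub>2 X y \<partial>\<nu>) = (\<integral>y. cond_mass \<mu>\<^sub>1 B y \<partial>\<nu>)"
  proof (rule integral_cong_AE)
    show "AE y in \<nu>. cond_mass \<mu>\<^sub>1 B y * cond_mass \<mu>\<^sub>2 X y = cond_mass \<mu>\<^sub>1 B y"
      using cond_mass_space[OF \<mu>2] by eventually_elim simp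
  qed (intro borel_measurable_times borel_measurable_cond_mass' \<mu>1 \<mu>2)+
  then show ?thesis using joining_spec(2)[OF B X_borel] integral_cond_mass[OF \<mu>1 B] by (simp add: emeasure_eq_measure)
qed

lemma joining_snd:
  assumes B: "B \<in> sets (borel_on X)" shows "emeasure joining (X \<times> B) = emeasure \<mu>\<^sub>2 B"
proof -
  interpret prob_space \<mu>\<^sub>2 by (rule invariant_fibreD(1)[OF \<mu>2])
  have "(\<integral>y. cond_mass \<mu>\<^sub>1 X y * cond_mass \<mu>\<^sub>2 B y \<partial>\<nu>) = (\<integral>y. cond_mass \<mu>\<^sub>2 B y \<partial>\<nu>)"
  proof (rule integral_cong_AE)
    show "AE y in \<nu>. cond_mass \<mu>\<^sub>1 X y * cond_mass \<mu>\<^sub>2 B y = cond_mass \<mu>\<^sub>2 B y"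
      using cond_mass_space[OF \<mu>1] by eventually_elim simp
  qed (intro borel_measurable_times borel_measurable_cond_mass' \<mu>1 \<mu>2)+
  then show ?thesis using joining_spec(2)[OF X_borel B] integral_cond_mass[OF \<mu>2 B] by (simp add: emeasure_eq_measure)
qed

lemma prob_space_joining: "prob_space joining"
proof
  interpret prob_space \<mu>\<^sub>1 by (rule invariant_fibreD(1)[OF \<mu>1])
  show "emeasure joining (space joining) = 1"
    using joining_fst[OF X_borel] emeasure_space_1 by (simp add: space_joining invariant_fibreD(3)[OF \<mu>1])
qed

text \<open>
  Both conditional masses are transported by the same map \<open>\<psi>\<close>, which preserves \<open>\<nu>\<close>.
\<close>

lemma joining_invariant:
  assumes \<theta>1: "\<theta>\<^sub>1 \<in> borel_on X \<rightarrow>\<^sub>M borel_on X" "distr \<mu>\<^sub>1 \<mu>\<^sub>1 \<theta>\<^sub>1 = \<mu>\<^sub>1" "\<And>x. x \<in> X \<Longrightarrow> \<pi> (\<theta>\<^sub>1 x) = \<psi> (\<pi> x)"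
    and \<theta>2: "\<theta>\<^sub>2 \<in> borel_on X \<rightarrow>\<^sub>M borel_on X" "distr \<mu>\<^sub>2 \<mu>\<^sub>2 \<theta>\<^sub>2 = \<mu>\<^sub>2" "\<And>x. x \<in> X \<Longrightarrow> \<pi> (\<theta>\<^sub>2 x) = \<psi> (\<pi> x)"
    and \<psi>: "\<psi> \<in> \<nu> \<rightarrow>\<^sub>M \<nu>" "distr \<nu> \<nu> \<psi> = \<nu>" and \<psi>': "\<psi>' \<in> \<nu> \<rightarrow>\<^sub>M \<nu>" "\<And>y. y \<in> Y \<Longrightarrow> \<psi>' (\<psi> y) = y"
    and D: "D \<in> sets pair_space"
  shows "emeasure joining {p \<in> X \<times> X. (\<theta>\<^sub>1 (fst p), \<theta>\<^sub>2 (snd p)) \<in> D} = emeasure joining D"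
    "{p \<in> X \<times> X. (\<theta>\<^sub>1 (fst p), \<theta>\<^sub>2 (snd p)) \<in> D} \<in> sets joining"
proof -
  interpret prob_space joining by (rule prob_space_joining)
  let ?f = "\<lambda>p. (\<theta>\<^sub>1 (fst p), \<theta>\<^sub>2 (snd p))"
  have f: "?f \<in> pair_space \<rightarrow>\<^sub>M pair_space" using \<theta>1(1) \<theta>2(1) by measurable
  have fj: "?f \<in> joining \<rightarrow>\<^sub>M pair_space" using f joining_spec(1) by (simp cong: measurable_cong_sets)
  have "distr joining pair_space ?f = joining"
  proof (rule measure_eqI_rectangles)
    show "emeasure (distr joining pair_space ?f) (X \<times> X) \<noteq> \<infinity>"
      using emeasure_distr[OF fj, of "X \<times> X"] X_borel by (simp add: emeasure_eq_measure)
    fix B C assume B: "B \<in> sets (borel_on X)" and C: "C \<in> sets (borel_on X)"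
    have TB: "\<theta>\<^sub>1 -` B \<inter> X \<in> sets (borel_on X)" using measurable_sets[OF \<theta>1(1) B] by simp
    have TC: "\<theta>\<^sub>2 -` C \<inter> X \<in> sets (borel_on X)" using measurable_sets[OF \<theta>2(1) C] by simp
    have "emeasure (distr joining pair_space ?f) (B \<times> C) = emeasure joining (?f -` (B \<times> C) \<inter> space joining)"
      using B C by (intro emeasure_distr[OF fj]) auto
    also have "?f -` (B \<times> C) \<inter> space joining = (\<theta>\<^sub>1 -` B \<inter> X) \<times> (\<theta>\<^sub>2 -` C \<inter> X)" by (auto simp: space_joining)
    also have "emeasure joining \<dots> = ennreal (\<integral>y. cond_mass \<mu>\<^sub>1 (\<theta>\<^sub>1 -` B \<inter> X) y * cond_mass \<mu>\<^sub>2 (\<theta>\<^sub>2 -` C \<inter> X) y \<partial>\<nu>)"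
      by (rule joining_spec(2)[OF TB TC])
    also have "(\<integral>y. cond_mass \<mu>\<^sub>1 (\<theta>\<^sub>1 -` B \<inter> X) y * cond_mass \<mu>\<^sub>2 (\<theta>\<^sub>2 -` C \<inter> X) y \<partial>\<nu>) = (\<integral>y. cond_mass \<mu>\<^sub>1 B (\<psi> y) * cond_mass \<mu>\<^sub>2 C (\<psi> y) \<partial>\<nu>)"
    proof (rule integral_cong_AE)
      have "AE y in \<nu>. cond_mass \<mu>\<^sub>1 (\<theta>\<^sub>1 -` B \<inter> X) y = cond_mass \<mu>\<^sub>1 B (\<psi> y)"
        by (rule cond_mass_equivariant[OF \<mu>1 \<theta>1(1,2) \<psi> \<psi>' \<theta>1(3) B])
      moreover have "AE y in \<nu>. cond_mass \<mu>\<^sub>2 (\<theta>\<^sub>2 -` C \<inter> X) y = cond_mass \<mu>\<^sub>2 C (\<psi> y)"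
        by (rule cond_mass_equivariant[OF \<mu>2 \<theta>2(1,2) \<psi> \<psi>' \<theta>2(3) C])
      ultimately show "AE y in \<nu>. cond_mass \<mu>\<^sub>1 (\<theta>\<^sub>1 -` B \<inter> X) y * cond_mass \<mu>\<^sub>2 (\<theta>\<^sub>2 -` C \<inter> X) y = cond_mass \<mu>\<^sub>1 B (\<psi> y) * cond_mass \<mu>\<^sub>2 C (\<psi> y)"
        by eventually_elim simp
    qed (intro borel_measurable_times borel_measurable_cond_mass' \<mu>1 \<mu>2 measurable_compose[OF \<psi>(1)])+
    also have "\<dots> = (\<integral>y. cond_mass \<mu>\<^sub>1 B y * cond_mass \<mu>\<^sub>2 C y \<partial>distr \<nu> \<nu> \<psi>)"
      by (intro integral_distr[symmetric] \<psi>(1) borel_measurable_times borel_measurable_cond_mass' \<mu>1 \<mu>2)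
    also have "ennreal \<dots> = emeasure joining (B \<times> C)" by (simp only: \<psi>(2) joining_spec(2)[OF B C])
    finally show "emeasure (distr joining pair_space ?f) (B \<times> C) = emeasure joining (B \<times> C)" .
  qed (simp_all add: joining_spec(1))
  moreover have "emeasure (distr joining pair_space ?f) D = emeasure joining (?f -` D \<inter> space joining)"
    by (rule emeasure_distr[OF fj D])
  moreover have pre: "?f -` D \<inter> space joining = {p \<in> X \<times> X. ?f p \<in> D}" by (auto simp: space_joining)
  ultimately show "emeasure joining {p \<in> X \<times> X. ?f p \<in> D} = emeasure joining D" by simp
  show "{p \<in> X \<times> X. ?f p \<in> D} \<in> sets joining" using measurable_sets[OF fj D] pre by simp
qed

lemma joining_translate:
  assumes D: "D \<in> sets pair_space"
  shows "emeasure joining {p \<in> X \<times> X. (translate k (fst p), translate k (snd p)) \<in> D} = emeasure joining D"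
proof (rule joining_invariant(1)[OF measurable_translate _ code_translate measurable_translate _ code_translate _ _ _ _ D])
  have s\<nu>: "sets \<nu> = sets (borel_on Y)" by (rule invariant_fibreD(6)[OF \<mu>1])
  have m: "translate k \<in> \<nu> \<rightarrow>\<^sub>M \<nu>" for k using measurable_translate_Y s\<nu> by (simp cong: measurable_cong_sets)
  show "translate k \<in> \<nu> \<rightarrow>\<^sub>M \<nu>" "translate (- k) \<in> \<nu> \<rightarrow>\<^sub>M \<nu>" by (rule m)+
  show "distr \<mu>\<^sub>1 \<mu>\<^sub>1 (translate k) = \<mu>\<^sub>1" "distr \<mu>\<^sub>2 \<mu>\<^sub>2 (translate k) = \<mu>\<^sub>2"
    by (rule distr_translate invariant_fibreD(5)[OF \<mu>1] invariant_fibreD(5)[OF \<mu>2])+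
  show "translate (- k) (translate k y) = y" for y :: "int \<Rightarrow> 'b" by simp
  show "distr \<nu> \<nu> (translate k) = \<nu>"
  proof -
    note mt = measurable_translate_invariant[OF invariant_fibreD(5)[OF \<mu>1]]
    have "distr \<nu> \<nu> (translate k) = distr (distr \<mu>\<^sub>1 (borel_on Y) \<pi>) (borel_on Y) (translate k)"
      unfolding invariant_fibreD(4)[OF \<mu>1] by (rule distr_cong) (auto simp: s\<nu>)
    also have "\<dots> = distr \<mu>\<^sub>1 (borel_on Y) (translate k \<circ> \<pi>)"
      by (rule distr_distr[OF measurable_translate_Y code_measurable_on[OF \<mu>1]])
    also have "\<dots> = distr \<mu>\<^sub>1 (borel_on Y) (\<pi> \<circ> translate k)"
      by (rule distr_cong) (auto simp: code_translate invariant_fibreD(3)[OF \<mu>1])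
    also have "\<dots> = distr (distr \<mu>\<^sub>1 \<mu>\<^sub>1 (translate k)) (borel_on Y) \<pi>"
      by (rule distr_distr[OF code_measurable_on[OF \<mu>1] mt, symmetric])
    also have "\<dots> = \<nu>" unfolding distr_translate[OF invariant_fibreD(5)[OF \<mu>1]] by (rule invariant_fibreD(4)[OF \<mu>1])
    finally show ?thesis .
  qed
qed

lemma joining_over_identity:
  assumes \<theta>1: "\<theta>\<^sub>1 \<in> borel_on X \<rightarrow>\<^sub>M borel_on X" "distr \<mu>\<^sub>1 \<mu>\<^sub>1 \<theta>\<^sub>1 = \<mu>\<^sub>1" "\<And>x. x \<in> X \<Longrightarrow> \<pi> (\<theta>\<^sub>1 x) = \<pi> x"
    and \<theta>2: "\<theta>\<^sub>2 \<in> borel_on X \<rightarrow>\<^sub>M borel_on X" "distr \<mu>\<^sub>2 \<mu>\<^sub>2 \<theta>\<^sub>2 = \<mu>\<^sub>2" "\<And>x. x \<in> X \<Longrightarrow> \<pi> (\<theta>\<^sub>2 x) = \<pi> x"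
    and D: "D \<in> sets pair_space"
  shows "emeasure joining {p \<in> X \<times> X. (\<theta>\<^sub>1 (fst p), \<theta>\<^sub>2 (snd p)) \<in> D} = emeasure joining D"
    "{p \<in> X \<times> X. (\<theta>\<^sub>1 (fst p), \<theta>\<^sub>2 (snd p)) \<in> D} \<in> sets joining"
  using joining_invariant[OF \<theta>1(1,2) _ \<theta>2(1,2) _ _ _ _ _ D, of "\<lambda>y. y" "\<lambda>y. y"] \<theta>1(3) \<theta>2(3) distr_id2[of \<nu> \<nu>] by auto

end

end

section \<open>Invariant measures dominated by an ergodic measure\<close>

text \<open>
  The set of points that visit \<open>A\<close> infinitely often is strictly invariant and differs from \<open>A\<close> by a
  null set.
\<close>

lemma ergodic_almost_invariant:
  assumes erg: "ergodic_measure X \<mu>" and S: "shift \<in> \<mu> \<rightarrow>\<^sub>M \<mu>" and A: "A \<in> sets \<mu>"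
    and almost: "AE x in \<mu>. x \<in> A \<longleftrightarrow> shift x \<in> A"
  shows "measure \<mu> A = 0 \<or> measure \<mu> A = 1"
proof -
  have inv: "invariant_measure X \<mu>" using erg by (simp add: ergodic_measure_def)
  interpret prob_space \<mu> by (rule invariant_measureD(1)[OF inv])
  have dS: "distr \<mu> \<mu> shift = \<mu>" by (rule invariant_measureD(3)[OF inv])
  have Sn: "shift ^^ n \<in> \<mu> \<rightarrow>\<^sub>M \<mu>" for n
    using S by (induction n) (auto simp: id_def[symmetric] intro: measurable_comp)
  have shift_space: "shift x \<in> space \<mu>" if "x \<in> space \<mu>" for x using measurable_space[OF S that] .
  have step: "AE x in \<mu>. (shift ^^ n) x \<in> A \<longleftrightarrow> x \<in> A" for n
  proof (induction n)
    case (Suc n)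
    have "AE x in distr \<mu> \<mu> shift. (shift ^^ n) x \<in> A \<longleftrightarrow> x \<in> A" unfolding dS by (rule Suc)
    then have "AE x in \<mu>. (shift ^^ n) (shift x) \<in> A \<longleftrightarrow> shift x \<in> A" by (rule AE_distrD[OF S])
    then show ?case using almost by eventually_elim (simp add: funpow_swap1)
  qed simp
  define B where "B = {x \<in> space \<mu>. \<forall>n. \<exists>k\<ge>n. (shift ^^ k) x \<in> A}"
  have SA: "{x \<in> space \<mu>. (shift ^^ k) x \<in> A} \<in> sets \<mu>" for k
    using measurable_sets[OF Sn A, of k] by (simp add: vimage_def Int_def conj_commute)
  have BS: "B \<in> sets \<mu>"
  proof -
    have "B = (\<Inter>n. \<Union>k\<in>{n..}. {x \<in> space \<mu>. (shift ^^ k) x \<in> A})" unfolding B_def by auto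
    then show ?thesis using SA by (auto intro!: sets.countable_INT sets.countable_UN)
  qed
  have "AE x in \<mu>. \<forall>n. (shift ^^ n) x \<in> A \<longleftrightarrow> x \<in> A" using step by (simp add: AE_all_countable)
  then have "AE x in \<mu>. x \<in> B \<longleftrightarrow> x \<in> A" using AE_space by eventually_elim (auto simp: B_def)
  then have eq: "measure \<mu> B = measure \<mu> A" by (rule measure_eq_AE[OF _ BS A])
  have "shift -` B \<inter> space \<mu> = B"
  proof -
    have "(\<forall>n. \<exists>k\<ge>n. (shift ^^ k) (shift x) \<in> A) \<longleftrightarrow> (\<forall>n. \<exists>k\<ge>n. (shift ^^ k) x \<in> A)" for x
    proof
      assume *: "\<forall>n. \<exists>k\<ge>n. (shift ^^ k) (shift x) \<in> A"
      show "\<forall>n. \<exists>k\<ge>n. (shift ^^ k) x \<in> A"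
      proof
        fix n obtain k where "k \<ge> n" "(shift ^^ k) (shift x) \<in> A" using * by blast
        then show "\<exists>k\<ge>n. (shift ^^ k) x \<in> A" by (intro exI[of _ "Suc k"]) (simp add: funpow_swap1)
      qed
    next
      assume *: "\<forall>n. \<exists>k\<ge>n. (shift ^^ k) x \<in> A"
      show "\<forall>n. \<exists>k\<ge>n. (shift ^^ k) (shift x) \<in> A"
      proof
        fix n obtain k where k: "k \<ge> Suc n" "(shift ^^ k) x \<in> A" using * by blast
        then obtain k' where "k = Suc k'" by (cases k) auto
        then show "\<exists>k\<ge>n. (shift ^^ k) (shift x) \<in> A" using k by (intro exI[of _ k']) (simp add: funpow_swap1)
      qed
    qed
    then show ?thesis using shift_space by (auto simp: B_def)
  qed
  then show ?thesis using erg BS eq by (auto simp: ergodic_measure_def)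
qed

text \<open>
  Let \<open>f\<close> be the density of \<open>M\<close>, let \<open>c\<close> be its mean, and let \<open>A\<close> be the set where \<open>f > c\<close>. The points
  leaving \<open>A\<close> in one step and those entering it have equal mass for both invariant measures, although
  \<open>f - c\<close> is positive on the former and at most \<open>0\<close> on the latter. So \<open>A\<close> is almost invariant, which
  by ergodicity leaves only \<open>f = c\<close>.
\<close>

lemma dominated_invariant_eq_multiple:
  assumes erg: "ergodic_measure X \<mu>" and S: "shift \<in> \<mu> \<rightarrow>\<^sub>M \<mu>"
    and M: "sets M = sets \<mu>" "distr M M shift = M"
    and le: "\<And>B. B \<in> sets \<mu> \<Longrightarrow> emeasure M B \<le> emeasure \<mu> B" and B: "B \<in> sets \<mu>"
  shows "measure M B = measure M (space \<mu>) * measure \<mu> B"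
proof -
  have inv: "invariant_measure X \<mu>" using erg by (simp add: ergodic_measure_def)
  interpret prob_space \<mu> by (rule invariant_measureD(1)[OF inv])
  have dS: "distr \<mu> \<mu> shift = \<mu>" by (rule invariant_measureD(3)[OF inv])
  have spM: "space M = space \<mu>" using sets_eq_imp_space_eq[OF M(1)] .
  have fM: "finite_measure M"
  proof
    show "emeasure M (space M) \<noteq> \<infinity>" using le[OF sets.top] emeasure_space_1 by (auto simp: spM top_unique)
  qed
  interpret M: finite_measure M by (rule fM)
  have SM: "shift \<in> M \<rightarrow>\<^sub>M M" using S M(1) by (simp cong: measurable_cong_sets)
  define c where "c = measure M (space \<mu>)"
  have "absolutely_continuous \<mu> M"
    unfolding absolutely_continuous_def using le M(1) by (auto simp: null_sets_def) (metis le_zero_eq)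
  from real_RN_deriv[OF fM this M(1)] obtain f where f: "f \<in> borel_measurable \<mu>" 
    "AE x in \<mu>. RN_deriv \<mu> M x = ennreal (f x)" "\<And>x. 0 \<le> f x" by metis
  have dens: "density \<mu> f = M"
  proof -
    have "density \<mu> (RN_deriv \<mu> M) = M" by (rule density_RN_deriv[OF \<open>absolutely_continuous \<mu> M\<close> M(1)])
    moreover have "density \<mu> (RN_deriv \<mu> M) = density \<mu> f"
      using f by (intro density_cong) auto
    ultimately show ?thesis by simp
  qed
  have int: "integrable \<mu> f"
  proof (rule integrableI_nonneg)
    have "(\<integral>\<^sup>+x. ennreal (f x) \<partial>\<mu>) = emeasure M (space \<mu>)"
      using f emeasure_density[of f \<mu> "space \<mu>"] dens by (simp cong: nn_integral_cong)
    then show "(\<integral>\<^sup>+x. ennreal (f x) \<partial>\<mu>) < \<infinity>" using M.emeasure_finite[of "space \<mu>"] by (simp add: less_top[symmetric])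
  qed (use f in auto)
  have mM: "measure M B = (\<integral>x\<in>B. f x \<partial>\<mu>)" if B: "B \<in> sets \<mu>" for B
  proof -
    have "emeasure M B = (\<integral>\<^sup>+x. ennreal (indicator B x * f x) \<partial>\<mu>)"
      unfolding dens[symmetric] using f B
      by (subst emeasure_density) (auto intro!: nn_integral_cong simp: indicator_def)
    also have "\<dots> = ennreal (\<integral>x\<in>B. f x \<partial>\<mu>)"
      unfolding set_lebesgue_integral_def real_scaleR_def
      using integrable_mult_indicator[OF B int] f by (intro nn_integral_eq_integral) auto
    finally show ?thesis
      using f(3) by (simp add: measure_def set_lebesgue_integral_def Bochner_Integration.integral_nonneg)
  qed
  have mc: "measure M B - c * measure \<mu> B = (\<integral>x\<in>B. (f x - c) \<partial>\<mu>)" if B: "B \<in> sets \<mu>" for B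
  proof -
    have "(\<integral>x\<in>B. (f x - c) \<partial>\<mu>) = (\<integral>x\<in>B. f x \<partial>\<mu>) - (\<integral>x\<in>B. c \<partial>\<mu>)"
      using integrable_mult_indicator[OF B int] integrable_mult_indicator[OF B, of "\<lambda>_. c"]
      by (intro set_integral_diff) (auto simp: set_integrable_def)
    then show ?thesis using mM[OF B] B by (simp add: set_lebesgue_integral_def mult.commute)
  qed
  have fc: "integrable \<mu> (\<lambda>x. f x - c)" using int by simp
  define A where "A = {x \<in> space \<mu>. c < f x}"
  have A: "A \<in> sets \<mu>" unfolding A_def using f(1) by measurable
  define P where "P = A - (shift -` A \<inter> space \<mu>)"
  define P' where "P' = (shift -` A \<inter> space \<mu>) - A"
  have SA: "shift -` A \<inter> space \<mu> \<in> sets \<mu>" using measurable_sets[OF S A] .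
  have P: "P \<in> sets \<mu>" "P' \<in> sets \<mu>" unfolding P_def P'_def using A SA by auto
  \<comment> \<open>Applied to \<open>M\<close> and to \<open>\<mu>\<close>: an invariant measure gives \<open>A\<close> and its preimage equal mass.\<close>
  have eqm: "measure N P = measure N P'" if N: "finite_measure N" "sets N = sets \<mu>" "distr N N shift = N" "shift \<in> N \<rightarrow>\<^sub>M N" for N
  proof -
    interpret N: finite_measure N by (rule N(1))
    have spN: "space N = space \<mu>" using sets_eq_imp_space_eq[OF N(2)] .
    have "measure N A = measure N (shift -` A \<inter> space \<mu>)"
      using measure_distr[OF N(4), of A] N(2,3) A by (simp add: spN)
    moreover have "measure N P = measure N A - measure N (A \<inter> (shift -` A \<inter> space \<mu>))"
      unfolding P_def using A SA N(2) by (intro N.finite_measure_Diff') auto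
    moreover have "measure N P' = measure N (shift -` A \<inter> space \<mu>) - measure N ((shift -` A \<inter> space \<mu>) \<inter> A)"
      unfolding P'_def using A SA N(2) by (intro N.finite_measure_Diff') auto
    ultimately show ?thesis by (simp add: Int_commute)
  qed
  have "(\<integral>x\<in>P. (f x - c) \<partial>\<mu>) = (\<integral>x\<in>P'. (f x - c) \<partial>\<mu>)"
    unfolding mc[OF P(1), symmetric] mc[OF P(2), symmetric]
    using eqm[OF fM M SM] eqm[OF finite_measure_axioms refl dS S] by simp
  also have "\<dots> \<le> 0"
  proof -
    have "0 \<le> (\<integral>x. - (indicator P' x *\<^sub>R (f x - c)) \<partial>\<mu>)"
      by (intro Bochner_Integration.integral_nonneg) (auto simp: P'_def A_def indicator_def)
    then show ?thesis by (simp add: set_lebesgue_integral_def)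
  qed
  finally have le0: "(\<integral>x. indicator P x * (f x - c) \<partial>\<mu>) \<le> 0" by (simp add: set_lebesgue_integral_def)
  have nnP: "0 \<le> indicator P x * (f x - c)" for x by (auto simp: P_def A_def indicator_def)
  have "(\<integral>x. indicator P x * (f x - c) \<partial>\<mu>) = 0"
    using le0 nnP by (intro antisym Bochner_Integration.integral_nonneg) auto
  then have "AE x in \<mu>. indicator P x * (f x - c) = 0"
    using integral_nonneg_eq_0_iff_AE[of \<mu> "\<lambda>x. indicator P x * (f x - c)"] integrable_mult_indicator[OF P(1) fc] nnP by simp
  then have aP: "AE x in \<mu>. x \<notin> P" by eventually_elim (auto simp: P_def A_def indicator_def split: if_splits)
  then have "measure \<mu> P = 0" using P(1) by (simp add: AE_iff_measurable[OF _ refl] prob_eq_0 P_def)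
  then have "measure \<mu> P' = 0" using eqm[OF finite_measure_axioms refl dS S] by simp
  then have aP': "AE x in \<mu>. x \<notin> P'" using P(2) by (simp add: prob_eq_0)
  have "AE x in \<mu>. x \<in> A \<longleftrightarrow> shift x \<in> A"
    using aP aP' AE_space by eventually_elim (auto simp: P_def P'_def)
  then have A01: "measure \<mu> A = 0 \<or> measure \<mu> A = 1" by (rule ergodic_almost_invariant[OF erg S A])
  have tot: "(\<integral>x. (f x - c) \<partial>\<mu>) = 0"
  proof -
    have "(\<integral>x. (f x - c) \<partial>\<mu>) = (\<integral>x\<in>space \<mu>. (f x - c) \<partial>\<mu>)"
      unfolding set_lebesgue_integral_def by (intro Bochner_Integration.integral_cong) auto
    then show ?thesis using mc[OF sets.top] by (simp add: c_def prob_space)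
  qed
  have "AE x in \<mu>. f x - c = 0"
    using A01
  proof
    assume "measure \<mu> A = 0"
    then have "AE x in \<mu>. x \<notin> A" using A by (simp add: prob_eq_0)
    then have nn: "AE x in \<mu>. 0 \<le> c - f x" using AE_space by eventually_elim (auto simp: A_def)
    have "(\<integral>x. (c - f x) \<partial>\<mu>) = 0" using tot int by (simp add: prob_space)
    then have "AE x in \<mu>. c - f x = 0"
      using integral_nonneg_eq_0_iff_AE[OF _ nn] int by simp
    then show ?thesis by eventually_elim simp
  next
    assume "measure \<mu> A = 1"
    then have inA: "AE x in \<mu>. x \<in> A" using A by (simp add: prob_eq_1)
    then have nn: "AE x in \<mu>. 0 \<le> f x - c" by eventually_elim (auto simp: A_def)
    then show ?thesis using integral_nonneg_eq_0_iff_AE[OF fc nn] tot by simp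
  qed
  then have "(\<integral>x\<in>B. (f x - c) \<partial>\<mu>) = (\<integral>x. 0 \<partial>\<mu>)"
    unfolding set_lebesgue_integral_def using B f(1) by (intro integral_cong_AE) auto
  then show ?thesis using mc[OF B] by (simp add: c_def)
qed

section \<open>Exchanging words\<close>

definition exchange :: "int set \<Rightarrow> (int \<Rightarrow> 'a) \<Rightarrow> (int \<Rightarrow> 'a) \<Rightarrow> (int \<Rightarrow> 'a) \<Rightarrow> (int \<Rightarrow> 'a)" where
  "exchange I w w' x =
     (if \<forall>i\<in>I. x i = w i then \<lambda>i. if i \<in> I then w' i else x i
      else if \<forall>i\<in>I. x i = w' i then \<lambda>i. if i \<in> I then w i else x i
      else x)"

lemma exchange_restrict: "exchange I (restrict w I) (restrict w' I) = exchange I w w'"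
proof -
  have "(\<forall>i\<in>I. x i = restrict u I i) \<longleftrightarrow> (\<forall>i\<in>I. x i = u i)"
    "(\<lambda>i. if i \<in> I then restrict u I i else x i) = (\<lambda>i. if i \<in> I then u i else x i)" for x u :: "int \<Rightarrow> 'a"
    by auto
  then show ?thesis by (intro ext) (simp only: exchange_def)
qed

lemma exchange_off: "i \<notin> I \<Longrightarrow> exchange I w w' x i = x i"
  by (simp add: exchange_def)

lemma exchange_first: "\<forall>i\<in>I. x i = w i \<Longrightarrow> i \<in> I \<Longrightarrow> exchange I w w' x i = w' i"
  by (simp add: exchange_def)

lemma exchange_second: "\<forall>i\<in>I. x i = w' i \<Longrightarrow> i \<in> I \<Longrightarrow> exchange I w w' x i = w i"
  by (auto simp: exchange_def)

lemma exchange_neither: "\<not> (\<forall>i\<in>I. x i = w i) \<Longrightarrow> \<not> (\<forall>i\<in>I. x i = w' i) \<Longrightarrow> exchange I w w' x = x"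
  unfolding exchange_def by (simp only: if_False)

lemma exchange_exchange: "exchange I w w' (exchange I w w' x) = x"
proof -
  consider "\<forall>i\<in>I. x i = w i" | "\<forall>i\<in>I. x i = w' i" | "\<not> (\<forall>i\<in>I. x i = w i)" "\<not> (\<forall>i\<in>I. x i = w' i)" by blast
  then show ?thesis
  proof cases
    case 1
    then have "\<forall>i\<in>I. exchange I w w' x i = w' i" by (simp add: exchange_first)
    then have "exchange I w w' (exchange I w w' x) i = x i" for i
      using 1 by (cases "i \<in> I") (simp_all add: exchange_second exchange_off)
    then show ?thesis by blast
  next
    case 2
    then have "\<forall>i\<in>I. exchange I w w' x i = w i" by (simp add: exchange_second)
    then have "exchange I w w' (exchange I w w' x) i = x i" for i
      using 2 by (cases "i \<in> I") (simp_all add: exchange_first exchange_off)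
    then show ?thesis by blast
  next
    case 3
    then show ?thesis by (simp add: exchange_neither)
  qed
qed

context sliding_block_code
begin

text \<open>
  Replacing \<open>w\<close> by \<open>w'\<close> on an interval is harmless if the two words agree on the outermost \<open>K\<close> symbols
  at both ends: a window of length \<open>K\<close> either lies in the interval, where the new point is \<open>w'\<close>, or
  sees no change at all.
\<close>

lemma splice_in_X:
  assumes w: "w \<in> X" "w' \<in> X" "\<pi> w = \<pi> w'" and x: "x \<in> X" "\<And>i. i \<in> {a..<b} \<Longrightarrow> x i = w i"
    and left: "\<And>i. i \<in> {a..<b} \<Longrightarrow> i < a + K \<Longrightarrow> w i = w' i"
    and right: "\<And>i. i \<in> {a..<b} \<Longrightarrow> b - K \<le> i \<Longrightarrow> w i = w' i"
    and z: "\<And>i. z i = (if i \<in> {a..<b} then w' i else x i)"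
  shows "z \<in> X" "\<pi> z = \<pi> x"
proof -
  have window: "(\<forall>j\<in>{i..<i + K}. z j = w' j \<and> x j = w j) \<or> (\<forall>j\<in>{i..<i + K}. z j = x j)" for i
  proof (cases "{i..<i + K} \<subseteq> {a..<b}")
    case True
    then show ?thesis using z x(2) by auto
  next
    case False
    then obtain p where p: "p \<in> {i..<i + K}" "p < a \<or> b \<le> p" by force
    have "z j = x j" if j: "j \<in> {i..<i + K}" for j
    proof (cases "j \<in> {a..<b}")
      case True
      have "j < a + K \<or> b - K \<le> j" using p j by auto
      then have "w j = w' j" using left right True by blast
      then show ?thesis using z x(2)[OF True] True by simp
    next
      case False
      then show ?thesis using z[of j] by (simp only: if_False)
    qed
    then show ?thesis by blast
  qed
  show zX: "z \<in> X"
  proof (rule glue)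
    fix i show "\<exists>x\<in>X. \<forall>j\<in>{i..<i + K}. z j = x j" using window[of i] w(2) x(1) by blast
  qed
  show "\<pi> z = \<pi> x"
  proof
    fix i
    show "\<pi> z i = \<pi> x i"
      using window[of "i - r"]
    proof
      assume *: "\<forall>j\<in>{i - r..<i - r + K}. z j = w' j \<and> x j = w j"
      have "\<pi> z i = \<pi> w' i" by (rule code_eqI[OF zX w(2)]) (use * in blast)
      also have "\<dots> = \<pi> w i" by (simp add: w(3))
      also have "\<dots> = \<pi> x i" by (rule code_eqI[OF w(1) x(1)]) (use * in simp)
      finally show ?thesis .
    next
      assume *: "\<forall>j\<in>{i - r..<i - r + K}. z j = x j"
      show ?thesis by (rule code_eqI[OF zX x(1)]) (use * in blast)
    qed
  qed
qed

lemma block_involution_exchange: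
  assumes w: "w \<in> X" "w' \<in> X" "\<pi> w = \<pi> w'"
    and left: "\<And>i. i \<in> {a..<b} \<Longrightarrow> i < a + K \<Longrightarrow> w i = w' i"
    and right: "\<And>i. i \<in> {a..<b} \<Longrightarrow> b - K \<le> i \<Longrightarrow> w i = w' i"
  shows "block_involution {a..<b} (exchange {a..<b} w w')"
proof -
  let ?I = "{a..<b}" and ?T = "exchange {a..<b} w w'"
  have X: "?T x \<in> X \<and> \<pi> (?T x) = \<pi> x" if x: "x \<in> X" for x
  proof -
    consider "\<forall>i\<in>?I. x i = w i" | "\<forall>i\<in>?I. x i = w' i" | "\<not> (\<forall>i\<in>?I. x i = w i)" "\<not> (\<forall>i\<in>?I. x i = w' i)" by blast
    then show ?thesis
    proof cases
      case 1
      have "?T x i = (if i \<in> ?I then w' i else x i)" for i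
        using 1 by (simp add: exchange_first exchange_off)
      from splice_in_X[OF w x _ left right this] 1 show ?thesis by blast
    next
      case 2
      have *: "?T x i = (if i \<in> ?I then w i else x i)" for i
        using 2 by (simp add: exchange_second exchange_off)
      show ?thesis
        using splice_in_X[OF w(2,1) w(3)[symmetric] x _ left[symmetric] right[symmetric] *] 2 by blast
    next
      case 3
      then show ?thesis using x by (simp add: exchange_neither)
    qed
  qed
  have loc: "?T x i = ?T x' i" if eq: "\<forall>i\<in>?I. x i = x' i" and i: "i \<in> ?I" for x x' i
  proof -
    have "(\<forall>i\<in>?I. x i = u i) \<longleftrightarrow> (\<forall>i\<in>?I. x' i = u i)" for u using eq by simp
    then show ?thesis using i eq by (simp add: exchange_def)
  qed
  show ?thesis
    unfolding block_involution_def using X loc exchange_exchange exchange_off by blast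
qed

subsection \<open>Measurable sets of pairs\<close>

text \<open>
  Only finitely many pairs of words occur on \<open>J\<close>, so relative to \<open>R\<close> such a set is a finite union of
  measurable rectangles.
\<close>

lemma pair_determined_sets:
  assumes J: "finite J" and R: "R \<in> sets pair_space" and D: "D \<subseteq> R"
    and det: "\<And>p q. p \<in> R \<Longrightarrow> q \<in> D \<Longrightarrow> (\<And>j. j \<in> J \<Longrightarrow> fst p j = fst q j \<and> snd p j = snd q j) \<Longrightarrow> p \<in> D"
  shows "D \<in> sets pair_space"
proof -
  have RX: "R \<subseteq> X \<times> X" using sets.sets_into_space[OF R] by (simp add: space_pair_measure)
  define words where "words = (\<lambda>q. (restrict (fst q) J, restrict (snd q) J)) ` D"
  define cell where "cell s = {x \<in> X. restrict x J = s}" for s :: "int \<Rightarrow> 'a"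
  have cell: "cell s \<in> sets (borel_on X)" for s
    unfolding cell_def by (intro cylinder_sets cylindersI[OF J]) (auto simp: determined_on_def fun_eq_iff restrict_def)
  have fin: "finite words"
  proof (rule finite_subset)
    show "words \<subseteq> PiE J (\<lambda>_. A) \<times> PiE J (\<lambda>_. A)" using D RX alphabet by (auto simp: words_def)
  qed (simp add: finite_PiE finite_A J)
  have "D = R \<inter> (\<Union>(s, t)\<in>words. cell s \<times> cell t)"
  proof (intro equalityI subsetI)
    fix p assume p: "p \<in> D"
    then have "p \<in> X \<times> X" using D RX by blast
    then have "p \<in> cell (restrict (fst p) J) \<times> cell (restrict (snd p) J)" by (auto simp: cell_def)
    moreover have "(restrict (fst p) J, restrict (snd p) J) \<in> words" using p by (auto simp: words_def)
    ultimately show "p \<in> R \<inter> (\<Union>(s, t)\<in>words. cell s \<times> cell t)" using p D by blast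
  next
    fix p assume p: "p \<in> R \<inter> (\<Union>(s, t)\<in>words. cell s \<times> cell t)"
    then obtain q where q: "q \<in> D" "p \<in> cell (restrict (fst q) J) \<times> cell (restrict (snd q) J)"
      by (auto simp: words_def)
    have "fst p j = fst q j \<and> snd p j = snd q j" if "j \<in> J" for j
      using q(2) that by (auto simp: cell_def restrict_eq_iff)
    then show "p \<in> D" using det[of p q] p q(1) by blast
  qed
  also have "\<dots> \<in> sets pair_space"
  proof (intro sets.Int R sets.finite_UN[OF fin])
    fix st assume "st \<in> words"
    show "(case st of (s, t) \<Rightarrow> cell s \<times> cell t) \<in> sets pair_space"
      by (cases st) (auto intro: pair_measureI cell)
  qed
  finally show ?thesis .
qed

lemma top_pair_space: "X \<times> X \<in> sets pair_space"
  using sets.top[of pair_space] by (simp add: space_pair_measure)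

definition same_image :: "((int \<Rightarrow> 'a) \<times> (int \<Rightarrow> 'a)) set" where
  "same_image = {p \<in> X \<times> X. \<pi> (fst p) = \<pi> (snd p)}"

lemma sets_same_image: "same_image \<in> sets pair_space"
proof -
  have "{p \<in> X \<times> X. \<pi> (fst p) i = \<pi> (snd p) i} \<in> sets pair_space" for i
  proof (rule pair_determined_sets[of "{i - r..<i - r + K}", OF _ top_pair_space])
    fix p q assume p: "p \<in> X \<times> X" and q: "q \<in> {p \<in> X \<times> X. \<pi> (fst p) i = \<pi> (snd p) i}"
      and eq: "\<And>j. j \<in> {i - r..<i - r + K} \<Longrightarrow> fst p j = fst q j \<and> snd p j = snd q j"
    have X: "fst p \<in> X" "fst q \<in> X" "snd p \<in> X" "snd q \<in> X" using p q by auto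
    have "\<pi> (fst p) i = \<pi> (fst q) i" by (rule code_eqI[OF X(1,2)]) (use eq in blast)
    moreover have "\<pi> (snd p) i = \<pi> (snd q) i" by (rule code_eqI[OF X(3,4)]) (use eq in blast)
    ultimately show "p \<in> {p \<in> X \<times> X. \<pi> (fst p) i = \<pi> (snd p) i}" using p q by simp
  qed auto
  then have "(\<Inter>i. {p \<in> X \<times> X. \<pi> (fst p) i = \<pi> (snd p) i}) \<in> sets pair_space" by (intro sets.countable_INT) auto
  also have "(\<Inter>i. {p \<in> X \<times> X. \<pi> (fst p) i = \<pi> (snd p) i}) = same_image" by (auto simp: same_image_def)
  finally show ?thesis .
qed

text \<open>
  A meeting is an agreement long enough to serve as one of the two ends in \<open>splice_in_X\<close>, which moreover
  asks the two points to have the same image.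
\<close>

definition meets :: "int \<Rightarrow> ((int \<Rightarrow> 'a) \<times> (int \<Rightarrow> 'a)) set" where
  "meets i = {p \<in> same_image. \<forall>j\<in>{i..<i + K}. fst p j = snd p j}"

lemma sets_meets: "meets i \<in> sets pair_space"
  by (rule pair_determined_sets[of "{i..<i + K}", OF _ sets_same_image]) (auto simp: meets_def)

lemma meets_translate:
  assumes p: "p \<in> X \<times> X"
  shows "(translate k (fst p), translate k (snd p)) \<in> meets i \<longleftrightarrow> p \<in> meets (i + k)"
proof -
  have x: "fst p \<in> X" "snd p \<in> X" using p by auto
  have "translate k y = translate k y' \<longleftrightarrow> y = y'" for y y' :: "int \<Rightarrow> 'b"
    by (metis translate_translate add.left_inverse translate_0)
  then have "(translate k (fst p), translate k (snd p)) \<in> same_image \<longleftrightarrow> p \<in> same_image"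
    using p x translate_X by (simp add: same_image_def code_translate)
  moreover have "(\<forall>j\<in>{i..<i + K}. fst p (j + k) = snd p (j + k)) \<longleftrightarrow> (\<forall>j\<in>{i + k..<i + k + K}. fst p j = snd p j)"
  proof (intro iffI ballI)
    fix j assume "\<forall>j\<in>{i..<i + K}. fst p (j + k) = snd p (j + k)" "j \<in> {i + k..<i + k + K}"
    then show "fst p j = snd p j" by (auto dest: bspec[of _ _ "j - k"])
  qed auto
  ultimately show ?thesis by (simp add: meets_def)
qed

text \<open>
  Although the connecting point \<open>v\<close> ranges over an uncountable set, its existence for given \<open>n\<close> and \<open>i\<close>
  depends, among the pairs with equal image, only on the coordinates near \<open>{n..i}\<close>: outside that range
  \<open>v\<close> can be continued by the two given points.
\<close>

lemma transition_sets: "{p \<in> X \<times> X. transition X \<pi> (fst p) (snd p)} \<in> sets pair_space"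
proof -
  define G where "G n i = {p \<in> same_image. \<exists>v\<in>X. \<pi> v = \<pi> (fst p) \<and> (\<forall>j\<le>n. v j = fst p j) \<and> (\<forall>j\<ge>i. v j = snd p j)}" for n i :: int
  have G: "G n i \<in> sets pair_space" if ni: "n \<le> i" for n i
  proof (rule pair_determined_sets[of "{n - 2 * K..i + 2 * K}", OF _ sets_same_image])
    fix p q assume p: "p \<in> same_image" and q: "q \<in> G n i"
      and eq: "\<And>j. j \<in> {n - 2 * K..i + 2 * K} \<Longrightarrow> fst p j = fst q j \<and> snd p j = snd q j"
    have pX: "fst p \<in> X" "snd p \<in> X" "\<pi> (fst p) = \<pi> (snd p)" using p by (auto simp: same_image_def)
    have qX: "fst q \<in> X" using q by (auto simp: G_def same_image_def)
    obtain v where v: "v \<in> X" "\<pi> v = \<pi> (fst q)" "\<And>j. j \<le> n \<Longrightarrow> v j = fst q j" "\<And>j. i \<le> j \<Longrightarrow> v j = snd q j"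
      using q by (auto simp: G_def)
    define z where "z j = (if j < n then fst p j else if j \<le> i then v j else snd p j)" for j
    have zl: "z j = fst p j" if "j \<le> n" for j
      using that v(3)[of n] eq[of n] ni K_pos by (cases "j = n") (auto simp: z_def)
    have zr: "z j = snd p j" if "i \<le> j" for j
    proof (cases "j = i")
      case True
      then have "z j = v i" using ni by (simp add: z_def)
      also have "\<dots> = snd p j" using v(4)[of i] eq[of i] ni K_pos True by simp
      finally show ?thesis .
    next
      case False then show ?thesis using that ni by (simp add: z_def)
    qed
    have zm: "z j = v j" if j: "j \<in> {n - 2 * K..i + 2 * K}" for j
    proof -
      consider "j < n" | "n \<le> j" "j \<le> i" | "i < j" by linarith
      then show ?thesis
      proof cases
        case 1 then show ?thesis using v(3)[of j] eq[OF j] by (simp add: z_def)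
      next
        case 2 then show ?thesis by (simp add: z_def)
      next
        case 3 then show ?thesis using v(4)[of j] eq[OF j] ni by (simp add: z_def)
      qed
    qed
    have window: "(\<forall>j\<in>{s..<s + K}. z j = fst p j) \<or> (\<forall>j\<in>{s..<s + K}. z j = snd p j) \<or>
       (\<forall>j\<in>{s..<s + K}. z j = v j \<and> fst p j = fst q j)" for s
    proof -
      consider "s + K \<le> n" | "i \<le> s" | "n < s + K" "s < i" by linarith
      then show ?thesis
      proof cases
        case 1 then show ?thesis using zl by auto
      next
        case 2 then show ?thesis using zr by auto
      next
        case 3
        then have "{s..<s + K} \<subseteq> {n - 2 * K..i + 2 * K}" using K_pos by auto
        then show ?thesis using zm eq by blast
      qed
    qed
    have zX: "z \<in> X"
    proof (rule glue)
      fix s show "\<exists>x\<in>X. \<forall>j\<in>{s..<s + K}. z j = x j" using window[of s] pX v(1) by blast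
    qed
    have "\<pi> z = \<pi> (fst p)"
    proof
      fix t
      from window[of "t - r"] show "\<pi> z t = \<pi> (fst p) t"
      proof (elim disjE)
        assume *: "\<forall>j\<in>{t - r..<t - r + K}. z j = fst p j"
        show ?thesis by (rule code_eqI[OF zX pX(1)]) (use * in blast)
      next
        assume *: "\<forall>j\<in>{t - r..<t - r + K}. z j = snd p j"
        have "\<pi> z t = \<pi> (snd p) t" by (rule code_eqI[OF zX pX(2)]) (use * in blast)
        then show ?thesis by (simp add: pX(3))
      next
        assume *: "\<forall>j\<in>{t - r..<t - r + K}. z j = v j \<and> fst p j = fst q j"
        have "\<pi> z t = \<pi> v t" by (rule code_eqI[OF zX v(1)]) (use * in blast)
        also have "\<dots> = \<pi> (fst q) t" by (simp add: v(2))
        also have "\<dots> = \<pi> (fst p) t" by (rule code_eqI[OF qX pX(1)]) (use * in simp)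
        finally show ?thesis .
      qed
    qed
    then show "p \<in> G n i" unfolding G_def using p zX zl zr by blast
  qed (auto simp: G_def)
  have "(\<Inter>n. \<Union>i\<in>{n..}. G n i) \<in> sets pair_space"
    using G by (intro sets.countable_INT sets.countable_UN) (auto intro!: sets.countable_UN')
  also have "(\<Inter>n. \<Union>i\<in>{n..}. G n i) = {p \<in> X \<times> X. transition X \<pi> (fst p) (snd p)}"
  proof (intro equalityI subsetI)
    fix p assume p: "p \<in> (\<Inter>n. \<Union>i\<in>{n..}. G n i)"
    then have pQ: "p \<in> same_image" by (auto simp: G_def)
    have "\<exists>v\<in>X. \<pi> v = \<pi> (fst p) \<and> \<pi> (fst p) = \<pi> (snd p) \<and> (\<forall>j\<le>n. v j = fst p j) \<and> (\<exists>i\<ge>n. \<forall>j\<ge>i. v j = snd p j)" for n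
    proof -
      obtain i where "i \<ge> n" "p \<in> G n i" using p by auto
      then show ?thesis using pQ unfolding G_def same_image_def by blast
    qed
    then show "p \<in> {p \<in> X \<times> X. transition X \<pi> (fst p) (snd p)}"
      using pQ by (auto simp: transition_def same_image_def)
  next
    fix p assume p: "p \<in> {p \<in> X \<times> X. transition X \<pi> (fst p) (snd p)}"
    have "p \<in> (\<Union>i\<in>{n..}. G n i)" for n
    proof -
      have pX: "p \<in> X \<times> X" using p by blast
      have "\<exists>v\<in>X. \<pi> v = \<pi> (fst p) \<and> \<pi> (fst p) = \<pi> (snd p) \<and> (\<forall>j\<le>n. v j = fst p j) \<and> (\<exists>i\<ge>n. \<forall>j\<ge>i. v j = snd p j)"
        using p unfolding transition_def by blast
      then obtain v i where v: "v \<in> X" "\<pi> v = \<pi> (fst p)" "\<pi> (fst p) = \<pi> (snd p)" "\<forall>j\<le>n. v j = fst p j"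
        "i \<ge> n" "\<forall>j\<ge>i. v j = snd p j" by blast
      then have "p \<in> G n i" unfolding G_def same_image_def using pX by blast
      then show ?thesis using v(5) by blast
    qed
    then show "p \<in> (\<Inter>n. \<Union>i\<in>{n..}. G n i)" by blast
  qed
  finally show ?thesis .
qed

lemma transition_equiv_sets: "{p \<in> X \<times> X. transition_equiv X \<pi> (fst p) (snd p)} \<in> sets pair_space"
proof -
  let ?D = "{p \<in> X \<times> X. transition X \<pi> (fst p) (snd p)}"
  have "(\<lambda>p. (snd p, fst p)) \<in> pair_space \<rightarrow>\<^sub>M pair_space" by measurable
  from measurable_sets[OF this transition_sets]
  have "(\<lambda>p. (snd p, fst p)) -` ?D \<inter> space pair_space \<in> sets pair_space" .
  then have "?D \<inter> ((\<lambda>p. (snd p, fst p)) -` ?D \<inter> space pair_space) \<in> sets pair_space"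
    using transition_sets by blast
  also have "?D \<inter> ((\<lambda>p. (snd p, fst p)) -` ?D \<inter> space pair_space) = {p \<in> X \<times> X. transition_equiv X \<pi> (fst p) (snd p)}"
    by (auto simp: transition_equiv_def space_pair_measure)
  finally show ?thesis .
qed

subsection \<open>From transitions to meetings\<close>

text \<open>
  A point that starts as \<open>u\<close> and ends as \<open>v\<close> is spliced, on a stretch where it equals \<open>v\<close>, with one
  that starts as \<open>v\<close> and ends as \<open>u\<close>. The result \<open>w\<close> differs from \<open>u\<close> in finitely many places only, and
  it meets \<open>v\<close>.
\<close>

lemma transition_equiv_detour:
  assumes u: "u \<in> X" "v \<in> X" "transition_equiv X \<pi> u v"
  shows "\<exists>a b i w. block_involution {a..<b} (exchange {a..<b} u w) \<and> w \<in> X \<and>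
     (exchange {a..<b} u w u, v) \<in> meets i"
proof -
  have "transition X \<pi> u v" "transition X \<pi> v u" using u(3) by (auto simp: transition_equiv_def)
  then obtain v1 i1 where v1: "v1 \<in> X" "\<pi> v1 = \<pi> u" "\<pi> u = \<pi> v" "\<And>j. j \<le> 0 \<Longrightarrow> v1 j = u j" "0 \<le> i1" "\<And>j. i1 \<le> j \<Longrightarrow> v1 j = v j"
    unfolding transition_def by metis
  obtain v2 i2 where v2: "v2 \<in> X" "\<pi> v2 = \<pi> v" "\<And>j. j \<le> i1 + K \<Longrightarrow> v2 j = v j" "i1 + K \<le> i2" "\<And>j. i2 \<le> j \<Longrightarrow> v2 j = u j"
    using \<open>transition X \<pi> v u\<close> unfolding transition_def by metis
  define w where "w j = (if j \<le> i1 + K then v1 j else v2 j)" for j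
  have w_right: "w j = v2 j" if "i1 \<le> j" for j
    using that v1(6)[of j] v2(3)[of j] by (simp add: w_def)
  have window: "(\<forall>j\<in>{i..<i + K}. w j = v1 j) \<or> (\<forall>j\<in>{i..<i + K}. w j = v2 j)" for i
  proof (cases "i1 \<le> i")
    case True then show ?thesis using w_right by auto
  next
    case False then show ?thesis by (auto simp: w_def)
  qed
  have wX: "w \<in> X"
  proof (rule glue)
    fix i show "\<exists>x\<in>X. \<forall>j\<in>{i..<i + K}. w j = x j" using window[of i] v1(1) v2(1) by blast
  qed
  have wpi: "\<pi> w = \<pi> u"
  proof
    fix t
    from window[of "t - r"] show "\<pi> w t = \<pi> u t"
    proof
      assume *: "\<forall>j\<in>{t - r..<t - r + K}. w j = v1 j"
      have "\<pi> w t = \<pi> v1 t" by (rule code_eqI[OF wX v1(1)]) (use * in blast)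
      then show ?thesis by (simp add: v1(2))
    next
      assume *: "\<forall>j\<in>{t - r..<t - r + K}. w j = v2 j"
      have "\<pi> w t = \<pi> v2 t" by (rule code_eqI[OF wX v2(1)]) (use * in blast)
      then show ?thesis by (simp add: v1(3) v2(2))
    qed
  qed
  have wl: "w j = u j" if "j \<le> 0" for j using that v1(4)[of j] v1(5) K_pos by (simp add: w_def)
  have wr: "w j = u j" if "i2 \<le> j" for j using w_right[of j] v2(4) v2(5)[of j] that K_pos by simp
  \<comment> \<open>A margin of length \<open>K\<close> on both sides makes the two words agree near the ends.\<close>
  let ?I = "{- K..<i2 + K}"
  have "block_involution ?I (exchange ?I u w)"
    by (rule block_involution_exchange[OF u(1) wX]) (use wpi wl wr in auto)
  moreover have "exchange ?I u w u = w"
  proof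
    fix j show "exchange ?I u w u j = w j"
      using wl[of j] wr[of j] K_pos by (cases "j \<in> ?I") (auto simp: exchange_first exchange_off)
  qed
  moreover have "(w, v) \<in> meets i1"
    using wX u(2) wpi v1(3,6) by (auto simp: meets_def same_image_def w_def)
  ultimately show ?thesis using wX by metis
qed

end

section \<open>Relatively maximal measures never meet\<close>

context sliding_block_code
begin

context
  fixes \<mu>\<^sub>1 \<mu>\<^sub>2 :: "(int \<Rightarrow> 'a) measure" and \<nu> :: "(int \<Rightarrow> 'b) measure"
  assumes max1: "ergodic_relative_maximal_entropy X Y \<pi> \<nu> \<mu>\<^sub>1"
    and max2: "ergodic_relative_maximal_entropy X Y \<pi> \<nu> \<mu>\<^sub>2"
begin

lemma fibre1: "\<mu>\<^sub>1 \<in> invariant_fibre X Y \<pi> \<nu>" and fibre2: "\<mu>\<^sub>2 \<in> invariant_fibre X Y \<pi> \<nu>"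
  using max1 max2 by (auto simp: ergodic_relative_maximal_entropy_def)

lemma preserves1: "block_involution J T \<Longrightarrow> finite J \<Longrightarrow> distr \<mu>\<^sub>1 \<mu>\<^sub>1 T = \<mu>\<^sub>1"
  using max1 by (intro maximal_entropy_block_involution[OF fibre1]) (auto simp: ergodic_relative_maximal_entropy_def)

lemma preserves2: "block_involution J T \<Longrightarrow> finite J \<Longrightarrow> distr \<mu>\<^sub>2 \<mu>\<^sub>2 T = \<mu>\<^sub>2"
  using max2 by (intro maximal_entropy_block_involution[OF fibre2]) (auto simp: ergodic_relative_maximal_entropy_def)

abbreviation \<Lambda> where "\<Lambda> \<equiv> relatively_independent_joining X Y \<pi> \<nu> \<mu>\<^sub>1 \<mu>\<^sub>2"

lemmas sets_\<Lambda> = joining_spec(1)[OF fibre1 fibre2]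
lemmas space_\<Lambda> = space_joining[OF fibre1 fibre2]

interpretation prob_space \<Lambda> by (rule prob_space_joining[OF fibre1 fibre2])

lemma meets_sets_\<Lambda>: "meets i \<in> sets \<Lambda>"
  using sets_meets sets_\<Lambda> by simp

text \<open>
  Every equivalent pair is carried to a meeting pair by one of countably many maps that act on the
  first coordinate as a block involution, and each of these preserves the joining.
\<close>

lemma transition_equiv_null:
  assumes null: "\<And>i. emeasure \<Lambda> (meets i) = 0"
  shows "{p \<in> X \<times> X. transition_equiv X \<pi> (fst p) (snd p)} \<in> null_sets \<Lambda>"
proof -
  define W where "W a b = {st \<in> PiE {a..<b} (\<lambda>_. A) \<times> PiE {a..<b} (\<lambda>_. A).
    block_involution {a..<b} (exchange {a..<b} (fst st) (snd st))}" for a b :: int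
  define R where "R a b st i = {p \<in> X \<times> X. (exchange {a..<b} (fst st) (snd st) (fst p), snd p) \<in> meets i}" for a b :: int and st i
  have finW: "finite (W a b)" for a b
    by (rule finite_subset[of _ "PiE {a..<b} (\<lambda>_. A) \<times> PiE {a..<b} (\<lambda>_. A)"])
      (auto simp: W_def finite_PiE finite_A)
  have "R a b st i \<in> null_sets \<Lambda>" if "st \<in> W a b" for a b st i
  proof -
    have T: "block_involution {a..<b} (exchange {a..<b} (fst st) (snd st))" using that by (simp add: W_def)
    have id: "(\<lambda>x. x) \<in> borel_on X \<rightarrow>\<^sub>M borel_on X" "distr \<mu>\<^sub>2 \<mu>\<^sub>2 (\<lambda>x. x) = \<mu>\<^sub>2" by simp_all
    have "emeasure \<Lambda> (R a b st i) = emeasure \<Lambda> (meets i)" "R a b st i \<in> sets \<Lambda>"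
      unfolding R_def
      by (rule joining_over_identity[OF fibre1 fibre2 measurable_block_involution[OF T] preserves1[OF T] block_involutionD(3)[OF T]
            id refl sets_meets], simp_all)+
    then show ?thesis using null by (simp add: null_sets_def)
  qed
  then have "(\<Union>a. \<Union>b. \<Union>st\<in>W a b. \<Union>i. R a b st i) \<in> null_sets \<Lambda>"
    by (intro null_sets_UN null_sets_UN' countable_finite finW) auto
  moreover have "{p \<in> X \<times> X. transition_equiv X \<pi> (fst p) (snd p)} \<subseteq> (\<Union>a. \<Union>b. \<Union>st\<in>W a b. \<Union>i. R a b st i)"
  proof
    fix p assume "p \<in> {p \<in> X \<times> X. transition_equiv X \<pi> (fst p) (snd p)}"
    then have p: "p \<in> X \<times> X" "fst p \<in> X" "snd p \<in> X" "transition_equiv X \<pi> (fst p) (snd p)" by auto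
    from transition_equiv_detour[OF p(2-4)] obtain a b i w where w:
      "block_involution {a..<b} (exchange {a..<b} (fst p) w)" "w \<in> X" "(exchange {a..<b} (fst p) w (fst p), snd p) \<in> meets i"
      by blast
    define st where "st = (restrict (fst p) {a..<b}, restrict w {a..<b})"
    have ex: "exchange {a..<b} (fst st) (snd st) = exchange {a..<b} (fst p) w"
      by (simp only: st_def fst_conv snd_conv exchange_restrict)
    have "st \<in> PiE {a..<b} (\<lambda>_. A) \<times> PiE {a..<b} (\<lambda>_. A)" using p(2) w(2) alphabet by (auto simp: st_def)
    then have "st \<in> W a b" unfolding W_def using w(1) ex by simp
    moreover have "p \<in> R a b st i" unfolding R_def ex using p(1) w(3) by blast
    ultimately show "p \<in> (\<Union>a. \<Union>b. \<Union>st\<in>W a b. \<Union>i. R a b st i)" by blast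
  qed
  moreover have "{p \<in> X \<times> X. transition_equiv X \<pi> (fst p) (snd p)} \<in> sets \<Lambda>"
    using transition_equiv_sets sets_\<Lambda> by simp
  ultimately show ?thesis using null_sets_subset by blast
qed

subsection \<open>Pairs that meet infinitely often\<close>

definition often :: "((int \<Rightarrow> 'a) \<times> (int \<Rightarrow> 'a)) set" where
  "often = (\<Inter>n. (\<Union>i\<in>{n..}. meets i) \<inter> (\<Union>i\<in>{..n}. meets i))"

lemma mem_often: "p \<in> often \<longleftrightarrow> (\<forall>n. (\<exists>i\<ge>n. p \<in> meets i) \<and> (\<exists>i\<le>n. p \<in> meets i))"
  by (auto simp: often_def)

lemma sets_often: "often \<in> sets pair_space"
  unfolding often_def using sets_meets by (intro sets.countable_INT sets.Int sets.countable_UN') auto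

lemma often_sub: "often \<subseteq> X \<times> X"
  using sets.sets_into_space[OF sets_often] by (simp add: space_pair_measure)

lemma often_translate:
  assumes p: "p \<in> X \<times> X"
  shows "(translate k (fst p), translate k (snd p)) \<in> often \<longleftrightarrow> p \<in> often"
  unfolding mem_often meets_translate[OF p]
proof (intro iffI allI conjI)
  fix n assume *: "\<forall>n. (\<exists>i\<ge>n. p \<in> meets (i + k)) \<and> (\<exists>i\<le>n. p \<in> meets (i + k))"
  obtain i where "i \<ge> n - k" "p \<in> meets (i + k)" using * by blast
  then show "\<exists>i\<ge>n. p \<in> meets i" by (intro exI[of _ "i + k"]) simp
  obtain i where "i \<le> n - k" "p \<in> meets (i + k)" using * by blast
  then show "\<exists>i\<le>n. p \<in> meets i" by (intro exI[of _ "i + k"]) simp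
next
  fix n assume *: "\<forall>n. (\<exists>i\<ge>n. p \<in> meets i) \<and> (\<exists>i\<le>n. p \<in> meets i)"
  obtain i where "i \<ge> n + k" "p \<in> meets i" using * by blast
  then show "\<exists>i\<ge>n. p \<in> meets (i + k)" by (intro exI[of _ "i - k"]) simp
  obtain i where "i \<le> n + k" "p \<in> meets i" using * by blast
  then show "\<exists>i\<le>n. p \<in> meets (i + k)" by (intro exI[of _ "i - k"]) simp
qed

lemma emeasure_meets_shift:
  "emeasure \<Lambda> (\<Union>i\<in>(+) n ` S. meets i) = emeasure \<Lambda> (\<Union>i\<in>S. meets i)"
proof -
  have meets_sub: "meets j \<subseteq> X \<times> X" for j by (auto simp: meets_def same_image_def)
  have S: "(\<Union>i\<in>S. meets i) \<in> sets pair_space" using sets_meets by (intro sets.countable_UN') auto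
  have "{p \<in> X \<times> X. (translate n (fst p), translate n (snd p)) \<in> (\<Union>i\<in>S. meets i)} = (\<Union>i\<in>(+) n ` S. meets i)"
  proof (intro equalityI subsetI)
    fix p assume p: "p \<in> {p \<in> X \<times> X. (translate n (fst p), translate n (snd p)) \<in> (\<Union>i\<in>S. meets i)}"
    then obtain j where "j \<in> S" "(translate n (fst p), translate n (snd p)) \<in> meets j" by auto
    then show "p \<in> (\<Union>i\<in>(+) n ` S. meets i)" using meets_translate[of p n j] p by (auto simp: add.commute)
  next
    fix p assume "p \<in> (\<Union>i\<in>(+) n ` S. meets i)"
    then obtain j where j: "j \<in> S" "p \<in> meets (j + n)" by (auto simp: add.commute)
    then have "p \<in> X \<times> X" using meets_sub by blast
    then show "p \<in> {p \<in> X \<times> X. (translate n (fst p), translate n (snd p)) \<in> (\<Union>i\<in>S. meets i)}"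
      using meets_translate[of p n j] j by blast
  qed
  then show ?thesis using joining_translate[OF fibre1 fibre2 S, of n] by simp
qed

text \<open>
  Poincare recurrence: the pairs meeting after time \<open>n\<close> decrease with \<open>n\<close>, but by invariance their
  measure does not.
\<close>

lemma meets_recurrent: "meets i - often \<in> null_sets \<Lambda>"
proof -
  define U where "U n = (\<Union>i\<in>{n..}. meets i)" for n :: int
  define L where "L n = (\<Union>i\<in>{..n}. meets i)" for n :: int
  have US: "U n \<in> sets pair_space" and LS: "L n \<in> sets pair_space" for n
    unfolding U_def L_def using sets_meets by (intro sets.countable_UN'; auto)+
  have Ueq: "emeasure \<Lambda> (U n) = emeasure \<Lambda> (U 0)" for n
    using emeasure_meets_shift[of n "{0..}"] by (simp add: U_def image_add_atLeast)
  have Leq: "emeasure \<Lambda> (L n) = emeasure \<Lambda> (L 0)" for n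
    using emeasure_meets_shift[of n "{..0}"] by (simp add: L_def image_add_atMost)
  have null: "meets i - B m \<in> null_sets \<Lambda>"
    if B: "\<And>n. B n \<in> sets pair_space" "\<And>n. emeasure \<Lambda> (B n) = emeasure \<Lambda> (B 0)" and k: "meets i \<subseteq> B k" "B m \<subseteq> B k"
    for B :: "int \<Rightarrow> ((int \<Rightarrow> 'a) \<times> (int \<Rightarrow> 'a)) set" and m k
  proof -
    have Bs: "B n \<in> sets \<Lambda>" for n using B(1) sets_\<Lambda> by simp
    have "emeasure \<Lambda> (B k - B m) = emeasure \<Lambda> (B k) - emeasure \<Lambda> (B m)"
      using Bs k(2) by (intro emeasure_Diff) auto
    also have "\<dots> = 0" using B(2)[of k] B(2)[of m] by (simp add: emeasure_eq_measure)
    finally have "B k - B m \<in> null_sets \<Lambda>" using Bs by (auto simp: null_sets_def)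
    then show ?thesis
      by (rule null_sets_subset) (use Bs meets_sets_\<Lambda> k(1) in auto)
  qed
  have "meets i - U n \<in> null_sets \<Lambda>" for n
  proof (rule null[of U "min i n" n, OF US Ueq])
    show "meets i \<subseteq> U (min i n)" unfolding U_def by (rule UN_upper) simp
    show "U n \<subseteq> U (min i n)" unfolding U_def by (rule UN_mono) auto
  qed
  moreover have "meets i - L n \<in> null_sets \<Lambda>" for n
  proof (rule null[of L "max i n" n, OF LS Leq])
    show "meets i \<subseteq> L (max i n)" unfolding L_def by (rule UN_upper) simp
    show "L n \<subseteq> L (max i n)" unfolding L_def by (rule UN_mono) auto
  qed
  ultimately have "(\<Union>n. (meets i - U n) \<union> (meets i - L n)) \<in> null_sets \<Lambda>"
    by (intro null_sets_UN null_sets.Un) auto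
  moreover have "(\<Union>n. (meets i - U n) \<union> (meets i - L n)) = meets i - often"
    unfolding often_def U_def L_def by blast
  ultimately show ?thesis by simp
qed

lemma meets_cong:
  assumes p: "p \<in> X \<times> X" "q \<in> X \<times> X" and pi: "\<pi> (fst p) = \<pi> (fst q)" "\<pi> (snd p) = \<pi> (snd q)"
    and eq: "\<And>j. fst p j = snd p j \<longleftrightarrow> fst q j = snd q j"
  shows "p \<in> meets i \<longleftrightarrow> q \<in> meets i"
  using p pi eq by (simp add: meets_def same_image_def)

text \<open>
  The block involution that exchanges the words of \<open>q\<close> between two of its meetings is applied to both
  coordinates. It interchanges the two sets and preserves the joining. The positions where the two
  coordinates agree stay the same, and with them the cell.
\<close>

lemma exchange_swaps_cell:
  fixes cell :: "((int \<Rightarrow> 'a) \<times> (int \<Rightarrow> 'a)) set"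
  assumes cell: "cell \<in> sets pair_space"
    and cong: "\<And>p q. p \<in> X \<times> X \<Longrightarrow> q \<in> X \<times> X \<Longrightarrow> (\<And>i. p \<in> meets i \<longleftrightarrow> q \<in> meets i) \<Longrightarrow> p \<in> cell \<longleftrightarrow> q \<in> cell"
    and ends: "cell \<subseteq> meets a" "cell \<subseteq> meets b" and q: "q \<in> cell"
  defines "I \<equiv> {a..<b + K}"
  shows "emeasure \<Lambda> {p \<in> cell. restrict (fst p) I = restrict (fst q) I \<and> restrict (snd p) I = restrict (snd q) I}
       = emeasure \<Lambda> {p \<in> cell. restrict (fst p) I = restrict (snd q) I \<and> restrict (snd p) I = restrict (fst q) I}"
proof -
  define T where "T = exchange I (fst q) (snd q)"
  define R where "R s t = {p \<in> cell. restrict (fst p) I = restrict s I \<and> restrict (snd p) I = restrict t I}" for s t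
  have cX: "cell \<subseteq> X \<times> X" using sets.sets_into_space[OF cell] by (simp add: space_pair_measure)
  have qa: "q \<in> meets a" "q \<in> meets b" using q ends by auto
  have T: "block_involution I T"
    unfolding I_def T_def
    by (rule block_involution_exchange) (use qa in \<open>auto simp: meets_def same_image_def\<close>)
  have finI: "finite I" by (simp add: I_def)
  have RS: "R s t \<in> sets pair_space" for s t
    by (rule pair_determined_sets[OF finI cell]) (auto simp: R_def restrict_eq_iff)
  have "{p \<in> X \<times> X. (T (fst p), T (snd p)) \<in> R (snd q) (fst q)} = R (fst q) (snd q)"
  proof -
    have fwd: "(T (fst p), T (snd p)) \<in> cell \<longleftrightarrow> p \<in> cell"
      if p: "p \<in> X \<times> X" and e: "\<forall>i\<in>I. fst p i = fst q i" "\<forall>i\<in>I. snd p i = snd q i" for p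
    proof (rule cong)
      have pX: "fst p \<in> X" "snd p \<in> X" using p by auto
      show TX: "(T (fst p), T (snd p)) \<in> X \<times> X" using block_involutionD(1)[OF T] pX by auto
      fix i
      show "(T (fst p), T (snd p)) \<in> meets i \<longleftrightarrow> p \<in> meets i"
      proof (rule meets_cong[OF TX p])
        show "\<pi> (fst (T (fst p), T (snd p))) = \<pi> (fst p)" "\<pi> (snd (T (fst p), T (snd p))) = \<pi> (snd p)"
          using block_involutionD(3)[OF T] pX by auto
        fix j
        have "T (fst p) j = T (snd p) j \<longleftrightarrow> fst p j = snd p j"
        proof (cases "j \<in> I")
          case True
          have "T (fst p) j = snd q j" unfolding T_def by (rule exchange_first[OF e(1) True])
          moreover have "T (snd p) j = fst q j" unfolding T_def by (rule exchange_second[OF e(2) True])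
          moreover have "fst p j = fst q j" "snd p j = snd q j" using e True by auto
          ultimately show ?thesis by auto
        next
          case False
          then show ?thesis unfolding T_def by (simp only: exchange_off not_False_eq_True)
        qed
        then show "fst (T (fst p), T (snd p)) j = snd (T (fst p), T (snd p)) j \<longleftrightarrow> fst p j = snd p j" by simp
      qed
    qed (rule p)
    have on_I: "(\<forall>i\<in>I. T x i = snd q i) \<longleftrightarrow> (\<forall>i\<in>I. x i = fst q i)"
      "(\<forall>i\<in>I. T x i = fst q i) \<longleftrightarrow> (\<forall>i\<in>I. x i = snd q i)" for x
    proof -
      have 1: "\<forall>i\<in>I. T x i = snd q i" if "\<forall>i\<in>I. x i = fst q i" for x using that unfolding T_def by (simp add: exchange_first)
      have 2: "\<forall>i\<in>I. T x i = fst q i" if "\<forall>i\<in>I. x i = snd q i" for x using that unfolding T_def by (simp add: exchange_second)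
      have TT: "T (T x) = x" unfolding T_def by (rule exchange_exchange)
      show "(\<forall>i\<in>I. T x i = snd q i) \<longleftrightarrow> (\<forall>i\<in>I. x i = fst q i)" using 1[of x] 2[of "T x"] TT by metis
      show "(\<forall>i\<in>I. T x i = fst q i) \<longleftrightarrow> (\<forall>i\<in>I. x i = snd q i)" using 2[of x] 1[of "T x"] TT by metis
    qed
    show ?thesis
    proof (intro equalityI subsetI)
      fix p assume p: "p \<in> {p \<in> X \<times> X. (T (fst p), T (snd p)) \<in> R (snd q) (fst q)}"
      then have "\<forall>i\<in>I. T (fst p) i = snd q i" "\<forall>i\<in>I. T (snd p) i = fst q i"
        by (simp_all add: R_def restrict_eq_iff)
      then have e: "\<forall>i\<in>I. fst p i = fst q i" "\<forall>i\<in>I. snd p i = snd q i"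
        using on_I(1)[of "fst p"] on_I(2)[of "snd p"] by blast+
      have "(T (fst p), T (snd p)) \<in> cell" "p \<in> X \<times> X" using p by (auto simp: R_def)
      then have "p \<in> cell" using fwd[OF _ e] by blast
      then show "p \<in> R (fst q) (snd q)" using e by (simp add: R_def restrict_eq_iff)
    next
      fix p assume p: "p \<in> R (fst q) (snd q)"
      then have e: "\<forall>i\<in>I. fst p i = fst q i" "\<forall>i\<in>I. snd p i = snd q i" and pc: "p \<in> cell"
        by (simp_all add: R_def restrict_eq_iff)
      have pX: "p \<in> X \<times> X" using pc cX by blast
      have "(T (fst p), T (snd p)) \<in> cell" using fwd[OF pX e] pc by blast
      moreover have "\<forall>i\<in>I. T (fst p) i = snd q i" "\<forall>i\<in>I. T (snd p) i = fst q i" using e on_I by blast+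
      ultimately show "p \<in> {p \<in> X \<times> X. (T (fst p), T (snd p)) \<in> R (snd q) (fst q)}"
        using pX by (simp add: R_def restrict_eq_iff)
    qed
  qed
  moreover have "emeasure \<Lambda> {p \<in> X \<times> X. (T (fst p), T (snd p)) \<in> R (snd q) (fst q)} = emeasure \<Lambda> (R (snd q) (fst q))"
    by (rule joining_over_identity(1)[OF fibre1 fibre2 measurable_block_involution[OF T finI] preserves1[OF T finI] block_involutionD(3)[OF T]
          measurable_block_involution[OF T finI] preserves2[OF T finI] block_involutionD(3)[OF T] RS])
  ultimately show ?thesis by (simp only: R_def)
qed

text \<open>
  The window of \<open>C\<close> lies between the two meetings, where the coordinates have exchanged their words.
\<close>

lemma cell_swap_le:
  fixes cell :: "((int \<Rightarrow> 'a) \<times> (int \<Rightarrow> 'a)) set"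
  assumes cell: "cell \<in> sets pair_space"
    and cong: "\<And>p q. p \<in> X \<times> X \<Longrightarrow> q \<in> X \<times> X \<Longrightarrow> (\<And>i. p \<in> meets i \<longleftrightarrow> q \<in> meets i) \<Longrightarrow> p \<in> cell \<longleftrightarrow> q \<in> cell"
    and ends: "cell \<subseteq> meets a" "cell \<subseteq> meets b"
    and C: "determined_on {a..<b + K} X C"
  shows "emeasure \<Lambda> {p \<in> cell. fst p \<in> C} \<le> emeasure \<Lambda> {p \<in> cell. snd p \<in> C}"
proof -
  define I where "I = {a..<b + K}"
  define w where "w p = (restrict (fst p) I, restrict (snd p) I)" for p :: "(int \<Rightarrow> 'a) \<times> (int \<Rightarrow> 'a)"
  define S where "S = w ` {p \<in> cell. fst p \<in> C}"
  define R where "R st = {p \<in> cell. w p = st}" for st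
  have cX: "cell \<subseteq> X \<times> X" using sets.sets_into_space[OF cell] by (simp add: space_pair_measure)
  have finI: "finite I" by (simp add: I_def)
  have RS: "R st \<in> sets \<Lambda>" for st
    unfolding sets_\<Lambda>
    by (rule pair_determined_sets[OF finI cell]) (auto simp: R_def w_def restrict_eq_iff)
  have finS: "finite S"
  proof (rule finite_subset)
    show "S \<subseteq> PiE I (\<lambda>_. A) \<times> PiE I (\<lambda>_. A)" using cX alphabet by (auto simp: S_def w_def)
  qed (simp add: finite_PiE finite_A finI)
  have swap: "emeasure \<Lambda> (R st) = emeasure \<Lambda> (R (snd st, fst st))" if st: "st \<in> S" for st
  proof -
    obtain q where q: "q \<in> cell" "st = w q" using st unfolding S_def by blast
    show ?thesis
      using exchange_swaps_cell[OF cell cong ends q(1)]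
      unfolding R_def q(2) w_def I_def fst_conv snd_conv prod.inject .
  qed
  have "emeasure \<Lambda> {p \<in> cell. fst p \<in> C} \<le> emeasure \<Lambda> (\<Union>st\<in>S. R st)"
  proof (rule emeasure_mono)
    show "{p \<in> cell. fst p \<in> C} \<subseteq> (\<Union>st\<in>S. R st)" by (auto simp: S_def R_def)
    show "(\<Union>st\<in>S. R st) \<in> sets \<Lambda>" by (intro sets.finite_UN finS RS)
  qed
  also have "\<dots> \<le> (\<Sum>st\<in>S. emeasure \<Lambda> (R st))"
    using RS finS by (intro emeasure_subadditive_finite) auto
  also have "\<dots> = (\<Sum>st\<in>S. emeasure \<Lambda> (R (snd st, fst st)))" by (intro sum.cong refl swap)
  also have "\<dots> = emeasure \<Lambda> (\<Union>st\<in>S. R (snd st, fst st))"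
    using RS finS by (intro sum_emeasure) (auto simp: disjoint_family_on_def R_def)
  also have "\<dots> \<le> emeasure \<Lambda> {p \<in> cell. snd p \<in> C}"
  proof (rule emeasure_mono)
    show "(\<Union>st\<in>S. R (snd st, fst st)) \<subseteq> {p \<in> cell. snd p \<in> C}"
    proof
      fix p assume "p \<in> (\<Union>st\<in>S. R (snd st, fst st))"
      then obtain q where q: "q \<in> cell" "fst q \<in> C" "p \<in> cell" "w p = (restrict (snd q) I, restrict (fst q) I)"
        by (auto simp: S_def R_def w_def)
      have "fst q \<in> C \<longleftrightarrow> snd p \<in> C"
      proof (rule determined_onD[OF C])
        fix i assume "i \<in> {a..<b + K}"
        then show "fst q i = snd p i" using q(4) by (auto simp: w_def I_def restrict_eq_iff)
      qed (use q cX in auto)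
      then show "p \<in> {p \<in> cell. snd p \<in> C}" using q by simp
    qed
    have "{p \<in> cell. snd p \<in> C} \<in> sets pair_space"
    proof (rule pair_determined_sets[of "{a..<b + K}", OF _ cell])
      fix p q assume "p \<in> cell" "q \<in> {p \<in> cell. snd p \<in> C}"
        "\<And>j. j \<in> {a..<b + K} \<Longrightarrow> fst p j = fst q j \<and> snd p j = snd q j"
      then have "snd q \<in> C \<longleftrightarrow> snd p \<in> C" using cX by (intro determined_onD[OF C]) auto
      then show "p \<in> {p \<in> cell. snd p \<in> C}" using \<open>p \<in> cell\<close> \<open>q \<in> {p \<in> cell. snd p \<in> C}\<close> by simp
    qed auto
    then show "{p \<in> cell. snd p \<in> C} \<in> sets \<Lambda>" using sets_\<Lambda> by simp
  qed
  finally show ?thesis .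
qed

lemma sets_fst_in: "B \<in> sets (borel_on X) \<Longrightarrow> {p \<in> D. fst p \<in> B} \<in> sets \<Lambda>" if "D \<in> sets pair_space" for D
proof -
  assume B: "B \<in> sets (borel_on X)"
  have "{p \<in> D. fst p \<in> B} = D \<inter> (B \<times> X)"
    using sets.sets_into_space[OF that] by (auto simp: space_pair_measure)
  then show ?thesis using that B X_borel sets_\<Lambda> by auto
qed

lemma sets_snd_in: "B \<in> sets (borel_on X) \<Longrightarrow> {p \<in> D. snd p \<in> B} \<in> sets \<Lambda>" if "D \<in> sets pair_space" for D
proof -
  assume B: "B \<in> sets (borel_on X)"
  have "{p \<in> D. snd p \<in> B} = D \<inter> (X \<times> B)"
    using sets.sets_into_space[OF that] by (auto simp: space_pair_measure)
  then show ?thesis using that B X_borel sets_\<Lambda> by auto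
qed

text \<open>
  The set is divided according to the last meeting before and the first meeting after the window of
  \<open>C\<close>; each of these countably many cells is invariant under the exchange between its two meetings.
\<close>

lemma often_swap_le:
  assumes C: "C \<in> cylinders X"
  shows "emeasure \<Lambda> {p \<in> often. fst p \<in> C} \<le> emeasure \<Lambda> {p \<in> often. snd p \<in> C}"
proof -
  obtain J where J: "finite J" "determined_on J X C" using C by (auto simp: cylinders_def)
  have "finite (insert 0 J)" using J by simp
  then obtain a0 b0 where ab: "insert 0 J \<subseteq> {a0..b0}"
    by (metis Max_ge Min_le atLeastAtMost_iff subsetI)
  define first where "first n = meets (a0 - int n) - (\<Union>k<n. meets (a0 - int k))" for n :: nat
  define last where "last n = meets (b0 + int n) - (\<Union>k<n. meets (b0 + int k))" for n :: nat
  define cell where "cell kl = often \<inter> first (fst kl) \<inter> last (snd kl)" for kl :: "nat \<times> nat"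
  have cell: "cell kl \<in> sets pair_space" for kl
    unfolding cell_def first_def last_def using sets_often sets_meets by (intro sets.Int sets.Diff sets.finite_UN) auto
  have cong: "p \<in> cell kl \<longleftrightarrow> q \<in> cell kl" if "\<And>i. p \<in> meets i \<longleftrightarrow> q \<in> meets i" for p q kl
    using that unfolding cell_def first_def last_def mem_often Int_iff by simp
  have cover: "often = (\<Union>kl. cell kl)"
  proof (intro equalityI subsetI)
    fix p assume p: "p \<in> often"
    have "\<exists>k. p \<in> meets (a0 - int k)"
    proof -
      obtain i where "i \<le> a0" "p \<in> meets i" using p unfolding mem_often by blast
      then show ?thesis by (intro exI[of _ "nat (a0 - i)"]) simp
    qed
    then have "p \<in> first (LEAST k. p \<in> meets (a0 - int k))"
      unfolding first_def using LeastI_ex[of "\<lambda>k. p \<in> meets (a0 - int k)"] not_less_Least[of _ "\<lambda>k. p \<in> meets (a0 - int k)"] by auto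
    moreover have "\<exists>k. p \<in> meets (b0 + int k)"
    proof -
      obtain i where "i \<ge> b0" "p \<in> meets i" using p unfolding mem_often by blast
      then show ?thesis by (intro exI[of _ "nat (i - b0)"]) simp
    qed
    then have "p \<in> last (LEAST k. p \<in> meets (b0 + int k))"
      unfolding last_def using LeastI_ex[of "\<lambda>k. p \<in> meets (b0 + int k)"] not_less_Least[of _ "\<lambda>k. p \<in> meets (b0 + int k)"] by auto
    ultimately have "p \<in> cell ((LEAST k. p \<in> meets (a0 - int k)), (LEAST k. p \<in> meets (b0 + int k)))"
      using p by (simp add: cell_def)
    then show "p \<in> (\<Union>kl. cell kl)" by blast
  qed (auto simp: cell_def)
  have first_disj: "k = k'" if "p \<in> first k" "p \<in> first k'" for p k k'
    using that unfolding first_def by (metis DiffD1 DiffD2 UN_I lessThan_iff linorder_neqE_nat)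
  have last_disj: "k = k'" if "p \<in> last k" "p \<in> last k'" for p k k'
    using that unfolding last_def by (metis DiffD1 DiffD2 UN_I lessThan_iff linorder_neqE_nat)
  have disj: "disjoint_family cell"
    unfolding disjoint_family_on_def
  proof (intro ballI impI)
    fix kl kl' :: "nat \<times> nat" assume ne: "kl \<noteq> kl'"
    have False if p: "p \<in> cell kl" "p \<in> cell kl'" for p
    proof -
      have "fst kl = fst kl'" by (rule first_disj[of p]) (use p in \<open>simp_all add: cell_def\<close>)
      moreover have "snd kl = snd kl'" by (rule last_disj[of p]) (use p in \<open>simp_all add: cell_def\<close>)
      ultimately show False using ne by (simp add: prod_eq_iff)
    qed
    then show "cell kl \<inter> cell kl' = {}" by blast
  qed
  have CS: "C \<in> sets (borel_on X)" using C by (rule cylinder_sets)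
  have split: "emeasure \<Lambda> (\<Union>kl. F kl) = (\<integral>\<^sup>+kl. emeasure \<Lambda> (F kl) \<partial>count_space UNIV)"
    if "\<And>kl. F kl \<in> sets \<Lambda>" "\<And>kl. F kl \<subseteq> cell kl" for F
  proof (rule emeasure_UN_countable)
    have "F kl \<inter> F kl' = {}" if "kl \<noteq> kl'" for kl kl'
    proof -
      have "cell kl \<inter> cell kl' = {}" using disjoint_family_onD[OF disj, of kl kl'] that by simp
      then show ?thesis using \<open>\<And>kl. F kl \<subseteq> cell kl\<close>[of kl] \<open>\<And>kl. F kl \<subseteq> cell kl\<close>[of kl'] by blast
    qed
    then show "disjoint_family F" by (simp add: disjoint_family_on_def)
  qed (use that in auto)
  have "emeasure \<Lambda> {p \<in> often. fst p \<in> C} = emeasure \<Lambda> (\<Union>kl. {p \<in> cell kl. fst p \<in> C})"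
    unfolding cover by (rule arg_cong[of _ _ "emeasure \<Lambda>"]) blast
  also have "\<dots> = (\<integral>\<^sup>+kl. emeasure \<Lambda> {p \<in> cell kl. fst p \<in> C} \<partial>count_space UNIV)"
    by (rule split[OF sets_fst_in[OF cell CS]]) auto
  also have "\<dots> \<le> (\<integral>\<^sup>+kl. emeasure \<Lambda> {p \<in> cell kl. snd p \<in> C} \<partial>count_space UNIV)"
  proof (rule nn_integral_mono)
    fix kl :: "nat \<times> nat"
    show "emeasure \<Lambda> {p \<in> cell kl. fst p \<in> C} \<le> emeasure \<Lambda> {p \<in> cell kl. snd p \<in> C}"
    proof (rule cell_swap_le[OF cell cong])
      show "cell kl \<subseteq> meets (a0 - int (fst kl))" "cell kl \<subseteq> meets (b0 + int (snd kl))"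
        by (auto simp: cell_def first_def last_def)
      show "determined_on {a0 - int (fst kl)..<b0 + int (snd kl) + K} X C"
        by (rule determined_on_mono[OF J(2)]) (use ab K_pos in force)
    qed
  qed
  also have "\<dots> = emeasure \<Lambda> (\<Union>kl. {p \<in> cell kl. snd p \<in> C})"
    by (rule split[OF sets_snd_in[OF cell CS], symmetric]) auto
  also have "\<dots> = emeasure \<Lambda> {p \<in> often. snd p \<in> C}"
    unfolding cover by (rule arg_cong[of _ _ "emeasure \<Lambda>"]) blast
  finally show ?thesis .
qed

text \<open>
  The two marginals of the joining on the pairs that meet infinitely often coincide: the inequality of
  \<open>often_swap_le\<close> for a cylinder and for its complement adds up to an equality of total masses.
\<close>

theorem meeting_measures_equal:
  assumes pos: "emeasure \<Lambda> (meets i) \<noteq> 0"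
  shows "\<mu>\<^sub>1 = \<mu>\<^sub>2"
proof -
  define P where "P = density \<Lambda> (indicator often)"
  define M1 where "M1 = distr P (borel_on X) fst"
  define M2 where "M2 = distr P (borel_on X) snd"
  have oS: "often \<in> sets \<Lambda>" using sets_often sets_\<Lambda> by simp
  have m1: "fst \<in> P \<rightarrow>\<^sub>M borel_on X" and m2: "snd \<in> P \<rightarrow>\<^sub>M borel_on X"
    using measurable_fst[of "borel_on X" "borel_on X"] measurable_snd[of "borel_on X" "borel_on X"] sets_\<Lambda>
    by (simp_all add: P_def cong: measurable_cong_sets)
  have e1: "emeasure M1 B = emeasure \<Lambda> {p \<in> often. fst p \<in> B}" if B: "B \<in> sets (borel_on X)" for B
  proof -
    have "emeasure M1 B = emeasure P (fst -` B \<inter> space P)" unfolding M1_def by (rule emeasure_distr[OF m1 B])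
    also have "\<dots> = emeasure \<Lambda> (often \<inter> (fst -` B \<inter> space P))"
      unfolding P_def using oS measurable_sets[OF m1 B] by (subst emeasure_density) (auto simp: P_def simp flip: indicator_inter_arith)
    also have "often \<inter> (fst -` B \<inter> space P) = {p \<in> often. fst p \<in> B}" using often_sub by (auto simp: P_def space_\<Lambda>)
    finally show ?thesis .
  qed
  have e2: "emeasure M2 B = emeasure \<Lambda> {p \<in> often. snd p \<in> B}" if B: "B \<in> sets (borel_on X)" for B
  proof -
    have "emeasure M2 B = emeasure P (snd -` B \<inter> space P)" unfolding M2_def by (rule emeasure_distr[OF m2 B])
    also have "\<dots> = emeasure \<Lambda> (often \<inter> (snd -` B \<inter> space P))"
      unfolding P_def using oS measurable_sets[OF m2 B] by (subst emeasure_density) (auto simp: P_def simp flip: indicator_inter_arith)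
    also have "often \<inter> (snd -` B \<inter> space P) = {p \<in> often. snd p \<in> B}" using often_sub by (auto simp: P_def space_\<Lambda>)
    finally show ?thesis .
  qed
  have s1: "sets M1 = sets (borel_on X)" and s2: "sets M2 = sets (borel_on X)" by (simp_all add: M1_def M2_def)
  have sp1: "space M1 = X" by (simp add: M1_def)
  have tot: "emeasure M1 X = emeasure \<Lambda> often" "emeasure M2 X = emeasure \<Lambda> often"
  proof -
    have "{p \<in> often. fst p \<in> X} = often" "{p \<in> often. snd p \<in> X} = often" using often_sub by auto
    then show "emeasure M1 X = emeasure \<Lambda> often" "emeasure M2 X = emeasure \<Lambda> often" using e1[OF X_borel] e2[OF X_borel] by simp_all
  qed
  have f1: "finite_measure M1" using tot(1) by (intro finite_measureI) (simp add: sp1 emeasure_eq_measure)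
  interpret M1: finite_measure M1 by (rule f1)
  have "M1 = M2"
  proof (rule measure_eqI_cylinders[OF f1 s1 s2])
    fix C assume C: "C \<in> cylinders X"
    have XC: "X - C \<in> cylinders X" using C by auto
    have CX: "C \<subseteq> X" by (rule cylinders_subset[OF C])
    have CS: "C \<in> sets (borel_on X)" "X - C \<in> sets (borel_on X)" using C XC by (auto intro: cylinder_sets)
    have le: "emeasure M1 C \<le> emeasure M2 C" "emeasure M1 (X - C) \<le> emeasure M2 (X - C)"
      using often_swap_le[OF C] often_swap_le[OF XC] e1 e2 CS by auto
    have "emeasure M1 C + emeasure M1 (X - C) = emeasure M1 X" "emeasure M2 C + emeasure M2 (X - C) = emeasure M2 X"
      using plus_emeasure[of C M1 "X - C"] plus_emeasure[of C M2 "X - C"] CS s1 s2 CX by (auto simp: Un_absorb1)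
    then have sum: "emeasure M1 C + emeasure M1 (X - C) = emeasure M2 C + emeasure M2 (X - C)" using tot by simp
    show "emeasure M1 C = emeasure M2 C"
    proof (rule antisym[OF le(1)])
      have "emeasure M1 (X - C) + emeasure M2 C \<le> emeasure M1 (X - C) + emeasure M1 C"
        using add_left_mono[OF le(2), of "emeasure M2 C"] sum by (simp add: add.commute)
      then show "emeasure M2 C \<le> emeasure M1 C"
        using M1.emeasure_finite[of "X - C"] by (simp add: ennreal_add_left_cancel_le)
    qed
  qed
  have inv: "distr M1 M1 shift = M1"
  proof (rule measure_eqI)
    fix B assume "B \<in> sets (distr M1 M1 shift)"
    then have B: "B \<in> sets (borel_on X)" using s1 by simp
    have mT: "translate 1 \<in> M1 \<rightarrow>\<^sub>M M1" using measurable_translate s1 by (simp cong: measurable_cong_sets)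
    have TB: "translate 1 -` B \<inter> X \<in> sets (borel_on X)" using measurable_sets[OF measurable_translate B] by simp
    have D: "{p \<in> often. fst p \<in> B} \<in> sets pair_space" using sets_fst_in[OF sets_often B] sets_\<Lambda> by simp
    have "emeasure (distr M1 M1 shift) B = emeasure M1 (translate 1 -` B \<inter> X)"
      using emeasure_distr[OF mT, of B] B s1 by (simp add: shift_eq_translate sp1)
    also have "\<dots> = emeasure \<Lambda> {p \<in> often. fst p \<in> translate 1 -` B \<inter> X}" by (rule e1[OF TB])
    also have "{p \<in> often. fst p \<in> translate 1 -` B \<inter> X} = {p \<in> X \<times> X. (translate 1 (fst p), translate 1 (snd p)) \<in> {p \<in> often. fst p \<in> B}}"
      using often_translate often_sub by auto
    also have "emeasure \<Lambda> \<dots> = emeasure \<Lambda> {p \<in> often. fst p \<in> B}" by (rule joining_translate[OF fibre1 fibre2 D])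
    also have "\<dots> = emeasure M1 B" by (rule e1[OF B, symmetric])
    finally show "emeasure (distr M1 M1 shift) B = emeasure M1 B" .
  qed simp
  note D1 = invariant_fibreD[OF fibre1] and D2 = invariant_fibreD[OF fibre2]
  have S1: "shift \<in> \<mu>\<^sub>1 \<rightarrow>\<^sub>M \<mu>\<^sub>1" "shift \<in> \<mu>\<^sub>2 \<rightarrow>\<^sub>M \<mu>\<^sub>2"
    unfolding shift_eq_translate by (rule measurable_translate_invariant D1 D2)+
  have le1: "emeasure M1 B \<le> emeasure \<mu>\<^sub>1 B" if "B \<in> sets \<mu>\<^sub>1" for B
  proof -
    have B: "B \<in> sets (borel_on X)" using that D1(2) by simp
    have "emeasure M1 B \<le> emeasure \<Lambda> (B \<times> X)"
      unfolding e1[OF B] using B X_borel often_sub sets_\<Lambda> by (intro emeasure_mono) auto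
    then show ?thesis using joining_fst[OF fibre1 fibre2 B] by simp
  qed
  have le2: "emeasure M1 B \<le> emeasure \<mu>\<^sub>2 B" if "B \<in> sets \<mu>\<^sub>2" for B
  proof -
    have B: "B \<in> sets (borel_on X)" using that D2(2) by simp
    have "emeasure M1 B \<le> emeasure \<Lambda> (X \<times> B)"
      unfolding \<open>M1 = M2\<close> e2[OF B] using B X_borel often_sub sets_\<Lambda> by (intro emeasure_mono) auto
    then show ?thesis using joining_snd[OF fibre1 fibre2 B] by simp
  qed
  have erg: "ergodic_measure X \<mu>\<^sub>1" "ergodic_measure X \<mu>\<^sub>2"
    using max1 max2 by (auto simp: ergodic_relative_maximal_entropy_def)
  have c: "measure M1 X \<noteq> 0"
  proof
    assume "measure M1 X = 0"
    then have "often \<in> null_sets \<Lambda>" using tot(1) oS by (simp add: M1.emeasure_eq_measure null_sets_def)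
    then have "often \<union> (meets i - often) \<in> null_sets \<Lambda>" using meets_recurrent by (rule null_sets.Un)
    then have "meets i \<in> null_sets \<Lambda>" by (rule null_sets_subset) (use meets_sets_\<Lambda> in auto)
    then show False using pos by auto
  qed
  show ?thesis
  proof (rule measure_eqI)
    show "sets \<mu>\<^sub>1 = sets \<mu>\<^sub>2" using D1(2) D2(2) by simp
    fix B assume "B \<in> sets \<mu>\<^sub>1"
    then have B: "B \<in> sets \<mu>\<^sub>1" "B \<in> sets \<mu>\<^sub>2" using D1(2) D2(2) by auto
    have "measure M1 B = measure M1 X * measure \<mu>\<^sub>1 B"
      using dominated_invariant_eq_multiple[OF erg(1) S1(1) _ inv le1 B(1)] s1 D1(2,3) by simp
    moreover have "measure M1 B = measure M1 X * measure \<mu>\<^sub>2 B"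
      using dominated_invariant_eq_multiple[OF erg(2) S1(2) _ inv le2 B(2)] s1 D2(2,3) by simp
    ultimately have "measure \<mu>\<^sub>1 B = measure \<mu>\<^sub>2 B" using c by simp
    then show "emeasure \<mu>\<^sub>1 B = emeasure \<mu>\<^sub>2 B"
      using finite_measure.emeasure_eq_measure[OF prob_space.finite_measure[OF D1(1)]]
        finite_measure.emeasure_eq_measure[OF prob_space.finite_measure[OF D2(1)]] by simp
  qed
qed

end

end

theorem theorem5p7:
  fixes X :: "(int \<Rightarrow> 'a::discrete_topology) set"
    and Y :: "(int \<Rightarrow> 'b::discrete_topology) set"
    and \<pi> :: "(int \<Rightarrow> 'a) \<Rightarrow> (int \<Rightarrow> 'b)"
    and \<nu> :: "(int \<Rightarrow> 'b) measure"
    and \<mu>\<^sub>1 \<mu>\<^sub>2 :: "(int \<Rightarrow> 'a) measure"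
  assumes "factor_triple X Y \<pi>"
    and "ergodic_measure Y \<nu>"
    and "ergodic_relative_maximal_entropy X Y \<pi> \<nu> \<mu>\<^sub>1"
    and "ergodic_relative_maximal_entropy X Y \<pi> \<nu> \<mu>\<^sub>2"
    and "\<mu>\<^sub>1 \<noteq> \<mu>\<^sub>2"
  shows "{(u, v) \<in> X \<times> X. transition_equiv X \<pi> u v}
           \<in> null_sets (relatively_independent_joining X Y \<pi> \<nu> \<mu>\<^sub>1 \<mu>\<^sub>2)"
proof -
  obtain A K r where "sliding_block_code X Y \<pi> A K r"
    using factor_triple_sliding_block_code[OF assms(1)] .
  then interpret sliding_block_code X Y \<pi> A K r .
  have "{p \<in> X \<times> X. transition_equiv X \<pi> (fst p) (snd p)}
      \<in> null_sets (relatively_independent_joining X Y \<pi> \<nu> \<mu>\<^sub>1 \<mu>\<^sub>2)"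
    using transition_equiv_null[OF assms(3,4)] meeting_measures_equal[OF assms(3,4)] assms(5) by blast
  moreover have "{p \<in> X \<times> X. transition_equiv X \<pi> (fst p) (snd p)} = {(u, v) \<in> X \<times> X. transition_equiv X \<pi> u v}"
    by auto
  ultimately show ?thesis by simp
qed

end
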